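(* Assume that $f(t,\cdot,\cdot,\cdot)$ (for every $t\in\mathcal T$) and $g$ are continuous, that $(x,a)\mapsto\mathbb P_t^0(x,a,\cdot)$ is weakly continuous for every $t\in\mathcal T$, and that the policy class is regular (see context). Fix $t\in\mathcal T$, $(x,a)\in\mathcal X\times A$, $\theta\in\mathrm{int}(\Theta)$ and a direction $r\in\mathbb R^{d_\theta}$. Assume that $D^+_\theta V_{t+1}^\theta(y)[r]$ exists for every $y\in\mathcal X$, that $$\sup_{y\in\mathcal X}\Big|\frac{V_{t+1}^{\theta+hr}(y)-V_{t+1}^\theta(y)}{h}-D_\theta^+V_{t+1}^\theta(y)[r]\Big|\xrightarrow[h\downarrow0]{}0,$$ and that $y\mapsto D_\theta^+V_{t+1}^\theta(y)[r]$ belongs to $C(\mathcal X;\mathbb R)$. Let $$\Phi_t(\mathbb P,\theta):=\int_{\mathcal X}\big(f(t,x,a,y)+V_{t+1}^\theta(y)\big)\mathbb P(dy),\qquad \mathcal P_t^*(x,a,\theta):=\arg\min_{\mathbb P\in\mathbb B_t(x,a)}\Phi_t(\mathbb P,\theta).$$ Then the right directional derivative of $\theta\mapsto G_t^\theta(x,a)$ in direction $r$ exists and $$D_\theta^+G_t^\theta(x,a)[r]=\min_{\mathbb P^*\in\mathcal P_t^*(x,a,\theta)}\int_{\mathcal X}D_\theta^+V_{t+1}^\theta(y)[r]\,\mathbb P^*(dy).$$ Likewise, if the same hypothesis holds on the left (uniform convergence of the quotients as $h\uparrow0$ to $D_\theta^-V_{t+1}^\theta(\cdot)[r]\in C(\mathcal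 X;\mathbb R)$), then $$D_\theta^-G_t^\theta(x,a)[r]=\max_{\mathbb P^*\in\mathcal P_t^*(x,a,\theta)}\int_{\mathcal X}D_\theta^-V_{t+1}^\theta(y)[r]\,\mathbb P^*(dy).$$
   Context: Model. $\mathcal X\subset\mathbb R^d$, $A\subset\mathbb R^m$ are nonempty compact sets, $T\ge1$ an integer, $\mathcal T=\{0,\dots,T-1\}$, $\bar{\mathcal T}=\{0,\dots,T\}$, $q\ge1$ an integer, $\varepsilon>0$, $c(x,y)=\|x-y\|^q$ (Euclidean norm). $\mathcal P(\mathcal X)$ is the set of Borel probability measures on $\mathcal X$ and $W_q$ the $q$-Wasserstein distance for the Euclidean metric. Rewards: Borel $f:\mathcal T\times\mathcal X\times A\times\mathcal X\to\mathbb R$, $g:\mathcal X\to\mathbb R$. For $t\in\mathcal T$, $\mathbb P_t^0$ is a Borel (nominal) transition kernel from $\mathcal X\times A$ to $\mathcal X$, and $\mathbb B_t(x,a)=\{\mathbb P\in\mathcal P(\mathcal X):W_q(\mathbb P,\mathbb P_t^0(x,a,\cdot))\le\varepsilon\}$. Policies. $\Theta\subset\mathbb R^{d_\theta}$ is compact, $\nu$ is a reference measure on $A$, and for $\theta\in\Theta$, $\pi_t^\theta(x,da)=\pi_t^\theta(x,a)\,\nu(da)$ is a probability measure on $A$ for each $(t,x)\in\mathcal T\times\mathcal X$. The policy class is regular if for each $t$: $(\theta,x)\mapsto\pi_t^\theta(x,\cdot)$ is weakly continuous on $\Theta\times\mathcal X$; for every $\varphi\in C(A)$, $\theta\mapsto\int_A\varphi(a)\pi_t^\theta(x,da)$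 is $C^1$ on $\Theta$ with derivative continuous in $(\theta,x)$; and the score $\nabla_\theta\log\pi_t^\theta(x,a)$ exists with $\sup_{\theta,t,x,a}\|\nabla_\theta\log\pi_t^\theta(x,a)\|<\infty$. Value functions. $V_t^\theta(x)=\inf\mathbb E\big[\sum_{l=t}^{T-1}f(l,X_l,a_l,X_{l+1})+g(X_T)\big]$, the infimum being over path laws $\delta_x(dx_t)\prod_{l=t}^{T-1}\pi_l^\theta(x_l,da_l)\mathbb P_l(x_l,a_l,dx_{l+1})$ with Borel kernels $\mathbb P_l$ such that $\mathbb P_l(x',a',\cdot)\in\mathbb B_l(x',a')$ for all $(x',a')$. Robust state-action value: $$G_t^\theta(x,a)=\sup_{\lambda\ge0}\Big\{\int_{\mathcal X}\inf_{y\in\mathcal X}\{f(t,x,a,y)+V_{t+1}^\theta(y)+\lambda c(x',y)\}\,\mathbb P_t^0(x,a,dx')-\varepsilon^q\lambda\Big\},$$ which by Wasserstein duality equals $\inf_{\mathbb P\in\mathbb B_t(x,a)}\int(f(t,x,a,y)+V_{t+1}^\theta(y))\mathbb P(dy)$. The dynamic programming recursion is $V_T^\theta=g$, $V_t^\theta(x)=\int_AG_t^\theta(x,a)\pi_t^\theta(x,da)$. Directional derivatives. $D_\theta^+\phi(\theta)[r]=\lim_{h\downarrow0}(\phi(\theta+hr)-\phi(\theta))/h$, $D_\theta^-\phi(\theta)[r]=\lim_{h\uparrow0}(\phi(\theta+hr)-\phi(\theta))/h$. *)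

theory Defs
  imports "HOL-Probability.Probability"
begin

text \<open>
  Borel probability measures on a subset \<open>S\<close> of a Euclidean space are the elements of
  \<open>\<P> S = space (prob_algebra (restrict_space borel S))\<close>; Borel kernels are measurable maps
  into \<open>prob_algebra (restrict_space borel S)\<close>.
\<close>

abbreviation prob_measures :: "'a::topological_space set \<Rightarrow> 'a measure set" ("\<P>") where
  "\<P> S \<equiv> space (prob_algebra (restrict_space borel S))"

text \<open>
  Continuity for the weak topology on \<open>\<P> S\<close>, which is the initial topology of the functionals
  \<open>\<mu> \<mapsto> \<integral>\<phi> d\<mu>\<close> with \<open>\<phi>\<close> bounded and continuous on \<open>S\<close>.
\<close>

definition weakly_continuous_on ::
  "'z::topological_space set \<Rightarrow> 'a::topological_space set \<Rightarrow> ('z \<Rightarrow> 'a measure) \<Rightarrow> bool" where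
  "weakly_continuous_on D S K \<longleftrightarrow>
     (\<forall>\<phi> :: 'a \<Rightarrow> real. continuous_on S \<phi> \<and> bounded (\<phi> ` S) \<longrightarrow>
        continuous_on D (\<lambda>z. \<integral>y. \<phi> y \<partial>K z))"

definition couplings :: "'a measure \<Rightarrow> 'a measure \<Rightarrow> ('a \<times> 'a) measure set" where
  "couplings \<mu> \<nu> = {\<gamma>. sets \<gamma> = sets (\<mu> \<Otimes>\<^sub>M \<nu>) \<and> distr \<gamma> \<mu> fst = \<mu> \<and> distr \<gamma> \<nu> snd = \<nu>}"

text \<open>
  The real-valued integral and infimum are only meaningful for measures with finite \<open>q\<close>-th moments;
  below, \<open>wasserstein\<close> is only applied to probability measures on a bounded set.
\<close>

definition wasserstein :: "nat \<Rightarrow> 'a::euclidean_space measure \<Rightarrow> 'a measure \<Rightarrow> real" where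
  "wasserstein q \<mu> \<nu> = root q (INF \<gamma>\<in>couplings \<mu> \<nu>. \<integral>z. norm (fst z - snd z) ^ q \<partial>\<gamma>)"

text \<open>
  One-sided directional derivatives. The left quotient keeps the signed denominator \<open>h < 0\<close>.
\<close>

definition has_right_dir_deriv ::
  "('p::real_normed_vector \<Rightarrow> real) \<Rightarrow> 'p \<Rightarrow> 'p \<Rightarrow> real \<Rightarrow> bool" where
  "has_right_dir_deriv \<phi> \<theta> r L \<longleftrightarrow>
     ((\<lambda>h. (\<phi> (\<theta> + h *\<^sub>R r) - \<phi> \<theta>) / h) \<longlongrightarrow> L) (at_right 0)"

definition has_left_dir_deriv ::
  "('p::real_normed_vector \<Rightarrow> real) \<Rightarrow> 'p \<Rightarrow> 'p \<Rightarrow> real \<Rightarrow> bool" where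
  "has_left_dir_deriv \<phi> \<theta> r L \<longleftrightarrow>
     ((\<lambda>h. (\<phi> (\<theta> + h *\<^sub>R r) - \<phi> \<theta>) / h) \<longlongrightarrow> L) (at_left 0)"


section \<open>The model\<close>

text \<open>
  In the notation of the paper, the fields are \<open>\<X>\<close>, \<open>A\<close>, \<open>T\<close>, \<open>q\<close>, \<open>\<epsilon>\<close>, \<open>f\<close>, \<open>g\<close>, \<open>P\<^sup>0\<close>, \<open>\<Theta>\<close>, \<open>\<nu>\<close>
  and the policy density \<open>(t, \<theta>, x, a) \<mapsto> \<pi>\<^sub>t\<^sup>\<theta>(x, a)\<close> with respect to \<open>\<nu>\<close>.
\<close>

record ('d, 'm, 'p) robust_mdp =
  states :: "(real ^ 'd::finite) set"
  actions :: "(real ^ 'm::finite) set"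
  horizon :: nat
  expo :: nat
  radius :: real
  run_reward :: "nat \<Rightarrow> real ^ 'd \<Rightarrow> real ^ 'm \<Rightarrow> real ^ 'd \<Rightarrow> real"
  term_reward :: "real ^ 'd \<Rightarrow> real"
  nominal :: "nat \<Rightarrow> real ^ 'd \<Rightarrow> real ^ 'm \<Rightarrow> (real ^ 'd) measure"
  params :: "(real ^ 'p::finite) set"
  ref_measure :: "(real ^ 'm) measure"
  policy_density :: "nat \<Rightarrow> real ^ 'p \<Rightarrow> real ^ 'd \<Rightarrow> real ^ 'm \<Rightarrow> real"

abbreviation state_space ::
  "('d::finite, 'm::finite, 'p::finite) robust_mdp \<Rightarrow> (real ^ 'd) measure" where
  "state_space M \<equiv> restrict_space borel (states M)"

abbreviation action_space ::
  "('d::finite, 'm::finite, 'p::finite) robust_mdp \<Rightarrow> (real ^ 'm) measure" where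
  "action_space M \<equiv> restrict_space borel (actions M)"

definition policy ::
  "('d::finite, 'm::finite, 'p::finite) robust_mdp \<Rightarrow> nat \<Rightarrow> real ^ 'p \<Rightarrow> real ^ 'd \<Rightarrow> (real ^ 'm) measure"
where
  "policy M t \<theta> x = density (ref_measure M) (\<lambda>a. ennreal (policy_density M t \<theta> x a))"

definition wf_robust_mdp :: "('d::finite, 'm::finite, 'p::finite) robust_mdp \<Rightarrow> bool" where
  "wf_robust_mdp M \<longleftrightarrow>
     compact (states M) \<and> states M \<noteq> {} \<and>
     compact (actions M) \<and> actions M \<noteq> {} \<and>
     horizon M \<ge> 1 \<and> expo M \<ge> 1 \<and> radius M > 0 \<and>
     (\<forall>t<horizon M.
        (\<lambda>(x, a, y). run_reward M t x a y)
          \<in> borel_measurable (restrict_space borel (states M \<times> actions M \<times> states M))) \<and>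
     term_reward M \<in> borel_measurable (state_space M) \<and>
     (\<forall>t<horizon M.
        (\<lambda>(x, a). nominal M t x a)
          \<in> state_space M \<Otimes>\<^sub>M action_space M \<rightarrow>\<^sub>M prob_algebra (state_space M)) \<and>
     compact (params M) \<and>
     sets (ref_measure M) = sets (action_space M) \<and>
     (\<forall>t<horizon M. \<forall>\<theta>\<in>params M. \<forall>x\<in>states M.
        policy_density M t \<theta> x \<in> borel_measurable (ref_measure M) \<and>
        (\<forall>a\<in>actions M. policy_density M t \<theta> x a \<ge> 0) \<and>
        prob_space (policy M t \<theta> x))"

text \<open>
  Regularity of the policy class. As \<open>\<Theta>\<close> is merely compact, derivatives in \<open>\<theta>\<close> are taken within
  \<open>\<Theta>\<close>, i.e. they are ordinary gradients at interior points. Positivity of the density is part of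
  the existence of the score, since in HOL \<open>ln\<close> is total.
\<close>

definition regular_policy_class :: "('d::finite, 'm::finite, 'p::finite) robust_mdp \<Rightarrow> bool" where
  "regular_policy_class M \<longleftrightarrow>
     (\<forall>t<horizon M.
        weakly_continuous_on (params M \<times> states M) (actions M) (\<lambda>(\<theta>, x). policy M t \<theta> x)) \<and>
     (\<forall>t<horizon M. \<forall>\<phi> :: real ^ 'm \<Rightarrow> real. continuous_on (actions M) \<phi> \<longrightarrow>
        (\<exists>D :: real ^ 'p \<Rightarrow> real ^ 'd \<Rightarrow> real ^ 'p.
           (\<forall>\<theta>\<in>params M. \<forall>x\<in>states M.
              ((\<lambda>\<theta>'. \<integral>a. \<phi> a \<partial>policy M t \<theta>' x) has_derivative (\<lambda>v. D \<theta> x \<bullet> v))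
                (at \<theta> within params M)) \<and>
           continuous_on (params M \<times> states M) (\<lambda>(\<theta>, x). D \<theta> x))) \<and>
     (\<exists>(score :: nat \<Rightarrow> real ^ 'p \<Rightarrow> real ^ 'd \<Rightarrow> real ^ 'm \<Rightarrow> real ^ 'p) C.
        \<forall>t<horizon M. \<forall>\<theta>\<in>params M. \<forall>x\<in>states M. \<forall>a\<in>actions M.
          policy_density M t \<theta> x a > 0 \<and>
          ((\<lambda>\<theta>'. ln (policy_density M t \<theta>' x a)) has_derivative (\<lambda>v. score t \<theta> x a \<bullet> v))
            (at \<theta> within params M) \<and>
          norm (score t \<theta> x a) \<le> C)"

definition ambiguity_set ::
  "('d::finite, 'm::finite, 'p::finite) robust_mdp \<Rightarrow> nat \<Rightarrow> real ^ 'd \<Rightarrow> real ^ 'm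
     \<Rightarrow> (real ^ 'd) measure set" where
  "ambiguity_set M t x a =
     {P \<in> \<P> (states M). wasserstein (expo M) P (nominal M t x a) \<le> radius M}"


section \<open>Path laws and robust values\<close>

text \<open>
  A path of \<open>n\<close> steps starting at time \<open>t\<close> is a pair \<open>(\<xi>, \<alpha>)\<close> of the states at times
  \<open>t, \<dots>, t + n\<close> and the actions at times \<open>t, \<dots>, t + n - 1\<close>. The law \<open>path_law M P \<theta> t x n\<close> is
  \<open>\<delta>\<^sub>x(dx\<^sub>t) \<Prod>\<^sub>l \<pi>\<^sub>l\<^sup>\<theta>(x\<^sub>l, da\<^sub>l) P\<^sub>l(x\<^sub>l, a\<^sub>l, dx\<^sub>l\<^sub>+\<^sub>1)\<close>, built up one step at a time in the Giry monad.
\<close>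

definition path_space ::
  "('d::finite, 'm::finite, 'p::finite) robust_mdp \<Rightarrow> nat \<Rightarrow> nat
     \<Rightarrow> ((nat \<Rightarrow> real ^ 'd) \<times> (nat \<Rightarrow> real ^ 'm)) measure" where
  "path_space M t n =
     PiM {t..t + n} (\<lambda>_. state_space M) \<Otimes>\<^sub>M PiM {t..<t + n} (\<lambda>_. action_space M)"

primrec path_law ::
  "('d::finite, 'm::finite, 'p::finite) robust_mdp
     \<Rightarrow> (nat \<Rightarrow> real ^ 'd \<Rightarrow> real ^ 'm \<Rightarrow> (real ^ 'd) measure) \<Rightarrow> real ^ 'p \<Rightarrow> nat \<Rightarrow> real ^ 'd \<Rightarrow> nat
     \<Rightarrow> ((nat \<Rightarrow> real ^ 'd) \<times> (nat \<Rightarrow> real ^ 'm)) measure" where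
  "path_law M P \<theta> t x 0 = return (path_space M t 0) (\<lambda>i\<in>{t}. x, \<lambda>i. undefined)"
| "path_law M P \<theta> t x (Suc n) =
     path_law M P \<theta> t x n \<bind> (\<lambda>(\<xi>, \<alpha>).
       policy M (t + n) \<theta> (\<xi> (t + n)) \<bind> (\<lambda>a.
         distr (P (t + n) (\<xi> (t + n)) a) (path_space M t (Suc n))
           (\<lambda>y. (\<xi>(Suc (t + n) := y), \<alpha>(t + n := a)))))"

definition adversary_kernels ::
  "('d::finite, 'm::finite, 'p::finite) robust_mdp \<Rightarrow> nat
     \<Rightarrow> (nat \<Rightarrow> real ^ 'd \<Rightarrow> real ^ 'm \<Rightarrow> (real ^ 'd) measure) set" where
  "adversary_kernels M t =
     {P. \<forall>l\<in>{t..<horizon M}.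
        (\<lambda>(x, a). P l x a) \<in> state_space M \<Otimes>\<^sub>M action_space M \<rightarrow>\<^sub>M prob_algebra (state_space M) \<and>
        (\<forall>x\<in>states M. \<forall>a\<in>actions M. P l x a \<in> ambiguity_set M l x a)}"

definition robust_value ::
  "('d::finite, 'm::finite, 'p::finite) robust_mdp \<Rightarrow> nat \<Rightarrow> real ^ 'p \<Rightarrow> real ^ 'd \<Rightarrow> real" where
  "robust_value M t \<theta> x =
     (INF P\<in>adversary_kernels M t.
        \<integral>(\<xi>, \<alpha>). (\<Sum>l=t..<horizon M. run_reward M l (\<xi> l) (\<alpha> l) (\<xi> (Suc l)))
                  + term_reward M (\<xi> (horizon M))
          \<partial>path_law M P \<theta> t x (horizon M - t))"

definition robust_action_value ::
  "('d::finite, 'm::finite, 'p::finite) robust_mdp \<Rightarrow> nat \<Rightarrow> real ^ 'p \<Rightarrow> real ^ 'd \<Rightarrow> real ^ 'm \<Rightarrow> real"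
where
  "robust_action_value M t \<theta> x a =
     (SUP \<kappa>\<in>{0..}.
        (\<integral>x'. (INF y\<in>states M.
                 run_reward M t x a y + robust_value M (Suc t) \<theta> y + \<kappa> * norm (x' - y) ^ expo M)
           \<partial>nominal M t x a)
        - radius M ^ expo M * \<kappa>)"

definition worst_case_objective ::
  "('d::finite, 'm::finite, 'p::finite) robust_mdp \<Rightarrow> nat \<Rightarrow> real ^ 'd \<Rightarrow> real ^ 'm
     \<Rightarrow> (real ^ 'd) measure \<Rightarrow> real ^ 'p \<Rightarrow> real" where
  "worst_case_objective M t x a P \<theta> =
     (\<integral>y. run_reward M t x a y + robust_value M (Suc t) \<theta> y \<partial>P)"

definition worst_case_measures ::
  "('d::finite, 'm::finite, 'p::finite) robust_mdp \<Rightarrow> nat \<Rightarrow> real ^ 'd \<Rightarrow> real ^ 'm \<Rightarrow> real ^ 'p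
     \<Rightarrow> (real ^ 'd) measure set" where
  "worst_case_measures M t x a \<theta> =
     {P. is_arg_min (\<lambda>P. worst_case_objective M t x a P \<theta>) (\<lambda>P. P \<in> ambiguity_set M t x a) P}"

end

theory Submission
  imports Defs
begin

text \<open>
  By Wasserstein duality the robust action value is the infimum of \<open>P \<mapsto> \<integral>(f + V) dP\<close> over the
  Wasserstein ball, which is weakly sequentially compact, so the claim is Danskin's theorem for that
  infimum: minimizers of the perturbed problems accumulate at a minimizer of the unperturbed one. The
  left derivative is minus the right derivative in the opposite direction.

  Attainment and duality need \<open>V\<close> to be continuous, which is not assumed. It follows by comparing the
  infimum over adversaries with value iteration: value iterates are continuous because the dual is
  jointly continuous in state and action, and Borel adversaries that are optimal up to \<open>\<delta>\<close> per step are
  built explicitly from Gibbs weights on a finite net, without a measurable selection theorem.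
\<close>

section \<open>Weak sequential compactness\<close>

text \<open>Continuity in (x, a) of an infimum over balls whose centre moves is hard to read off
  from the balls. In the dual the centre occurs only as the integrating measure, so weak continuity
  of the nominal kernel applies directly. The reverse inequality needs adversaries that are Borel in
  (x, a); as values are infima, a loss of \<delta> per stage is harmless, and averages over a finite
  net can replace exact minimizers. The same construction over a one-point parameter set yields
  strong duality for a single ball, so there is no separate minimax argument. Compactness is made
  concrete as well: a compact Euclidean set is a continuous image of a compact set of reals, so
  sequences of measures can be carried to the line and back. In the envelope argument the measures
  carry no topology; only two functionals need to converge along subsequences, the unperturbed
  objective and the candidate derivative. This suffices because the perturbed objective has a
  first-order expansion in h whose error is uniform over the ball.\<close>

definition bitseqs :: "(nat \<Rightarrow> real) set" where
  "bitseqs = {b. \<forall>k. b k \<in> {0, 1}}"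

text \<open>Radix expansion with weights starting at \<open>c ^ 0\<close>. On 0-1 sequences, ratio
  1/4 makes it injective with a Cantor set as range, and ratio 1/2 makes it cover [0, 2]. Both
  occur: the first encodes a sequence as a real number, the second decodes it as a
  coordinate.\<close>

definition digit_sum :: "real \<Rightarrow> (nat \<Rightarrow> real) \<Rightarrow> real" where
  "digit_sum c b = (\<Sum>k. b k * c ^ k)"

lemma bitseqs_cases: "b \<in> bitseqs \<Longrightarrow> b k = 0 \<or> b k = 1"
  by (auto simp: bitseqs_def)

text \<open>Tychonoff's theorem. The digits are the reals 0 and 1, so that the product topology is
  the one the function type already carries.\<close>

lemma compact_bitseqs: "compact bitseqs"
proof -
  have [simp]: "bitseqs = PiE UNIV (\<lambda>_. {0, 1})"
    by (auto simp: bitseqs_def PiE_iff)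
  then have "compactin (product_topology (\<lambda>_::nat. euclideanreal) UNIV) bitseqs"
    by (simp add: compactin_PiE)
  then show ?thesis
    by (simp add: euclidean_product_topology)
qed

lemma norm_digit_le:
  assumes "0 < c" "b \<in> bitseqs"
  shows "norm (b k * c ^ k) \<le> c ^ k"
  using bitseqs_cases[OF assms(2), of k] assms(1) by (elim disjE) simp_all

lemma summable_digits:
  assumes "0 < c" "c < 1" "b \<in> bitseqs"
  shows "summable (\<lambda>k. b k * c ^ k)"
proof (rule summable_comparison_test'[where g="\<lambda>k. c ^ k" and N=0])
  show "summable (\<lambda>k. c ^ k)"
    using assms by (intro summable_geometric) auto
  show "norm (b k * c ^ k) \<le> c ^ k" for k
    by (rule norm_digit_le[OF assms(1,3)])
qed

lemma digit_sum_bounds: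
  assumes "0 < c" "c < 1" "b \<in> bitseqs"
  shows "0 \<le> digit_sum c b" "digit_sum c b \<le> 1 / (1 - c)"
proof -
  show "0 \<le> digit_sum c b"
    unfolding digit_sum_def using bitseqs_cases[OF assms(3)] assms(1)
    by (intro suminf_nonneg summable_digits assms) (metis mult_1 mult_zero_left order_refl zero_le_power less_imp_le)
  have "digit_sum c b \<le> (\<Sum>k. c ^ k)"
    unfolding digit_sum_def
  proof (intro suminf_le summable_digits assms)
    show "b k * c ^ k \<le> c ^ k" for k
      using norm_digit_le[OF assms(1,3), of k] by simp
    show "summable (\<lambda>k. c ^ k)"
      using assms by (intro summable_geometric) auto
  qed
  then show "digit_sum c b \<le> 1 / (1 - c)"
    using assms by (simp add: suminf_geometric)
qed

lemma digit_sum_split: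
  assumes "0 < c" "c < 1" "b \<in> bitseqs"
  shows "digit_sum c b = b 0 + c * digit_sum c (\<lambda>k. b (Suc k))"
proof -
  have b': "(\<lambda>k. b (Suc k)) \<in> bitseqs" using assms(3) by (auto simp: bitseqs_def)
  have "digit_sum c b = (\<Sum>k. b (Suc k) * c ^ Suc k) + b 0"
    unfolding digit_sum_def using suminf_split_head[OF summable_digits[OF assms]] by simp
  also have "(\<Sum>k. b (Suc k) * c ^ Suc k) = (\<Sum>k. c * (b (Suc k) * c ^ k))"
    by (simp add: mult_ac)
  also have "\<dots> = c * digit_sum c (\<lambda>k. b (Suc k))"
    unfolding digit_sum_def by (rule suminf_mult[OF summable_digits[OF assms(1,2) b']])
  finally show ?thesis by simp
qed

lemma continuous_on_digit_sum:
  assumes "0 < c" "c < 1"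
  shows "continuous_on bitseqs (digit_sum c)"
proof -
  have "uniform_limit bitseqs (\<lambda>n b. \<Sum>k<n. b k * c ^ k) (\<lambda>b. \<Sum>k. b k * c ^ k) sequentially"
    using assms by (intro Weierstrass_m_test[where M="\<lambda>k. c ^ k"] norm_digit_le summable_geometric) auto
  then show ?thesis
    unfolding digit_sum_def[abs_def]
  proof (rule uniform_limit_theorem[rotated])
    have "continuous_on bitseqs (\<lambda>b::nat \<Rightarrow> real. b k)" for k
      by (rule continuous_on_subset[OF continuous_on_product_coordinates]) simp
    then show "\<forall>\<^sub>F n in sequentially. continuous_on bitseqs (\<lambda>b. \<Sum>k<n. b k * c ^ k)"
      by (intro always_eventually allI continuous_intros) 
  qed simp
qed

text \<open>With ratio 1/4 the digits after the first contribute at most 1/4 * 4/3 = 1/3 < 1, so the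
  value determines the first digit. Removing it and rescaling gives the induction on the
  position.\<close>

lemma inj_on_digit_sum: "inj_on (digit_sum (1/4)) bitseqs"
proof -
  have "b k = b' k" if "b \<in> bitseqs" "b' \<in> bitseqs" "digit_sum (1/4) b = digit_sum (1/4) b'" for b b' k
    using that
  proof (induction k arbitrary: b b')
    case (0 b b')
    have s: "(\<lambda>k. b (Suc k)) \<in> bitseqs" "(\<lambda>k. b' (Suc k)) \<in> bitseqs"
      using 0 by (auto simp: bitseqs_def)
    have "b 0 + 1/4 * digit_sum (1/4) (\<lambda>k. b (Suc k)) = b' 0 + 1/4 * digit_sum (1/4) (\<lambda>k. b' (Suc k))"
      using 0 digit_sum_split[of "1/4" b] digit_sum_split[of "1/4" b'] by simp
    then show ?case
      using digit_sum_bounds[OF _ _ s(1), of "1/4"] digit_sum_bounds[OF _ _ s(2), of "1/4"]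
        bitseqs_cases[OF 0(1), of 0] bitseqs_cases[OF 0(2), of 0] by auto
  next
    case (Suc k b b')
    have s: "(\<lambda>k. b (Suc k)) \<in> bitseqs" "(\<lambda>k. b' (Suc k)) \<in> bitseqs"
      using Suc.prems by (auto simp: bitseqs_def)
    have eq: "b 0 + 1/4 * digit_sum (1/4) (\<lambda>k. b (Suc k)) = b' 0 + 1/4 * digit_sum (1/4) (\<lambda>k. b' (Suc k))"
      using Suc.prems digit_sum_split[of "1/4" b] digit_sum_split[of "1/4" b'] by simp
    moreover have "b 0 = b' 0"
      using eq digit_sum_bounds[OF _ _ s(1), of "1/4"] digit_sum_bounds[OF _ _ s(2), of "1/4"]
        bitseqs_cases[OF Suc.prems(1), of 0] bitseqs_cases[OF Suc.prems(2), of 0] by auto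
    ultimately have "digit_sum (1/4) (\<lambda>k. b (Suc k)) = digit_sum (1/4) (\<lambda>k. b' (Suc k))"
      by simp
    from Suc.IH[OF s this] show ?case .
  qed
  then show ?thesis by (auto intro!: inj_onI)
qed

text \<open>\<open>v\<close> is the orbit of u under the doubling map and \<open>b\<close> records
  its digits. After n digits the remainder is exactly \<open>2 * v n * (1/2) ^ n\<close>, which
  vanishes because the orbit stays in [0, 1]. The value is 2 * u since the leading digit has weight
  1 rather than 1/2.\<close>

lemma binary_expansion:
  fixes u :: real
  assumes "0 \<le> u" "u \<le> 1"
  obtains b where "b \<in> bitseqs" "digit_sum (1/2) b = 2 * u"
proof -
  define d where "d v = (if v \<ge> 1/2 then 1 else 0 :: real)" for v :: real
  define v where "v n = ((\<lambda>v. 2 * v - d v) ^^ n) u" for n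
  have v_Suc: "v (Suc n) = 2 * v n - d (v n)" for n by (simp add: v_def)
  have v_range: "0 \<le> v n \<and> v n \<le> 1" for n
    by (induction n) (use assms in \<open>auto simp: v_Suc d_def v_def[of 0]\<close>)
  define b where "b n = d (v n)" for n
  have b: "b \<in> bitseqs" by (auto simp: b_def d_def bitseqs_def)
  have partial: "(\<Sum>k<n. b k * (1/2) ^ k) = 2 * u - 2 * v n * (1/2) ^ n" for n
  proof (induction n)
    case (Suc n)
    then show ?case by (simp add: v_Suc b_def algebra_simps)
  qed (simp add: v_def)
  have "(\<lambda>n. v n * (1/2) ^ n) \<longlonglongrightarrow> 0"
  proof (rule Lim_null_comparison)
    show "\<forall>\<^sub>F n in sequentially. norm (v n * (1/2) ^ n) \<le> (1/2) ^ n"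
      using v_range by (intro always_eventually allI) (simp add: abs_mult mult_left_le_one_le)
    show "(\<lambda>n. (1/2::real) ^ n) \<longlonglongrightarrow> 0" by (intro LIMSEQ_power_zero) simp
  qed
  then have "(\<lambda>n. 2 * u - 2 * (v n * (1/2) ^ n)) \<longlonglongrightarrow> 2 * u - 2 * 0"
    by (intro tendsto_intros)
  then have "(\<lambda>k. b k * (1/2) ^ k) sums (2 * u)"
    unfolding sums_def partial by (simp add: mult.assoc)
  then have "digit_sum (1/2) b = 2 * u"
    unfolding digit_sum_def by (rule sums_unique[symmetric])
  with b show ?thesis by (rule that)
qed

text \<open>A concrete form of the Hausdorff-Alexandroff theorem. One 0-1 sequence is split into as
  many subsequences as there are coordinates, and reading each in binary covers a cube around K. The
  code with ratio 1/4 turns the sequences into a compact set of reals, and C is the preimage of K in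
  it.\<close>

lemma compact_image_of_compact_real:
  fixes K :: "'a::euclidean_space set"
  assumes "compact K"
  obtains C :: "real set" and \<phi> where "compact C" "continuous_on C \<phi>" "\<phi> ` C = K"
proof -
  obtain R where R: "\<And>x. x \<in> K \<Longrightarrow> norm x \<le> R" "R > 0"
    using compact_imp_bounded[OF assms] unfolding bounded_pos by auto
  define enc where "enc i k = prod_encode (to_nat_on (Basis :: 'a set) i, k)" for i :: 'a and k :: nat
  \<comment> \<open>Binary digit sums fill [0, 2], so this affine map fills [-R, R], which contains
    all coordinates of points of K.\<close>
  define m where "m b = (\<Sum>i\<in>Basis. (- R + R * digit_sum (1/2) (\<lambda>k. b (enc i k))) *\<^sub>R i)" for b
  define \<psi> where "\<psi> = m \<circ> inv_into bitseqs (digit_sum (1/4))"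
  define D where "D = digit_sum (1/4) ` bitseqs"
  have "continuous_on bitseqs m"
    unfolding m_def
  proof (intro continuous_intros)
    fix i :: 'a
    show "continuous_on bitseqs (\<lambda>b. digit_sum (1/2) (\<lambda>k. b (enc i k)))"
      by (rule continuous_on_compose2[OF continuous_on_digit_sum[of "1/2"]])
        (auto simp: bitseqs_def intro!: continuous_on_coordinatewise_then_product
          continuous_on_subset[OF continuous_on_product_coordinates])
  qed
  moreover have "continuous_on D (inv_into bitseqs (digit_sum (1/4)))"
    unfolding D_def using compact_bitseqs inj_on_digit_sum
    by (intro continuous_on_inv continuous_on_digit_sum) (auto simp: inv_into_f_f)
  moreover have "inv_into bitseqs (digit_sum (1/4)) ` D \<subseteq> bitseqs"
    unfolding D_def by (auto intro: inv_into_into)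
  ultimately have cont: "continuous_on D \<psi>"
    unfolding \<psi>_def using continuous_on_compose continuous_on_subset by blast
  have D: "compact D"
    unfolding D_def by (intro compact_continuous_image continuous_on_digit_sum compact_bitseqs) auto
  have surj: "K \<subseteq> \<psi> ` D"
  proof
    fix x assume x: "x \<in> K"
    have range: "\<bar>x \<bullet> i\<bar> \<le> R" if "i \<in> Basis" for i
      using R(1)[OF x] Basis_le_norm[OF that, of x] by simp
    have "\<forall>i\<in>Basis. \<exists>b. b \<in> bitseqs \<and> digit_sum (1/2) b = 2 * ((x \<bullet> i + R) / (2 * R))"
    proof
      fix i :: 'a assume i: "i \<in> Basis"
      have "0 \<le> (x \<bullet> i + R) / (2 * R)" "(x \<bullet> i + R) / (2 * R) \<le> 1"
        using range[OF i] \<open>R > 0\<close> by (auto simp: field_simps)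
      then show "\<exists>b. b \<in> bitseqs \<and> digit_sum (1/2) b = 2 * ((x \<bullet> i + R) / (2 * R))"
        by (rule binary_expansion) blast
    qed
    then obtain b where b: "\<And>i. i \<in> Basis \<Longrightarrow> b i \<in> bitseqs"
        "\<And>i. i \<in> Basis \<Longrightarrow> digit_sum (1/2) (b i) = 2 * ((x \<bullet> i + R) / (2 * R))"
      by metis
    \<comment> \<open>Interleaves the binary expansions of the coordinates. Indices that encode no
      basis vector get the digit 0, so the result is still a 0-1 sequence.\<close>
    define \<beta> where "\<beta> n = (case prod_decode n of (j, k) \<Rightarrow>
      if j \<in> to_nat_on (Basis :: 'a set) ` Basis then b (from_nat_into Basis j) k else 0)" for n
    have \<beta>_enc: "\<beta> (enc i k) = b i k" if "i \<in> Basis" for i k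
      using that by (simp add: \<beta>_def enc_def countable_finite)
    have "\<beta> n \<in> {0, 1}" for n
      using bitseqs_cases[OF b(1)] by (fastforce simp: \<beta>_def countable_finite split: prod.splits)
    then have \<beta>: "\<beta> \<in> bitseqs" by (auto simp: bitseqs_def)
    have "m \<beta> = (\<Sum>i\<in>Basis. (x \<bullet> i) *\<^sub>R i)"
      unfolding m_def
    proof (rule sum.cong[OF refl])
      fix i :: 'a assume i: "i \<in> Basis"
      have "- R + R * digit_sum (1/2) (\<lambda>k. \<beta> (enc i k)) = x \<bullet> i"
        using b(2)[OF i] \<beta>_enc[OF i] \<open>R > 0\<close> by (simp add: field_simps)
      then show "(- R + R * digit_sum (1/2) (\<lambda>k. \<beta> (enc i k))) *\<^sub>R i = (x \<bullet> i) *\<^sub>R i" by simp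
    qed
    then have "\<psi> (digit_sum (1/4) \<beta>) = x"
      unfolding \<psi>_def using \<beta> inj_on_digit_sum by (simp add: inv_into_f_f euclidean_representation)
    then show "x \<in> \<psi> ` D" unfolding D_def using \<beta> by blast
  qed
  show thesis
  proof (rule that)
    have "closed (D \<inter> \<psi> -` K)"
      by (intro continuous_closed_preimage cont compact_imp_closed D assms)
    then show "compact (D \<inter> \<psi> -` K)"
      using D by (metis compact_Int_closed inf_left_idem)
    show "continuous_on (D \<inter> \<psi> -` K) \<psi>" by (rule continuous_on_subset[OF cont]) simp
    show "\<psi> ` (D \<inter> \<psi> -` K) = K" using surj by auto
  qed
qed

text \<open>The section selects the least point of each fibre. It is Borel because its sublevel set
  for c is the image of the compact set \<open>C \<inter> {..c}\<close>, hence compact.\<close>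

lemma borel_section_of_compact_real:
  fixes K :: "'a::euclidean_space set"
  assumes "compact K"
  obtains C :: "real set" and \<phi> s
  where "compact C" "continuous_on C \<phi>" "\<phi> ` C = K"
    "s \<in> borel_measurable (restrict_space borel K)" "\<And>x. x \<in> K \<Longrightarrow> s x \<in> C" "\<And>x. x \<in> K \<Longrightarrow> \<phi> (s x) = x"
proof -
  obtain C :: "real set" and \<phi> where C: "compact C" and \<phi>: "continuous_on C \<phi>" "\<phi> ` C = K"
    using compact_image_of_compact_real[OF assms] .
  define s where "s x = Inf (C \<inter> \<phi> -` {x})" for x
  have fibre: "compact (C \<inter> \<phi> -` {x})" for x
  proof -
    have "closed (C \<inter> \<phi> -` {x})"
      by (intro continuous_closed_preimage \<phi> compact_imp_closed C) simp
    then show ?thesis using C by (metis compact_Int_closed inf_left_idem)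
  qed
  have ne: "C \<inter> \<phi> -` {x} \<noteq> {}" if "x \<in> K" for x using that \<phi>(2) by auto
  have s_mem: "s x \<in> C \<inter> \<phi> -` {x}" if "x \<in> K" for x
    unfolding s_def using fibre ne[OF that]
    by (intro closed_contains_Inf compact_imp_closed bounded_imp_bdd_below compact_imp_bounded)
  have le_iff: "s x \<le> c \<longleftrightarrow> x \<in> \<phi> ` (C \<inter> {..c})" if "x \<in> K" for x c
  proof
    assume "s x \<le> c" then show "x \<in> \<phi> ` (C \<inter> {..c})" using s_mem[OF that] by force
  next
    assume "x \<in> \<phi> ` (C \<inter> {..c})"
    then obtain r where "r \<in> C" "r \<le> c" "\<phi> r = x" by auto
    then have "s x \<le> r"
      unfolding s_def using fibre
      by (intro cInf_lower bounded_imp_bdd_below compact_imp_bounded) auto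
    with \<open>r \<le> c\<close> show "s x \<le> c" by simp
  qed
  have "s \<in> borel_measurable (restrict_space borel K)"
    unfolding borel_measurable_iff_le
  proof (intro allI)
    fix c
    have "{w \<in> space (restrict_space borel K). s w \<le> c} = K \<inter> \<phi> ` (C \<inter> {..c})"
      using le_iff by (auto simp: space_restrict_space)
    moreover have "compact (\<phi> ` (C \<inter> {..c}))"
      using C by (intro compact_continuous_image continuous_on_subset[OF \<phi>(1)] compact_Int_closed) auto
    ultimately show "{w \<in> space (restrict_space borel K). s w \<le> c} \<in> sets (restrict_space borel K)"
      by (auto simp: sets_restrict_space dest!: compact_imp_closed)
  qed
  then show ?thesis
    by (rule that[OF C \<phi>]) (use s_mem in auto)
qed

text \<open>Pulling the measures back to the line along a Borel section makes Helly's theorem applicable.\<close>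

lemma weak_sequential_compactness:
  fixes K :: "'a::euclidean_space set" and P :: "nat \<Rightarrow> 'a measure"
  assumes K: "compact K" and P: "\<And>n. P n \<in> \<P> K"
  obtains r :: "nat \<Rightarrow> nat" and Q where "strict_mono r" "Q \<in> \<P> K"
    "\<And>f :: 'a \<Rightarrow> real. continuous_on K f \<Longrightarrow> (\<lambda>n. \<integral>y. f y \<partial>P (r n)) \<longlonglongrightarrow> (\<integral>y. f y \<partial>Q)"
proof -
  obtain C :: "real set" and \<phi> s where C: "compact C" and \<phi>: "continuous_on C \<phi>" "\<phi> ` C = K"
    and s: "s \<in> borel_measurable (restrict_space borel K)"
    and sC: "\<And>x. x \<in> K \<Longrightarrow> s x \<in> C" and \<phi>s: "\<And>x. x \<in> K \<Longrightarrow> \<phi> (s x) = x"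
    by (rule borel_section_of_compact_real[OF K]) blast
  have setsP [simp, measurable_cong]: "sets (P n) = sets (restrict_space borel K)" and probP: "prob_space (P n)" for n
    using P[of n] by (auto simp: space_prob_algebra)
  have spaceP: "space (P n) = K" for n
    using sets_eq_imp_space_eq[OF setsP, of n] by (simp add: space_restrict_space)
  define \<mu> where "\<mu> n = distr (P n) borel s" for n
  have s': "s \<in> borel_measurable (P n)" for n using s by simp
  have real: "real_distribution (\<mu> n)" for n
  proof -
    interpret P: prob_space "P n" by (rule probP)
    show ?thesis unfolding \<mu>_def
      by (intro P.real_distribution_distr s')
  qed
  have Cmass: "measure (\<mu> n) C = 1" for n
  proof -
    interpret P: prob_space "P n" by (rule probP)
    have "measure (\<mu> n) C = measure (P n) (s -` C \<inter> space (P n))"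
      unfolding \<mu>_def using s' C by (intro measure_distr) (auto intro: borel_closed compact_imp_closed)
    also have "s -` C \<inter> space (P n) = space (P n)" using sC spaceP by auto
    finally show ?thesis by (simp add: P.prob_space)
  qed
  obtain R where R: "\<And>c. c \<in> C \<Longrightarrow> \<bar>c\<bar> \<le> R" "R > 0"
    using compact_imp_bounded[OF C] unfolding bounded_pos by auto
  have "tight \<mu>"
    unfolding tight_def
  proof (intro conjI allI impI)
    fix \<delta> :: real assume "\<delta> > 0"
    \<comment> \<open>The interval is open on the left and C may contain -R, hence the left end -R -
      1. All mass lies in C, so one interval serves every \<delta>.\<close>
    have "measure (\<mu> n) {- R - 1<..R} > 1 - \<delta>" for n
    proof -
      interpret M: real_distribution "\<mu> n" by (rule real)
      have "C \<subseteq> {- R - 1<..R}" using R(1) by force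
      then have "measure (\<mu> n) C \<le> measure (\<mu> n) {- R - 1<..R}"
        by (intro M.finite_measure_mono) auto
      then show ?thesis using Cmass \<open>\<delta> > 0\<close> by simp
    qed
    then show "\<exists>a b. a < b \<and> (\<forall>n. 1 - \<delta> < measure (\<mu> n) {a<..b})"
      using \<open>R > 0\<close> by (intro exI[of _ "- R - 1"] exI[of _ R]) auto
  qed (rule real)
  from tight_imp_convergent_subsubsequence[OF this strict_mono_id]
  obtain r M where r: "strict_mono r" and M: "real_distribution M" and conv: "weak_conv_m (\<mu> \<circ> id \<circ> r) M"
    by (auto simp: id_def)
  interpret M: real_distribution M by (rule M)
  have real_r: "\<And>n. real_distribution ((\<mu> \<circ> id \<circ> r) n)" using real by simp
  have lim: "(\<lambda>n. \<integral>c. g c \<partial>\<mu> (r n)) \<longlonglongrightarrow> (\<integral>c. g c \<partial>M)"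
    if "continuous_on UNIV g" "\<And>c. \<bar>g c\<bar> \<le> B" for g :: "real \<Rightarrow> real" and B
    using weak_conv_imp_integral_bdd_continuous_conv[OF real_r M conv, of g B] that
    by (simp add: continuous_on_eq_continuous_at)
  have CB [measurable]: "C \<in> sets borel" using C by (intro borel_closed compact_imp_closed)
  have "C \<noteq> {}" using Cmass[of 0] by auto
  have pushP: "(\<integral>c. g c \<partial>\<mu> n) = (\<integral>y. g (s y) \<partial>P n)" if "g \<in> borel_measurable borel" for g :: "real \<Rightarrow> real" and n
    unfolding \<mu>_def using s' that by (intro integral_distr) auto
  have MC: "measure M C = 1"
  proof -
    \<comment> \<open>A bounded continuous function vanishing exactly on C. Its integrals along the
      sequence are 0, so the limit \<open>M\<close> is concentrated on C as well.\<close>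
    define g where "g c = min 1 (infdist c C)" for c
    have g: "continuous_on UNIV g" "\<And>c. \<bar>g c\<bar> \<le> 1"
      by (auto simp: g_def abs_of_nonneg infdist_nonneg intro!: continuous_intros)
    have gm: "g \<in> borel_measurable borel" using g(1) by (rule borel_measurable_continuous_onI)
    have "(\<integral>c. g c \<partial>\<mu> n) = 0" for n
    proof -
      have "(\<integral>y. g (s y) \<partial>P n) = (\<integral>y. 0 \<partial>P n)"
        using sC spaceP by (intro Bochner_Integration.integral_cong) (auto simp: g_def)
      then show ?thesis using pushP[OF gm] by simp
    qed
    with lim[OF g] have "(\<integral>c. g c \<partial>M) = 0"
      by (simp add: LIMSEQ_const_iff)
    moreover have "integrable M g"
      using gm g(2) by (intro M.integrable_const_bound[where B=1]) auto
    ultimately have "AE c in M. g c = 0"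
      by (subst (asm) integral_nonneg_eq_0_iff_AE) (auto simp: g_def infdist_nonneg)
    then have "AE c in M. c \<in> C"
    proof (rule AE_mp, intro AE_I2 impI)
      fix c assume "g c = 0"
      then have "infdist c C = 0" using infdist_nonneg[of c C] by (auto simp: g_def min_def split: if_splits)
      then show "c \<in> C" using C \<open>C \<noteq> {}\<close> by (simp add: in_closed_iff_infdist_zero compact_imp_closed)
    qed
    then show ?thesis using M.prob_eq_1[of C] by simp
  qed
  have "K \<noteq> {}" using \<open>C \<noteq> {}\<close> \<phi>(2) by auto
  then obtain k0 where "k0 \<in> K" by auto
  \<comment> \<open>\<open>M\<close> lives on the whole line while \<phi> is controlled only on C.
    The complement of C is null, so any value there will do, provided that it lies in K.\<close>
  define \<phi>' where "\<phi>' c = (if c \<in> C then \<phi> c else k0)" for c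
  have \<phi>'m: "\<phi>' \<in> borel \<rightarrow>\<^sub>M restrict_space borel K"
  proof (rule measurable_restrict_space2)
    show "\<phi>' \<in> space borel \<rightarrow> K" using \<phi>(2) \<open>k0 \<in> K\<close> by (auto simp: \<phi>'_def)
    show "\<phi>' \<in> borel_measurable borel"
      unfolding \<phi>'_def by (intro borel_measurable_continuous_on_if \<phi>(1) CB continuous_on_const)
  qed
  then have \<phi>'M: "\<phi>' \<in> M \<rightarrow>\<^sub>M restrict_space borel K" by simp
  show thesis
  proof (rule that[OF r])
    show "distr M (restrict_space borel K) \<phi>' \<in> \<P> K"
      using M.prob_space_distr[OF \<phi>'M] by (simp add: space_prob_algebra)
    fix f :: "'a \<Rightarrow> real" assume f: "continuous_on K f"
    have fm: "f \<in> borel_measurable (restrict_space borel K)"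
      using f by (rule borel_measurable_continuous_on_restrict)
    obtain B where B: "\<And>y. y \<in> K \<Longrightarrow> \<bar>f y\<bar> \<le> B" "B > 0"
      using compact_imp_bounded[OF compact_continuous_image[OF f K]] unfolding bounded_pos by auto
    have "continuous_on C (f \<circ> \<phi>)"
      using \<phi> f by (intro continuous_on_compose) auto
    \<comment> \<open>Weak convergence on the line tests against bounded continuous functions
      defined everywhere, so \<open>f \<circ> \<phi>\<close> is extended from C with the same
      bound.\<close>
    then obtain g where g: "continuous_on UNIV g" "\<And>c. c \<in> C \<Longrightarrow> g c = (f \<circ> \<phi>) c" "\<And>c. norm (g c) \<le> B"
      by (rule Tietze[where U=UNIV and B=B]) (use B \<phi> C in \<open>auto intro: compact_imp_closed\<close>)
    have gm: "g \<in> borel_measurable borel" using g(1) by (rule borel_measurable_continuous_onI)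
    have "(\<integral>y. f y \<partial>P n) = (\<integral>c. g c \<partial>\<mu> n)" for n
      unfolding pushP[OF gm]
      by (intro Bochner_Integration.integral_cong) (use g(2) sC \<phi>s spaceP in auto)
    moreover have "(\<integral>y. f y \<partial>distr M (restrict_space borel K) \<phi>') = (\<integral>c. f (\<phi>' c) \<partial>M)"
      by (intro integral_distr \<phi>'M fm)
    moreover have "\<dots> = (\<integral>c. g c \<partial>M)"
    proof (rule integral_cong_AE)
      show "(\<lambda>c. f (\<phi>' c)) \<in> borel_measurable M"
        using measurable_compose[OF \<phi>'m fm] by simp
      have "AE c in M. c \<in> C" using M.prob_eq_1[of C] MC by simp
      then show "AE c in M. f (\<phi>' c) = g c" by eventually_elim (simp add: \<phi>'_def g(2))
    qed (use gm in simp)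
    ultimately show "(\<lambda>n. \<integral>y. f y \<partial>P (r n)) \<longlonglongrightarrow> (\<integral>y. f y \<partial>distr M (restrict_space borel K) \<phi>')"
      using lim[OF g(1), of B] g(3) by simp
  qed
qed

section \<open>Probability measures on compact sets\<close>

lemma prob_measuresD:
  assumes "P \<in> \<P> K"
  shows "sets P = sets (restrict_space borel K)" "space P = K" "prob_space P"
  using assms sets_eq_imp_space_eq[of P "restrict_space borel K"]
  by (auto simp: space_prob_algebra space_restrict_space)

lemma sets_mono_of_measurable_ident:
  assumes "(\<lambda>z. z) \<in> M \<rightarrow>\<^sub>M N" "space M = space N"
  shows "sets N \<subseteq> sets M"
proof
  fix A assume A: "A \<in> sets N"
  have "(\<lambda>z. z) -` A \<inter> space M \<in> sets M" by (rule measurable_sets[OF assms(1) A])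
  moreover have "(\<lambda>z. z) -` A \<inter> space M = A"
    using sets.sets_into_space[OF A] assms(2) by auto
  ultimately show "A \<in> sets M" by simp
qed

text \<open>Both inclusions say that the identity is measurable. Kernels of the model are measurable
  on a product of spaces, whereas continuity and compactness concern the product set; this equality
  passes between the two.\<close>

lemma sets_restrict_borel_Times:
  fixes K :: "'a::second_countable_topology set" and L :: "'b::second_countable_topology set"
  shows "sets (restrict_space borel K \<Otimes>\<^sub>M restrict_space borel L) = sets (restrict_space borel (K \<times> L))"
proof (rule antisym)
  have sp: "space (restrict_space borel K \<Otimes>\<^sub>M restrict_space borel L) = space (restrict_space borel (K \<times> L))"
    by (simp add: space_pair_measure space_restrict_space)
  have f: "fst \<in> restrict_space borel (K \<times> L) \<rightarrow>\<^sub>M restrict_space borel K"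
    by (rule measurable_restrict_space3) (auto simp: borel_prod[symmetric])
  have s: "snd \<in> restrict_space borel (K \<times> L) \<rightarrow>\<^sub>M restrict_space borel L"
    by (rule measurable_restrict_space3) (auto simp: borel_prod[symmetric])
  have "(\<lambda>z. z) \<in> restrict_space borel (K \<times> L) \<rightarrow>\<^sub>M restrict_space borel K \<Otimes>\<^sub>M restrict_space borel L"
    using measurable_Pair[OF f s] by simp
  then show "sets (restrict_space borel K \<Otimes>\<^sub>M restrict_space borel L) \<subseteq> sets (restrict_space borel (K \<times> L))"
    by (rule sets_mono_of_measurable_ident) (rule sp[symmetric])
  have f: "fst \<in> restrict_space borel K \<Otimes>\<^sub>M restrict_space borel L \<rightarrow>\<^sub>M borel"
    by (rule measurable_compose[OF measurable_fst]) (simp add: measurable_restrict_space1)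
  have s: "snd \<in> restrict_space borel K \<Otimes>\<^sub>M restrict_space borel L \<rightarrow>\<^sub>M borel"
    by (rule measurable_compose[OF measurable_snd]) (simp add: measurable_restrict_space1)
  have "(\<lambda>z. z) \<in> restrict_space borel K \<Otimes>\<^sub>M restrict_space borel L \<rightarrow>\<^sub>M restrict_space borel (K \<times> L)"
  proof (rule measurable_restrict_space2)
    show "(\<lambda>z. z) \<in> borel_measurable (restrict_space borel K \<Otimes>\<^sub>M restrict_space borel L)"
      using measurable_Pair[OF f s] by (simp add: borel_prod)
  qed (auto simp: space_pair_measure space_restrict_space)
  then show "sets (restrict_space borel (K \<times> L)) \<subseteq> sets (restrict_space borel K \<Otimes>\<^sub>M restrict_space borel L)"
    by (rule sets_mono_of_measurable_ident) (rule sp)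
qed

text \<open>Continuous functions that decrease to the indicator of a closed set C. The empty set is
  treated apart because \<open>infdist y {} = 0\<close> would give the constant 1 instead of
  0.\<close>

definition closed_approx :: "'a::metric_space set \<Rightarrow> nat \<Rightarrow> 'a \<Rightarrow> real" where
  "closed_approx C n y = (if C = {} then 0 else max 0 (1 - real n * infdist y C))"

lemma closed_approx_le_1: "\<bar>closed_approx C n y\<bar> \<le> 1"
  by (auto simp: closed_approx_def infdist_nonneg)

lemma continuous_on_closed_approx: "continuous_on S (closed_approx C n)"
  unfolding closed_approx_def by (cases "C = {}") (auto intro!: continuous_intros)

lemma closed_approx_tendsto:
  assumes "closed C"
  shows "(\<lambda>n. closed_approx C n y) \<longlonglongrightarrow> indicator C y"
proof (cases "y \<in> C")
  case True
  then have "closed_approx C n y = 1" for n by (auto simp: closed_approx_def)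
  then show ?thesis using True by simp
next
  case False
  show ?thesis
  proof (cases "C = {}")
    case False
    with \<open>y \<notin> C\<close> assms have "infdist y C > 0"
      using infdist_nonneg[of y C] in_closed_iff_infdist_zero[OF assms False, of y] by simp
    then obtain m where m: "real m * infdist y C > 1"
      using reals_Archimedean3 by blast
    have "closed_approx C n y = 0" if "n \<ge> m" for n
    proof -
      have "real m * infdist y C \<le> real n * infdist y C"
        using that infdist_nonneg by (intro mult_right_mono) auto
      with m show ?thesis by (auto simp: closed_approx_def)
    qed
    then have "\<forall>\<^sub>F n in sequentially. closed_approx C n y = 0"
      by (auto simp: eventually_sequentially)
    then show ?thesis using \<open>y \<notin> C\<close> by (simp add: tendsto_eventually)
  qed (simp add: closed_approx_def)
qed

lemma integral_closed_approx_tendsto: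
  assumes P: "P \<in> \<P> K" and C: "closed C"
  shows "(\<lambda>n. \<integral>y. closed_approx C n y \<partial>P) \<longlonglongrightarrow> measure P (K \<inter> C)"
proof -
  note [simp] = prob_measuresD[OF P]
  interpret prob_space P by simp
  have "(\<lambda>n. \<integral>y. closed_approx C n y \<partial>P) \<longlonglongrightarrow> (\<integral>y. indicator C y \<partial>P)"
  proof (rule integral_dominated_convergence[where w="\<lambda>_. 1"])
    have m: "f \<in> borel_measurable P" if "f \<in> borel_measurable borel" for f :: "'a \<Rightarrow> real"
    proof -
      have "f \<in> borel_measurable (restrict_space borel K)" using that by (rule measurable_restrict_space1)
      then show ?thesis by (simp cong: measurable_cong_sets)
    qed
    show "(indicator C :: _ \<Rightarrow> real) \<in> borel_measurable P" using C by (intro m) simp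
    show "closed_approx C n \<in> borel_measurable P" for n
      by (intro m borel_measurable_continuous_onI continuous_on_closed_approx)
  qed (use closed_approx_le_1 closed_approx_tendsto[OF C] in auto)
  then show ?thesis by (simp add: Int_commute)
qed

lemma sets_restrict_borel_closed:
  assumes "closed K"
  shows "sets (restrict_space borel K) = sigma_sets K ((\<inter>) K ` {C. closed C})"
proof -
  have "sets (restrict_space borel K) = (\<inter>) K ` sigma_sets UNIV {C. closed C}"
    unfolding sets_restrict_space borel_eq_closed by (subst sets_measure_of) auto
  also have "\<dots> = sigma_sets K ((\<inter>) K ` {C. closed C})"
    using assms by (subst sigma_sets_Int[of K UNIV]) auto
  finally show ?thesis .
qed

lemma Int_stable_closed: "Int_stable ((\<inter>) K ` {C. closed C})"
proof (rule Int_stableI)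
  fix a b assume "a \<in> (\<inter>) K ` {C. closed C}" "b \<in> (\<inter>) K ` {C. closed C}"
  then obtain C D where "closed C" "closed D" "a = K \<inter> C" "b = K \<inter> D" by auto
  then show "a \<inter> b \<in> (\<inter>) K ` {C. closed C}" by (intro image_eqI[of _ _ "C \<inter> D"]) auto
qed

text \<open>Traces of closed sets on K generate its Borel sets and are stable under intersection,
  and their measures are limits of integrals of bounded continuous functions. Such integrals are
  what can be computed for the policies and transport plans below.\<close>

lemma prob_measures_kernelI:
  assumes K: "closed K"
    and N: "\<And>z. z \<in> space M \<Longrightarrow> N z \<in> \<P> K"
    and int: "\<And>f :: 'a::metric_space \<Rightarrow> real. continuous_on K f \<Longrightarrow> bounded (f ` K) \<Longrightarrow>
      (\<lambda>z. \<integral>y. f y \<partial>N z) \<in> borel_measurable M"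
  shows "N \<in> M \<rightarrow>\<^sub>M prob_algebra (restrict_space borel K)"
proof (rule measurable_prob_algebra_generated[OF sets_restrict_borel_closed[OF K] Int_stable_closed])
  show "prob_space (N z)" "sets (N z) = sets (restrict_space borel K)" if "z \<in> space M" for z
    using prob_measuresD[OF N[OF that]] by auto
  fix A assume "A \<in> (\<inter>) K ` {C. closed C}"
  then obtain C where C: "closed C" "A = K \<inter> C" by auto
  have "(\<lambda>z. measure (N z) (K \<inter> C)) \<in> borel_measurable M"
  proof (rule borel_measurable_LIMSEQ_metric[where f="\<lambda>n z. \<integral>y. closed_approx C n y \<partial>N z"])
    show "(\<lambda>z. \<integral>y. closed_approx C n y \<partial>N z) \<in> borel_measurable M" for n
      by (intro int continuous_on_closed_approx) (auto intro!: boundedI[of _ 1] simp: closed_approx_le_1)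
  qed (intro integral_closed_approx_tendsto N C)
  then show "(\<lambda>z. emeasure (N z) A) \<in> borel_measurable M"
    using prob_measuresD(3)[OF N] unfolding C(2)
    by (subst measurable_cong[where g="\<lambda>z. ennreal (measure (N z) (K \<inter> C))"])
      (auto simp: finite_measure.emeasure_eq_measure prob_space_def)
qed auto

lemma prob_measures_eqI:
  assumes K: "closed K" and P: "P \<in> \<P> K" and Q: "Q \<in> \<P> K"
    and eq: "\<And>f :: 'a::metric_space \<Rightarrow> real. continuous_on K f \<Longrightarrow> bounded (f ` K) \<Longrightarrow>
      (\<integral>y. f y \<partial>P) = (\<integral>y. f y \<partial>Q)"
  shows "P = Q"
proof (rule measure_eqI_generator_eq[OF Int_stable_closed[of K], where \<Omega>=K and A="\<lambda>_. K"])
  interpret P: prob_space P using prob_measuresD[OF P] by simp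
  interpret Q: prob_space Q using prob_measuresD[OF Q] by simp
  fix A assume "A \<in> (\<inter>) K ` {C. closed C}"
  then obtain C where C: "closed C" "A = K \<inter> C" by auto
  have "(\<integral>y. closed_approx C n y \<partial>P) = (\<integral>y. closed_approx C n y \<partial>Q)" for n
    by (intro eq continuous_on_closed_approx) (auto intro!: boundedI[of _ 1] simp: closed_approx_le_1)
  then have "measure P (K \<inter> C) = measure Q (K \<inter> C)"
    using LIMSEQ_unique[OF integral_closed_approx_tendsto[OF P C(1)]] integral_closed_approx_tendsto[OF Q C(1)]
    by simp
  then show "emeasure P A = emeasure Q A"
    by (simp add: C P.emeasure_eq_measure Q.emeasure_eq_measure)
next
  interpret P: prob_space P using prob_measuresD[OF P] by simp
  show "emeasure P K \<noteq> \<infinity>" by simp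
qed (use K prob_measuresD[OF P] prob_measuresD[OF Q] sets_restrict_borel_closed[OF K] in auto)

section \<open>Integrals of continuous functions over a compact set\<close>

lemma borel_measurable_prob_measures:
  assumes "P \<in> \<P> K" "continuous_on K f"
  shows "f \<in> borel_measurable P"
  using borel_measurable_continuous_on_restrict[OF assms(2)] prob_measuresD(1)[OF assms(1)]
  by (simp cong: measurable_cong_sets)

lemma compact_real_bound:
  fixes f :: "'a::topological_space \<Rightarrow> real"
  assumes "compact K" "continuous_on K f"
  obtains B where "B > 0" "\<And>y. y \<in> K \<Longrightarrow> \<bar>f y\<bar> \<le> B"
  using compact_imp_bounded[OF compact_continuous_image[OF assms(2,1)]] unfolding bounded_pos by auto

lemma integrable_prob_measures:
  fixes f :: "'a::topological_space \<Rightarrow> real"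
  assumes "compact K" "P \<in> \<P> K" "continuous_on K f"
  shows "integrable P f"
proof -
  interpret prob_space P using prob_measuresD[OF assms(2)] by simp
  obtain B where "\<And>y. y \<in> K \<Longrightarrow> \<bar>f y\<bar> \<le> B" using compact_real_bound[OF assms(1,3)] by blast
  then show ?thesis
    using prob_measuresD[OF assms(2)] borel_measurable_prob_measures[OF assms(2,3)]
    by (intro integrable_const_bound[where B=B]) auto
qed

lemma integral_prob_measures_mono:
  fixes f g :: "'a::topological_space \<Rightarrow> real"
  assumes "compact K" "P \<in> \<P> K" "continuous_on K f" "continuous_on K g" "\<And>y. y \<in> K \<Longrightarrow> f y \<le> g y"
  shows "(\<integral>y. f y \<partial>P) \<le> (\<integral>y. g y \<partial>P)"
  using assms prob_measuresD[OF assms(2)] by (intro integral_mono integrable_prob_measures[of K]) auto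

lemma integral_prob_measures_diff_le:
  fixes f g :: "'a::topological_space \<Rightarrow> real"
  assumes "compact K" "P \<in> \<P> K" "continuous_on K f" "continuous_on K g" "\<And>y. y \<in> K \<Longrightarrow> \<bar>f y - g y\<bar> \<le> e"
  shows "\<bar>(\<integral>y. f y \<partial>P) - (\<integral>y. g y \<partial>P)\<bar> \<le> e"
proof -
  interpret prob_space P using prob_measuresD[OF assms(2)] by simp
  have "(\<integral>y. f y \<partial>P) \<le> (\<integral>y. g y + e \<partial>P)" "(\<integral>y. g y \<partial>P) \<le> (\<integral>y. f y + e \<partial>P)"
    using assms(5) by (intro integral_prob_measures_mono[OF assms(1,2)] continuous_intros assms; force)+
  then show ?thesis
    using integrable_prob_measures[OF assms(1,2,3)] integrable_prob_measures[OF assms(1,2,4)] by (simp add: prob_space)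
qed

lemma integral_prob_measures_bound:
  fixes f :: "'a::topological_space \<Rightarrow> real"
  assumes "compact K" "P \<in> \<P> K" "continuous_on K f" "\<And>y. y \<in> K \<Longrightarrow> \<bar>f y\<bar> \<le> e"
  shows "\<bar>\<integral>y. f y \<partial>P\<bar> \<le> e"
  using integral_prob_measures_diff_le[OF assms(1,2,3) continuous_on_const[of _ 0], of e] assms(4) by simp

lemma weakly_continuous_onD:
  fixes f :: "'a::topological_space \<Rightarrow> real"
  assumes "weakly_continuous_on D K N" "compact K" "continuous_on K f"
  shows "continuous_on D (\<lambda>z. \<integral>y. f y \<partial>N z)"
  using assms(1) compact_imp_bounded[OF compact_continuous_image[OF assms(3,2)]] assms(3)
  unfolding weakly_continuous_on_def by blast

section \<open>Continuity of integrals, suprema and infima in a parameter\<close>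

lemma uniformly_continuous_param:
  fixes F :: "'z::metric_space \<Rightarrow> 'a::metric_space \<Rightarrow> real"
  assumes "compact Z" "compact K" "continuous_on (Z \<times> K) (\<lambda>(z, y). F z y)" "e > 0"
  obtains d where "d > 0"
    "\<And>z z' y. z \<in> Z \<Longrightarrow> z' \<in> Z \<Longrightarrow> y \<in> K \<Longrightarrow> dist z z' < d \<Longrightarrow> \<bar>F z y - F z' y\<bar> < e"
proof -
  have "uniformly_continuous_on (Z \<times> K) (\<lambda>(z, y). F z y)"
    using assms by (intro compact_uniformly_continuous compact_Times)
  from uniformly_continuous_onE[OF this \<open>e > 0\<close>] obtain d where d: "d > 0"
    "\<And>p p'. p \<in> Z \<times> K \<Longrightarrow> p' \<in> Z \<times> K \<Longrightarrow> dist p' p < d \<Longrightarrow> dist (case p' of (z, y) \<Rightarrow> F z y) (case p of (z, y) \<Rightarrow> F z y) < e"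
    by metis
  show thesis
  proof (rule that[OF d(1)])
    fix z z' y assume "z \<in> Z" "z' \<in> Z" "y \<in> K" "dist z z' < d"
    then show "\<bar>F z y - F z' y\<bar> < e"
      using d(2)[of "(z', y)" "(z, y)"] by (simp add: dist_Pair_Pair dist_real_def)
  qed
qed

lemma continuous_on_slice:
  assumes "continuous_on (Z \<times> K) (\<lambda>(z, y). F z y)" "z \<in> Z"
  shows "continuous_on K (F z)"
  by (rule continuous_on_compose2[OF assms(1), of K "\<lambda>y. (z, y)", simplified])
    (use assms(2) in \<open>auto intro!: continuous_intros\<close>)

lemma continuous_on_integral_param:
  fixes F :: "'z::metric_space \<Rightarrow> 'a::metric_space \<Rightarrow> real"
  assumes Z: "compact Z" and K: "compact K" and N: "weakly_continuous_on Z K N" "\<And>z. z \<in> Z \<Longrightarrow> N z \<in> \<P> K"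
    and F: "continuous_on (Z \<times> K) (\<lambda>(z, y). F z y)"
  shows "continuous_on Z (\<lambda>z. \<integral>y. F z y \<partial>N z)"
  unfolding continuous_on_iff
proof (intro ballI allI impI)
  fix z and e :: real assume z: "z \<in> Z" and e: "e > 0"
  obtain d where d: "d > 0"
    "\<And>z z' y. z \<in> Z \<Longrightarrow> z' \<in> Z \<Longrightarrow> y \<in> K \<Longrightarrow> dist z z' < d \<Longrightarrow> \<bar>F z y - F z' y\<bar> < e / 2"
    using uniformly_continuous_param[OF Z K F, of "e/2"] e by auto
  have Fz: "continuous_on K (F z)" if "z \<in> Z" for z by (rule continuous_on_slice[OF F that])
  obtain d' where d': "d' > 0"
    "\<And>z'. z' \<in> Z \<Longrightarrow> dist z' z < d' \<Longrightarrow> dist (\<integral>y. F z y \<partial>N z') (\<integral>y. F z y \<partial>N z) < e / 2"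
    using weakly_continuous_onD[OF N(1) K Fz[OF z]] z e unfolding continuous_on_iff by (metis half_gt_zero)
  show "\<exists>d>0. \<forall>z'\<in>Z. dist z' z < d \<longrightarrow> dist (\<integral>y. F z' y \<partial>N z') (\<integral>y. F z y \<partial>N z) < e"
  proof (intro exI[of _ "min d d'"] conjI ballI impI)
    fix z' assume z': "z' \<in> Z" "dist z' z < min d d'"
    have "\<bar>(\<integral>y. F z' y \<partial>N z') - (\<integral>y. F z y \<partial>N z')\<bar> \<le> e / 2"
      using z' z by (intro integral_prob_measures_diff_le[OF K] N Fz less_imp_le[OF d(2)]) auto
    moreover have "\<bar>(\<integral>y. F z y \<partial>N z') - (\<integral>y. F z y \<partial>N z)\<bar> < e / 2"
      using d'(2)[of z'] z' by (simp add: dist_real_def)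
    ultimately show "dist (\<integral>y. F z' y \<partial>N z') (\<integral>y. F z y \<partial>N z) < e"
      unfolding dist_real_def by linarith
  qed (use d d' in auto)
qed

text \<open>One modulus of uniform continuity serves all y, so the suprema inherit it.\<close>

lemma continuous_on_SUP_param:
  fixes F :: "'z::metric_space \<Rightarrow> 'a::metric_space \<Rightarrow> real"
  assumes Z: "compact Z" and K: "compact K" "K \<noteq> {}" and F: "continuous_on (Z \<times> K) (\<lambda>(z, y). F z y)"
  shows "continuous_on Z (\<lambda>z. SUP y\<in>K. F z y)"
  unfolding continuous_on_iff
proof (intro ballI allI impI)
  fix z and e :: real assume z: "z \<in> Z" and e: "e > 0"
  obtain d where d: "d > 0"
    "\<And>z z' y. z \<in> Z \<Longrightarrow> z' \<in> Z \<Longrightarrow> y \<in> K \<Longrightarrow> dist z z' < d \<Longrightarrow> \<bar>F z y - F z' y\<bar> < e / 2"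
    using uniformly_continuous_param[OF Z K(1) F, of "e/2"] e by auto
  have bdd: "bdd_above (F z ` K)" if "z \<in> Z" for z
    by (intro bounded_imp_bdd_above compact_imp_bounded compact_continuous_image K continuous_on_slice[OF F that])
  have le: "(SUP y\<in>K. F z y) \<le> (SUP y\<in>K. F z' y) + e / 2" if "z \<in> Z" "z' \<in> Z" "dist z z' < d" for z z'
  proof (rule cSUP_least[OF K(2)])
    fix y assume y: "y \<in> K"
    have "F z y \<le> F z' y + e / 2" using d(2)[OF that(1,2) y that(3)] by linarith
    also have "F z' y \<le> (SUP y\<in>K. F z' y)" by (intro cSUP_upper y bdd that)
    finally show "F z y \<le> (SUP y\<in>K. F z' y) + e / 2" by simp
  qed
  show "\<exists>d>0. \<forall>z'\<in>Z. dist z' z < d \<longrightarrow> dist (SUP y\<in>K. F z' y) (SUP y\<in>K. F z y) < e"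
  proof (intro exI[of _ d] conjI ballI impI d(1))
    fix z' assume "z' \<in> Z" "dist z' z < d"
    then show "dist (SUP y\<in>K. F z' y) (SUP y\<in>K. F z y) < e"
      using le[of z z'] le[of z' z] z e by (simp add: dist_real_def dist_commute abs_less_iff)
  qed
qed

lemma continuous_on_INF_param:
  fixes F :: "'z::metric_space \<Rightarrow> 'a::metric_space \<Rightarrow> real"
  assumes Z: "compact Z" and K: "compact K" "K \<noteq> {}" and F: "continuous_on (Z \<times> K) (\<lambda>(z, y). F z y)"
  shows "continuous_on Z (\<lambda>z. INF y\<in>K. F z y)"
proof -
  have "continuous_on Z (\<lambda>z. - (SUP y\<in>K. - F z y))"
    using F by (intro continuous_on_minus continuous_on_SUP_param[OF Z K])
      (auto intro!: continuous_on_minus simp: case_prod_beta')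
  then show ?thesis by (simp add: Inf_real_def image_image)
qed

section \<open>Wasserstein balls\<close>

text \<open>The formula of the robust action value with f + V abstracted to \<open>F\<close>, so
  that duality can be developed for arbitrary continuous integrands.\<close>

definition transport_dual ::
  "'a::euclidean_space set \<Rightarrow> nat \<Rightarrow> real \<Rightarrow> 'a measure \<Rightarrow> ('a \<Rightarrow> real) \<Rightarrow> real" where
  "transport_dual K q \<epsilon> \<mu> F =
     (SUP \<kappa>\<in>{0..}. (\<integral>x. (INF y\<in>K. F y + \<kappa> * norm (x - y) ^ q) \<partial>\<mu>) - \<epsilon> ^ q * \<kappa>)"

definition wasserstein_ball ::
  "'a::euclidean_space set \<Rightarrow> nat \<Rightarrow> real \<Rightarrow> 'a measure \<Rightarrow> 'a measure set" where
  "wasserstein_ball K q \<epsilon> \<mu> = {P \<in> \<P> K. wasserstein q P \<mu> \<le> \<epsilon>}"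

section \<open>Couplings and their marginals\<close>

lemma sets_pair_prob_measures:
  fixes K :: "'a::second_countable_topology set"
  assumes "P \<in> \<P> K" "\<mu> \<in> \<P> K"
  shows "sets (P \<Otimes>\<^sub>M \<mu>) = sets (restrict_space borel (K \<times> K))"
  using sets_pair_measure_cong[OF prob_measuresD(1)[OF assms(1)] prob_measuresD(1)[OF assms(2)]]
  by (simp add: sets_restrict_borel_Times)

lemma measurable_fst_prob_measures:
  fixes K :: "'a::second_countable_topology set"
  assumes "P \<in> \<P> K" "\<gamma> \<in> \<P> (K \<times> K)"
  shows "fst \<in> \<gamma> \<rightarrow>\<^sub>M P" "snd \<in> \<gamma> \<rightarrow>\<^sub>M P"
proof -
  have s: "sets \<gamma> = sets (restrict_space borel K \<Otimes>\<^sub>M restrict_space borel K)"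
    using prob_measuresD(1)[OF assms(2)] by (simp add: sets_restrict_borel_Times)
  show "fst \<in> \<gamma> \<rightarrow>\<^sub>M P" "snd \<in> \<gamma> \<rightarrow>\<^sub>M P"
    using prob_measuresD(1)[OF assms(1)] s by (simp_all cong: measurable_cong_sets)
qed

lemma couplings_prob_measures:
  fixes K :: "'a::second_countable_topology set"
  assumes P: "P \<in> \<P> K" "\<mu> \<in> \<P> K" and \<gamma>: "\<gamma> \<in> couplings P \<mu>"
  shows "\<gamma> \<in> \<P> (K \<times> K)"
proof -
  have s: "sets \<gamma> = sets (restrict_space borel (K \<times> K))"
    using \<gamma> sets_pair_prob_measures[OF P] by (simp add: couplings_def)
  have "fst \<in> \<gamma> \<rightarrow>\<^sub>M P"
    using \<gamma> by (simp add: couplings_def cong: measurable_cong_sets)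
  moreover have "prob_space (distr \<gamma> P fst)"
    using \<gamma> prob_measuresD[OF P(1)] by (simp add: couplings_def)
  ultimately have "prob_space \<gamma>" by (rule prob_space_distrD)
  with s show ?thesis by (simp add: space_prob_algebra)
qed

lemma couplings_integral:
  fixes K :: "'a::second_countable_topology set" and f :: "'a \<Rightarrow> real"
  assumes P: "P \<in> \<P> K" "\<mu> \<in> \<P> K" and \<gamma>: "\<gamma> \<in> couplings P \<mu>" and f: "continuous_on K f"
  shows "(\<integral>z. f (fst z) \<partial>\<gamma>) = (\<integral>y. f y \<partial>P)" "(\<integral>z. f (snd z) \<partial>\<gamma>) = (\<integral>y. f y \<partial>\<mu>)"
proof -
  note \<gamma>' = couplings_prob_measures[OF P \<gamma>]
  have "(\<integral>y. f y \<partial>distr \<gamma> P fst) = (\<integral>z. f (fst z) \<partial>\<gamma>)"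
    by (intro integral_distr measurable_fst_prob_measures[OF P(1) \<gamma>'] borel_measurable_prob_measures[OF P(1) f])
  then show "(\<integral>z. f (fst z) \<partial>\<gamma>) = (\<integral>y. f y \<partial>P)" using \<gamma> by (simp add: couplings_def)
  have "(\<integral>y. f y \<partial>distr \<gamma> \<mu> snd) = (\<integral>z. f (snd z) \<partial>\<gamma>)"
    by (intro integral_distr measurable_fst_prob_measures[OF P(2) \<gamma>'] borel_measurable_prob_measures[OF P(2) f])
  then show "(\<integral>z. f (snd z) \<partial>\<gamma>) = (\<integral>y. f y \<partial>\<mu>)" using \<gamma> by (simp add: couplings_def)
qed

text \<open>Criterion for plans of which only integrals are known, such as weak limits and mixtures:
  the second marginal is identified by test functions, and the first is taken to be whatever
  results.\<close>

lemma fst_marginal_coupling: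
  fixes K :: "'a::{metric_space,second_countable_topology} set"
  assumes K: "closed K" and \<mu>: "\<mu> \<in> \<P> K" and \<gamma>: "\<gamma> \<in> \<P> (K \<times> K)"
    and eq: "\<And>f :: 'a \<Rightarrow> real. continuous_on K f \<Longrightarrow> bounded (f ` K) \<Longrightarrow> (\<integral>z. f (snd z) \<partial>\<gamma>) = (\<integral>y. f y \<partial>\<mu>)"
  shows "distr \<gamma> (restrict_space borel K) fst \<in> \<P> K"
    "\<gamma> \<in> couplings (distr \<gamma> (restrict_space borel K) fst) \<mu>"
proof -
  interpret prob_space \<gamma> using prob_measuresD[OF \<gamma>] by simp
  have m: "fst \<in> \<gamma> \<rightarrow>\<^sub>M restrict_space borel K" "snd \<in> \<gamma> \<rightarrow>\<^sub>M \<mu>"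
    using measurable_fst_prob_measures[OF \<mu> \<gamma>] prob_measuresD(1)[OF \<mu>] by (simp_all cong: measurable_cong_sets)
  show P: "distr \<gamma> (restrict_space borel K) fst \<in> \<P> K"
    using prob_space_distr[OF m(1)] by (simp add: space_prob_algebra)
  have "distr \<gamma> \<mu> snd \<in> \<P> K"
    using prob_space_distr[OF m(2)] prob_measuresD[OF \<mu>] by (simp add: space_prob_algebra)
  then have "distr \<gamma> \<mu> snd = \<mu>"
  proof (rule prob_measures_eqI[OF K _ \<mu>])
    fix f :: "'a \<Rightarrow> real" assume f: "continuous_on K f" "bounded (f ` K)"
    have "(\<integral>y. f y \<partial>distr \<gamma> \<mu> snd) = (\<integral>z. f (snd z) \<partial>\<gamma>)"
      by (intro integral_distr m borel_measurable_prob_measures[OF \<mu> f(1)])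
    then show "(\<integral>y. f y \<partial>distr \<gamma> \<mu> snd) = (\<integral>y. f y \<partial>\<mu>)" using eq[OF f] by simp
  qed
  moreover have "distr \<gamma> (distr \<gamma> (restrict_space borel K) fst) fst = distr \<gamma> (restrict_space borel K) fst"
    by (intro distr_cong) auto
  moreover have "sets \<gamma> = sets (distr \<gamma> (restrict_space borel K) fst \<Otimes>\<^sub>M \<mu>)"
    using sets_pair_prob_measures[OF P \<mu>] prob_measuresD(1)[OF \<gamma>] by simp
  ultimately show "\<gamma> \<in> couplings (distr \<gamma> (restrict_space borel K) fst) \<mu>"
    by (simp add: couplings_def)
qed

lemma couplings_nonempty:
  assumes "prob_space P" "prob_space \<mu>"
  shows "couplings P \<mu> \<noteq> {}"
proof -
  interpret P: prob_space P by fact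
  interpret \<mu>: prob_space \<mu> by fact
  interpret pair_sigma_finite P \<mu> ..
  have "distr (P \<Otimes>\<^sub>M \<mu>) \<mu> snd = distr (distr (\<mu> \<Otimes>\<^sub>M P) (P \<Otimes>\<^sub>M \<mu>) (\<lambda>(x, y). (y, x))) \<mu> snd"
    by (subst distr_pair_swap) (rule refl)
  also have "\<dots> = distr (\<mu> \<Otimes>\<^sub>M P) \<mu> fst"
    by (subst distr_distr) (auto simp: comp_def case_prod_beta' intro!: distr_cong)
  also have "\<dots> = \<mu>" by (rule P.distr_pair_fst)
  finally show ?thesis
    using \<mu>.distr_pair_fst[of P] by (auto simp: couplings_def intro!: exI[of _ "P \<Otimes>\<^sub>M \<mu>"])
qed

lemma wasserstein_ballI:
  assumes "P \<in> \<P> K" "\<gamma> \<in> couplings P \<mu>" "(\<integral>z. norm (fst z - snd z) ^ q \<partial>\<gamma>) \<le> \<epsilon> ^ q" "q \<ge> 1" "\<epsilon> \<ge> 0"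
  shows "P \<in> wasserstein_ball K q \<epsilon> \<mu>"
proof -
  have "(INF \<gamma>\<in>couplings P \<mu>. \<integral>z. norm (fst z - snd z) ^ q \<partial>\<gamma>) \<le> \<epsilon> ^ q"
    using assms(2,3) by (intro cINF_lower2[of _ _ \<gamma>] bdd_belowI[of _ 0]) auto
  then have "wasserstein q P \<mu> \<le> root q (\<epsilon> ^ q)"
    unfolding wasserstein_def using assms by (intro real_root_le_mono) auto
  then show ?thesis
    using assms by (simp add: wasserstein_ball_def real_root_power_cancel)
qed

text \<open>Unfolds the distance without knowing that an optimal coupling exists: the infimum of the
  costs is at most \<open>\<epsilon> ^ q\<close>, so any slack e > 0 yields a coupling.\<close>

lemma wasserstein_ballD:
  assumes P: "P \<in> wasserstein_ball K q \<epsilon> \<mu>" and \<mu>: "\<mu> \<in> \<P> K" and "q \<ge> 1" "e > 0"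
  obtains \<gamma> where "\<gamma> \<in> couplings P \<mu>" "(\<integral>z. norm (fst z - snd z) ^ q \<partial>\<gamma>) < \<epsilon> ^ q + e"
proof -
  let ?v = "INF \<gamma>\<in>couplings P \<mu>. \<integral>z. norm (fst z - snd z) ^ q \<partial>\<gamma>"
  have ne: "couplings P \<mu> \<noteq> {}"
    using P \<mu> by (intro couplings_nonempty) (auto simp: wasserstein_ball_def space_prob_algebra)
  have "0 \<le> ?v" by (intro cINF_greatest ne) auto
  moreover from this have "0 \<le> root q ?v" "root q ?v \<le> \<epsilon>"
    using P \<open>q \<ge> 1\<close> by (auto simp: wasserstein_ball_def wasserstein_def)
  ultimately have "?v \<le> \<epsilon> ^ q"
    using power_mono[of "root q ?v" \<epsilon> q] \<open>q \<ge> 1\<close> by simp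
  then have "?v < \<epsilon> ^ q + e" using \<open>e > 0\<close> by simp
  then show thesis using cInf_lessD[of "(\<lambda>\<gamma>. \<integral>z. norm (fst z - snd z) ^ q \<partial>\<gamma>) ` couplings P \<mu>"] ne that by auto
qed

lemma continuous_on_cost: "continuous_on S (\<lambda>z :: 'a::real_normed_vector \<times> 'a. norm (fst z - snd z) ^ q)"
  by (intro continuous_intros)

text \<open>The extraction is done for couplings rather than for the measures. A weak limit of
  nearly optimal couplings on \<open>K \<times> K\<close> still has second marginal \<mu>, its cost
  is the limit of the costs because the cost is continuous, and its first marginal is the desired
  limit. Closedness of the ball comes out along the way.\<close>

lemma wasserstein_ball_sequentially_compact:
  fixes K :: "'a::euclidean_space set" and P :: "nat \<Rightarrow> 'a measure"
  assumes K: "compact K" and \<mu>: "\<mu> \<in> \<P> K" and q: "q \<ge> 1" "\<epsilon> > 0"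
    and P: "\<And>n. P n \<in> wasserstein_ball K q \<epsilon> \<mu>"
  obtains r :: "nat \<Rightarrow> nat" and Q where "strict_mono r" "Q \<in> wasserstein_ball K q \<epsilon> \<mu>"
    "\<And>f :: 'a \<Rightarrow> real. continuous_on K f \<Longrightarrow> (\<lambda>n. \<integral>y. f y \<partial>P (r n)) \<longlonglongrightarrow> (\<integral>y. f y \<partial>Q)"
proof -
  have P': "P n \<in> \<P> K" for n using P[of n] by (simp add: wasserstein_ball_def)
  have "\<exists>\<gamma>. \<gamma> \<in> couplings (P n) \<mu> \<and> (\<integral>z. norm (fst z - snd z) ^ q \<partial>\<gamma>) < \<epsilon> ^ q + inverse (real (Suc n))" for n
    by (rule wasserstein_ballD[OF P \<mu> q(1), of "inverse (real (Suc n))"]) auto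
  then obtain \<gamma> where \<gamma>: "\<And>n. \<gamma> n \<in> couplings (P n) \<mu>"
    "\<And>n. (\<integral>z. norm (fst z - snd z) ^ q \<partial>\<gamma> n) < \<epsilon> ^ q + inverse (real (Suc n))"
    by metis
  note \<gamma>' = couplings_prob_measures[OF P' \<mu> \<gamma>(1)]
  obtain r :: "nat \<Rightarrow> nat" and \<pi> where r: "strict_mono r" and \<pi>: "\<pi> \<in> \<P> (K \<times> K)"
    and lim: "\<And>f :: 'a \<times> 'a \<Rightarrow> real. continuous_on (K \<times> K) f \<Longrightarrow> (\<lambda>n. \<integral>z. f z \<partial>\<gamma> (r n)) \<longlonglongrightarrow> (\<integral>z. f z \<partial>\<pi>)"
    by (rule weak_sequential_compactness[OF compact_Times[OF K K], of \<gamma>]) (use \<gamma>' in blast)+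
  have cfst: "continuous_on (K \<times> K) (\<lambda>z. f (fst z))" and csnd: "continuous_on (K \<times> K) (\<lambda>z. f (snd z))"
    if "continuous_on K f" for f :: "'a \<Rightarrow> real"
    by (auto intro!: continuous_on_compose2[OF that] continuous_intros)
  let ?Q = "distr \<pi> (restrict_space borel K) fst"
  have eq: "(\<integral>z. f (snd z) \<partial>\<pi>) = (\<integral>y. f y \<partial>\<mu>)" if f: "continuous_on K f" for f :: "'a \<Rightarrow> real"
    using lim[OF csnd[OF f]] couplings_integral(2)[OF P' \<mu> \<gamma>(1) f] by (simp add: LIMSEQ_const_iff)
  have Q: "?Q \<in> \<P> K" "\<pi> \<in> couplings ?Q \<mu>"
    using fst_marginal_coupling[OF compact_imp_closed[OF K] \<mu> \<pi> eq] by auto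
  have "(\<lambda>n. \<epsilon> ^ q + inverse (real (Suc (r n)))) \<longlonglongrightarrow> \<epsilon> ^ q + 0"
    using LIMSEQ_subseq_LIMSEQ[OF LIMSEQ_inverse_real_of_nat r] by (intro tendsto_intros) (simp add: comp_def)
  then have "(\<integral>z. norm (fst z - snd z) ^ q \<partial>\<pi>) \<le> \<epsilon> ^ q"
    using LIMSEQ_le[OF lim[OF continuous_on_cost]] less_imp_le[OF \<gamma>(2)] by simp
  then have "?Q \<in> wasserstein_ball K q \<epsilon> \<mu>"
    using Q q by (intro wasserstein_ballI) auto
  moreover have "(\<lambda>n. \<integral>y. f y \<partial>P (r n)) \<longlonglongrightarrow> (\<integral>y. f y \<partial>?Q)" if f: "continuous_on K f" for f :: "'a \<Rightarrow> real"
    using lim[OF cfst[OF f]] couplings_integral(1)[OF P' \<mu> \<gamma>(1) f] couplings_integral(1)[OF Q(1) \<mu> Q(2) f] by simp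
  ultimately show thesis using that[OF r] by blast
qed

text \<open>For a coupling of P and \<mu>, integrate the pointwise bound
  \<open>\<phi> x \<le> F y + \<kappa> * norm (y - x) ^ q\<close>; the cost term is then controlled
  by the radius.\<close>

lemma transport_weak_duality:
  fixes K :: "'a::euclidean_space set"
  assumes K: "compact K" "K \<noteq> {}" and \<mu>: "\<mu> \<in> \<P> K" and q: "q \<ge> 1" and F: "continuous_on K F"
    and P: "P \<in> wasserstein_ball K q \<epsilon> \<mu>"
  shows "transport_dual K q \<epsilon> \<mu> F \<le> (\<integral>y. F y \<partial>P)"
  unfolding transport_dual_def
proof (rule cSUP_least)
  fix \<kappa> :: real assume "\<kappa> \<in> {0..}"
  then have \<kappa>: "\<kappa> \<ge> 0" by simp
  have P': "P \<in> \<P> K" using P by (simp add: wasserstein_ball_def)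
  define \<phi> where "\<phi> x = (INF y\<in>K. F y + \<kappa> * norm (x - y) ^ q)" for x
  have joint: "continuous_on (K \<times> K) (\<lambda>(x, y). F y + \<kappa> * norm (x - y) ^ q)"
    unfolding case_prod_beta'
    by (intro continuous_intros continuous_on_compose2[OF F]) auto
  have \<phi>: "continuous_on K \<phi>"
    unfolding \<phi>_def by (rule continuous_on_INF_param[OF K(1) K joint])
  have \<phi>_le: "\<phi> x \<le> F y + \<kappa> * norm (y - x) ^ q" if "x \<in> K" "y \<in> K" for x y
    unfolding \<phi>_def norm_minus_commute[of y x] using that(2)
    by (intro cINF_lower bounded_imp_bdd_below compact_imp_bounded compact_continuous_image K continuous_on_slice[OF joint that(1)])
  show "(\<integral>x. (INF y\<in>K. F y + \<kappa> * norm (x - y) ^ q) \<partial>\<mu>) - \<epsilon> ^ q * \<kappa> \<le> (\<integral>y. F y \<partial>P)"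
    unfolding \<phi>_def[symmetric]
  proof (rule field_le_epsilon)
    fix e :: real assume e: "e > 0"
    \<comment> \<open>Dividing by \<kappa> + 1 instead of \<kappa> keeps the slack positive at
      \<kappa> = 0, and \<kappa> times the slack is still at most e.\<close>
    then have "e / (\<kappa> + 1) > 0" using \<kappa> by simp
    then obtain \<gamma> where \<gamma>: "\<gamma> \<in> couplings P \<mu>" "(\<integral>z. norm (fst z - snd z) ^ q \<partial>\<gamma>) < \<epsilon> ^ q + e / (\<kappa> + 1)"
      by (rule wasserstein_ballD[OF P \<mu> q])
    note \<gamma>' = couplings_prob_measures[OF P' \<mu> \<gamma>(1)]
    have i: "integrable \<gamma> (\<lambda>z. F (fst z))" "integrable \<gamma> (\<lambda>z. norm (fst z - snd z) ^ q)"
      by (auto intro!: integrable_prob_measures[OF compact_Times[OF K(1) K(1)] \<gamma>'] continuous_on_compose2[OF F] continuous_intros)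
    have "(\<integral>x. \<phi> x \<partial>\<mu>) = (\<integral>z. \<phi> (snd z) \<partial>\<gamma>)"
      using couplings_integral(2)[OF P' \<mu> \<gamma>(1) \<phi>] by simp
    also have "\<dots> \<le> (\<integral>z. F (fst z) + \<kappa> * norm (fst z - snd z) ^ q \<partial>\<gamma>)"
      by (intro integral_prob_measures_mono[OF compact_Times[OF K(1) K(1)] \<gamma>'])
        (use \<phi>_le in \<open>auto intro!: continuous_on_compose2[OF \<phi>] continuous_on_compose2[OF F] continuous_intros\<close>)
    also have "\<dots> = (\<integral>y. F y \<partial>P) + \<kappa> * (\<integral>z. norm (fst z - snd z) ^ q \<partial>\<gamma>)"
      using i couplings_integral(1)[OF P' \<mu> \<gamma>(1) F] by simp
    also have "\<kappa> * (\<integral>z. norm (fst z - snd z) ^ q \<partial>\<gamma>) \<le> \<kappa> * (\<epsilon> ^ q + e / (\<kappa> + 1))"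
      using \<gamma>(2) \<kappa> by (intro mult_left_mono) auto
    also have "\<dots> \<le> \<epsilon> ^ q * \<kappa> + e"
    proof -
      have "\<kappa> * (e / (\<kappa> + 1)) \<le> e" using \<kappa> e by (simp add: field_simps)
      then show ?thesis by (simp add: algebra_simps)
    qed
    finally show "(\<integral>x. \<phi> x \<partial>\<mu>) - \<epsilon> ^ q * \<kappa> \<le> (\<integral>y. F y \<partial>P) + e" by simp
  qed
qed simp

text \<open>Realizes a randomized transport rule: from x, mass goes to y in N with probability
  \<open>w x y\<close>. Composition with \<mu> gives a plan whose first coordinate is the
  destination and whose second is the origin. Continuity of the weights makes the rule a
  kernel.\<close>

lemma finite_kernel_coupling:
  fixes K :: "'a::euclidean_space set" and w :: "'a \<Rightarrow> 'a \<Rightarrow> real"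
  assumes K: "compact K" and \<mu>: "\<mu> \<in> \<P> K" and N: "finite N" "N \<subseteq> K"
 and w: "\<And>x y. x \<in> K \<Longrightarrow> y \<in> N \<Longrightarrow> w x y \<ge> 0" "\<And>x. x \<in> K \<Longrightarrow> (\<Sum>y\<in>N. w x y) = 1"
      "\<And>y. y \<in> N \<Longrightarrow> continuous_on K (\<lambda>x. w x y)"
  obtains P \<gamma> where "P \<in> \<P> K" "\<gamma> \<in> couplings P \<mu>"
    "\<And>f. continuous_on K f \<Longrightarrow> (\<integral>y. f y \<partial>P) = (\<integral>x. (\<Sum>y\<in>N. w x y * f y) \<partial>\<mu>)"
    "\<And>f. continuous_on (K \<times> K) f \<Longrightarrow> (\<integral>z. f z \<partial>\<gamma>) = (\<integral>x. (\<Sum>y\<in>N. w x y * f (y, x)) \<partial>\<mu>)"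
proof -
  let ?X = "restrict_space borel (K \<times> K) :: ('a \<times> 'a) measure"
  define p where "p x = embed_pmf (\<lambda>y. if y \<in> N then w x y else 0)" for x
  have pmf_p: "pmf (p x) y = (if y \<in> N then w x y else 0)" if "x \<in> K" for x y
    unfolding p_def
  proof (rule pmf_embed_pmf)
    show "0 \<le> (if y \<in> N then w x y else 0)" for y using w(1) that by simp
    have "(\<integral>\<^sup>+ y. ennreal (if y \<in> N then w x y else 0) \<partial>count_space UNIV) = (\<Sum>y\<in>N. ennreal (w x y))"
      using N(1) by (subst nn_integral_count_space'[of N]) auto
    also have "\<dots> = ennreal (\<Sum>y\<in>N. w x y)" using w(1) that by (intro sum_ennreal) auto
    finally show "(\<integral>\<^sup>+ y. ennreal (if y \<in> N then w x y else 0) \<partial>count_space UNIV) = 1"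
      using w(2) that by simp
  qed
  \<comment> \<open>The discrete law lives on the whole type, so points outside N, which have mass
    zero, are sent to x to keep the map inside \<open>K \<times> K\<close>.\<close>
  define k where "k x = distr (measure_pmf (p x)) ?X (\<lambda>y. (if y \<in> N then y else x, x))" for x
  have m: "(\<lambda>y. (if y \<in> N then y else x, x)) \<in> measure_pmf (p x) \<rightarrow>\<^sub>M ?X" if "x \<in> K" for x
    using that N(2) by (auto simp: space_restrict_space)
  have int_k: "(\<integral>z. f z \<partial>k x) = (\<Sum>y\<in>N. w x y * f (y, x))"
    if "x \<in> K" "f \<in> borel_measurable ?X" for x and f :: "'a \<times> 'a \<Rightarrow> real"
  proof -
    have "(\<integral>z. f z \<partial>k x) = (\<integral>y. f (if y \<in> N then y else x, x) \<partial>measure_pmf (p x))"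
      unfolding k_def by (rule integral_distr[OF m that(2)]) (rule that(1))
    also have "\<dots> = (\<Sum>y\<in>N. f (if y \<in> N then y else x, x) * pmf (p x) y)"
      using N(1) pmf_p[OF that(1)] by (intro integral_measure_pmf_real) (auto simp: set_pmf_eq split: if_splits)
    finally show ?thesis using pmf_p[OF that(1)] by (simp add: mult.commute)
  qed
  have cont_sum: "continuous_on K (\<lambda>x. \<Sum>y\<in>N. w x y * f (y, x))" if "continuous_on (K \<times> K) f" for f :: "'a \<times> 'a \<Rightarrow> real"
    using N(2) by (intro continuous_intros w continuous_on_compose2[OF that]) auto
  have k: "k \<in> \<mu> \<rightarrow>\<^sub>M prob_algebra ?X"
  proof (rule prob_measures_kernelI)
    show "closed (K \<times> K)" using K by (intro closed_Times compact_imp_closed)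
    show "k x \<in> \<P> (K \<times> K)" if "x \<in> space \<mu>" for x
      using measure_pmf.prob_space_distr[OF m, of x] that prob_measuresD(2)[OF \<mu>]
      by (simp add: k_def space_prob_algebra)
    fix f :: "'a \<times> 'a \<Rightarrow> real" assume f: "continuous_on (K \<times> K) f"
    have "(\<lambda>x. \<Sum>y\<in>N. w x y * f (y, x)) \<in> borel_measurable \<mu>"
      by (rule borel_measurable_prob_measures[OF \<mu> cont_sum[OF f]])
    then show "(\<lambda>x. \<integral>z. f z \<partial>k x) \<in> borel_measurable \<mu>"
      using int_k borel_measurable_continuous_on_restrict[OF f] prob_measuresD(2)[OF \<mu>]
      by (subst measurable_cong) auto
  qed
  have \<mu>_in: "\<mu> \<in> space (prob_algebra \<mu>)" using prob_measuresD[OF \<mu>] by (simp add: space_prob_algebra)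
  define \<gamma> where "\<gamma> = \<mu> \<bind> k"
  have \<gamma>: "\<gamma> \<in> \<P> (K \<times> K)"
    using prob_space_bind'[OF \<mu>_in k] sets_bind'[OF \<mu>_in k] by (simp add: \<gamma>_def space_prob_algebra)
  have int_\<gamma>: "(\<integral>z. f z \<partial>\<gamma>) = (\<integral>x. (\<Sum>y\<in>N. w x y * f (y, x)) \<partial>\<mu>)" if f: "continuous_on (K \<times> K) f" for f :: "'a \<times> 'a \<Rightarrow> real"
  proof -
    interpret \<mu>: prob_space \<mu> using prob_measuresD[OF \<mu>] by simp
    have fm: "f \<in> borel_measurable ?X" by (rule borel_measurable_continuous_on_restrict[OF f])
    obtain B where B: "\<And>z. z \<in> K \<times> K \<Longrightarrow> \<bar>f z\<bar> \<le> B" using compact_real_bound[OF compact_Times[OF K K] f] by blast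
    have "(\<integral>z. f z \<partial>\<gamma>) = (\<integral>x. (\<integral>z. f z \<partial>k x) \<partial>\<mu>)"
      unfolding \<gamma>_def
    proof (rule integral_bind[OF fm _ measurable_prob_algebraD[OF k], where B=B and B'=1])
      show "AE x in \<mu>. emeasure (k x) (space (k x)) \<le> ennreal 1"
        using measurable_space[OF k] by (intro AE_I2) (auto simp: space_prob_algebra prob_space.emeasure_space_1)
    qed (use B \<mu>.finite_measure_axioms in \<open>auto simp: space_restrict_space\<close>)
    also have "\<dots> = (\<integral>x. (\<Sum>y\<in>N. w x y * f (y, x)) \<partial>\<mu>)"
      using int_k[OF _ fm] prob_measuresD(2)[OF \<mu>] by (intro Bochner_Integration.integral_cong) auto
    finally show ?thesis .
  qed
  have csnd: "continuous_on (K \<times> K) (\<lambda>z. f (snd z))" "continuous_on (K \<times> K) (\<lambda>z. f (fst z))"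
    if "continuous_on K f" for f :: "'a \<Rightarrow> real"
    by (auto intro!: continuous_on_compose2[OF that] continuous_intros)
  have marg: "(\<integral>z. f (snd z) \<partial>\<gamma>) = (\<integral>y. f y \<partial>\<mu>)" if "continuous_on K f" for f :: "'a \<Rightarrow> real"
    unfolding int_\<gamma>[OF csnd(1)[OF that]] using w(2) prob_measuresD(2)[OF \<mu>]
    by (intro Bochner_Integration.integral_cong) (auto simp: sum_distrib_right[symmetric])
  note P = fst_marginal_coupling[OF compact_imp_closed[OF K] \<mu> \<gamma> marg]
  show thesis
  proof (rule that[OF P _ int_\<gamma>])
    fix f :: "'a \<Rightarrow> real" assume f: "continuous_on K f"
    show "(\<integral>y. f y \<partial>distr \<gamma> (restrict_space borel K) fst) = (\<integral>x. (\<Sum>y\<in>N. w x y * f y) \<partial>\<mu>)"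
      using couplings_integral(1)[OF P(1) \<mu> P(2) f] int_\<gamma>[OF csnd(2)[OF f]] by simp
  qed
qed

section \<open>Wasserstein duality\<close>

text \<open>Uniform continuity in y holds with one modulus for all z, so a net of that mesh serves
  every z at once. Finiteness later allows minimization to be replaced by a finite sum with
  continuous weights.\<close>

lemma finite_minimizing_net:
  fixes E :: "'z::metric_space \<Rightarrow> 'a::metric_space \<Rightarrow> real"
  assumes Z: "compact Z" and K: "compact K" and E: "continuous_on (Z \<times> K) (\<lambda>(z, y). E z y)" and "\<delta> > 0"
  obtains N where "finite N" "N \<subseteq> K" "\<And>z y. z \<in> Z \<Longrightarrow> y \<in> K \<Longrightarrow> \<exists>y'\<in>N. E z y' \<le> E z y + \<delta>"
proof -
  have "continuous_on (K \<times> Z) (\<lambda>(y, z). E z y)"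
    unfolding case_prod_beta'
    by (rule continuous_on_compose2[OF E, of "K \<times> Z" "\<lambda>p. (snd p, fst p)", simplified])
      (auto intro!: continuous_intros)
  then obtain d where d: "d > 0"
    "\<And>y y' z. y \<in> K \<Longrightarrow> y' \<in> K \<Longrightarrow> z \<in> Z \<Longrightarrow> dist y y' < d \<Longrightarrow> \<bar>E z y - E z y'\<bar> < \<delta>"
    using uniformly_continuous_param[OF K Z _ \<open>\<delta> > 0\<close>] by blast
  obtain N where N: "finite N" "N \<subseteq> K" "K \<subseteq> (\<Union>x\<in>N. ball x d)"
    using seq_compact_imp_totally_bounded[of K] K d(1) unfolding compact_eq_seq_compact_metric by blast
  show thesis
  proof (rule that[OF N(1,2)])
    fix z y assume "z \<in> Z" "y \<in> K"
    moreover obtain y' where "y' \<in> N" "dist y' y < d" using N(3) \<open>y \<in> K\<close> by auto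
    ultimately show "\<exists>y'\<in>N. E z y' \<le> E z y + \<delta>"
      using d(2)[of y' y z] N(2) by (intro bexI[of _ y']) auto
  qed
qed

text \<open>Since u \<le> exp u, each excess \<open>e y - e y0\<close> times its Gibbs factor is at
  most \<open>exp (- \<beta> * e y0) / \<beta>\<close>, and the normalizing sum is at least
  \<open>exp (- \<beta> * e y0)\<close>. Thus each point of N costs at most 1 / \<beta>.\<close>

lemma softmin_gap:
  fixes e :: "'a \<Rightarrow> real"
  assumes N: "finite N" "y0 \<in> N" and \<beta>: "\<beta> > 0"
  shows "(\<Sum>y\<in>N. exp (- \<beta> * e y) / (\<Sum>y'\<in>N. exp (- \<beta> * e y')) * e y) \<le> e y0 + card N / \<beta>"
proof -
  define S where "S = (\<Sum>y\<in>N. exp (- \<beta> * e y))"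
  have S_ge: "exp (- \<beta> * e y0) \<le> S"
    unfolding S_def using N by (intro member_le_sum) auto
  then have S: "S > 0" using less_le_trans[OF exp_gt_zero] by blast
  have summand: "exp (- \<beta> * e y) * (e y - e y0) \<le> exp (- \<beta> * e y0) / \<beta>" for y
  proof -
    have "\<beta> * (e y - e y0) \<le> exp (\<beta> * (e y - e y0))"
      using exp_ge_add_one_self[of "\<beta> * (e y - e y0)"] by linarith
    then have "exp (- \<beta> * e y) * (\<beta> * (e y - e y0)) \<le> exp (- \<beta> * e y) * exp (\<beta> * (e y - e y0))"
      by (intro mult_left_mono) auto
    also have "\<dots> = exp (- \<beta> * e y0)" by (simp add: exp_add[symmetric] algebra_simps)
    finally show ?thesis using \<beta> by (simp add: field_simps)
  qed
  have "(\<Sum>y\<in>N. exp (- \<beta> * e y) * e y) = (\<Sum>y\<in>N. exp (- \<beta> * e y) * (e y - e y0)) + S * e y0"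
    by (simp add: S_def sum_distrib_right right_diff_distrib sum_subtractf)
  also have "\<dots> \<le> card N * (exp (- \<beta> * e y0) / \<beta>) + S * e y0"
    using sum_mono[of N, OF summand] by simp
  also have "\<dots> \<le> card N * (S / \<beta>) + S * e y0"
    using S_ge S \<beta> by (intro add_mono mult_left_mono divide_right_mono) auto
  finally have "(\<Sum>y\<in>N. exp (- \<beta> * e y) * e y) / S \<le> e y0 + card N / \<beta>"
    using S \<beta> by (simp add: field_simps)
  then show ?thesis
    unfolding S_def[symmetric] by (simp add: sum_divide_distrib)
qed

text \<open>\<open>l z\<close> is the least k in [0, \<Lambda>] with \<open>C k z \<le> c\<close>.
  Its sublevel sets are projections of compact sets, which gives measurability without monotonicity
  of C in k. A positive least k must satisfy the constraint with equality, which is the slackness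
  identity.\<close>

lemma measurable_least_multiplier:
  fixes C :: "real \<Rightarrow> 'z::euclidean_space \<Rightarrow> real"
  assumes Z: "compact Z" and C: "continuous_on ({0..\<Lambda>} \<times> Z) (\<lambda>(k, z). C k z)"
    and \<Lambda>: "\<Lambda> \<ge> 0" "\<And>z. z \<in> Z \<Longrightarrow> C \<Lambda> z \<le> c"
  shows "\<exists>l\<in>borel_measurable (restrict_space borel Z).
    \<forall>z\<in>Z. l z \<in> {0..\<Lambda>} \<and> C (l z) z \<le> c \<and> l z * C (l z) z = l z * c"
proof -
  define S where "S z = {k \<in> {0..\<Lambda>}. C k z \<le> c}" for z
  define l where "l z = Inf (S z)" for z
  have Cz: "continuous_on {0..\<Lambda>} (\<lambda>k. C k z)" if "z \<in> Z" for z
    by (rule continuous_on_compose2[OF C, of "{0..\<Lambda>}" "\<lambda>k. (k, z)", simplified])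
      (use that in \<open>auto intro!: continuous_intros\<close>)
  have S_ne: "\<Lambda> \<in> S z" if "z \<in> Z" for z using \<Lambda> that by (auto simp: S_def)
  have S_bdd: "bdd_below (S z)" for z by (auto simp: S_def intro!: bdd_belowI[of _ 0])
  have S_closed: "closed (S z)" if "z \<in> Z" for z
    using continuous_closed_preimage[OF Cz[OF that] closed_atLeastAtMost closed_atMost, of c]
    by (simp add: S_def vimage_def Int_def)
  have l: "l z \<in> S z" if "z \<in> Z" for z
    unfolding l_def using closed_contains_Inf[OF _ S_bdd S_closed] S_ne that by blast
  have l_le: "l z \<le> k" if "k \<in> S z" for z k
    unfolding l_def by (rule cInf_lower[OF that S_bdd])
  show ?thesis
  proof (intro bexI[of _ l] ballI conjI)
    show "l \<in> borel_measurable (restrict_space borel Z)"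
      unfolding borel_measurable_iff_le
    proof (intro allI)
      fix r
      let ?A = "{p \<in> {0..min r \<Lambda>} \<times> Z. (case p of (k, z) \<Rightarrow> C k z) \<le> c}"
      have "{w \<in> space (restrict_space borel Z). l w \<le> r} = snd ` ?A"
      proof (intro set_eqI iffI)
        fix z assume "z \<in> {w \<in> space (restrict_space borel Z). l w \<le> r}"
        then have "z \<in> Z" "l z \<le> r" by (auto simp: space_restrict_space)
        then have "(l z, z) \<in> ?A" using l[of z] by (auto simp: S_def)
        then show "z \<in> snd ` ?A" by force
      next
        fix z assume "z \<in> snd ` ?A"
        then obtain k where "k \<in> S z" "k \<le> r" "z \<in> Z" by (auto simp: S_def)
        then show "z \<in> {w \<in> space (restrict_space borel Z). l w \<le> r}"
          using l_le[of k z] by (auto simp: space_restrict_space)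
      qed
      moreover have "compact ?A"
      proof -
        have "continuous_on ({0..min r \<Lambda>} \<times> Z) (\<lambda>(k, z). C k z)"
          by (rule continuous_on_subset[OF C]) auto
        then have "closed ?A"
          using continuous_closed_preimage[of "{0..min r \<Lambda>} \<times> Z" "\<lambda>(k, z). C k z" "{..c}"] Z
          by (simp add: vimage_def Int_def closed_Times compact_imp_closed)
        moreover have "bounded ({0..min r \<Lambda>} \<times> Z)"
          by (intro compact_imp_bounded compact_Times compact_Icc Z)
        then have "bounded ?A" by (rule bounded_subset) auto
        ultimately show ?thesis by (simp add: compact_eq_bounded_closed)
      qed
      then have "compact (snd ` ?A)" by (intro compact_continuous_image continuous_intros)
      then have "snd ` ?A \<in> sets borel" by (intro borel_closed compact_imp_closed)
      moreover have "snd ` ?A \<subseteq> Z" by auto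
      ultimately show "{w \<in> space (restrict_space borel Z). l w \<le> r} \<in> sets (restrict_space borel Z)"
        by (auto simp: sets_restrict_space)
    qed
    fix z assume z: "z \<in> Z"
    show l': "l z \<in> {0..\<Lambda>}" "C (l z) z \<le> c" using l[OF z] by (auto simp: S_def)
    show "l z * C (l z) z = l z * c"
    proof (cases "l z = 0")
      case False
      \<comment> \<open>As 0 is infeasible, the intermediate value theorem supplies some k up to
        \<open>l z\<close> with \<open>C k z = c\<close>; this k is feasible, so minimality forces
        it to be \<open>l z\<close>.\<close>
      then have "0 \<notin> S z" using l_le[of 0 z] l' by auto
      then have "c \<le> C 0 z" using \<Lambda>(1) by (auto simp: S_def)
      moreover have "continuous_on {0..l z} (\<lambda>k. C k z)"
        using l' by (intro continuous_on_subset[OF Cz[OF z]]) auto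
      ultimately obtain k where k: "0 \<le> k" "k \<le> l z" "C k z = c"
        using IVT2'[of "\<lambda>k. C k z" "l z" c 0] l' by auto
      then have "k \<in> S z" using l' by (auto simp: S_def)
      then have "k = l z" using l_le[of k z] k(2) by auto
      with k show ?thesis by simp
    qed simp
  qed
qed

text \<open>The parameter z stands for a state-action pair; a one-point Z gives the case of a single
  measure. Compactness of Z makes one net, one bound on F and one bound on the multipliers valid for
  all z.\<close>

locale transport_family =
  fixes K :: "'a::euclidean_space set" and Z :: "'z::euclidean_space set"
    and q :: nat and \<epsilon> :: real and \<mu> :: "'z \<Rightarrow> 'a measure" and F :: "'z \<Rightarrow> 'a \<Rightarrow> real"
  assumes K: "compact K" "K \<noteq> {}" and Z: "compact Z" and q: "q \<ge> 1" and \<epsilon>: "\<epsilon> > 0"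
    and \<mu>_cont: "weakly_continuous_on Z K \<mu>" and \<mu>: "\<And>z. z \<in> Z \<Longrightarrow> \<mu> z \<in> \<P> K"
    and F: "continuous_on (Z \<times> K) (\<lambda>(z, y). F z y)"
begin

definition dual_integrand :: "real \<Rightarrow> 'z \<Rightarrow> 'a \<Rightarrow> real" where
  "dual_integrand \<kappa> z x = (INF y\<in>K. F z y + \<kappa> * norm (x - y) ^ q)"

definition dual_objective :: "real \<Rightarrow> 'z \<Rightarrow> real" where
  "dual_objective \<kappa> z = (\<integral>x. dual_integrand \<kappa> z x \<partial>\<mu> z) - \<epsilon> ^ q * \<kappa>"

abbreviation dual :: "'z \<Rightarrow> real" where
  "dual z \<equiv> transport_dual K q \<epsilon> (\<mu> z) (F z)"

lemma dual_eq_SUP: "dual z = (SUP \<kappa>\<in>{0..}. dual_objective \<kappa> z)"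
  by (simp add: transport_dual_def dual_objective_def dual_integrand_def)

section \<open>Regularity of the dual problem in the multiplier and the parameter\<close>

lemma continuous_on_F1: "z \<in> Z \<Longrightarrow> continuous_on K (F z)"
  by (rule continuous_on_slice[OF F])

lemma continuous_on_F_comp:
  assumes "continuous_on S f" "continuous_on S g" "f ` S \<subseteq> Z" "g ` S \<subseteq> K"
  shows "continuous_on S (\<lambda>s. F (f s) (g s))"
  by (rule continuous_on_compose2[OF F, of S "\<lambda>s. (f s, g s)", simplified])
    (use assms in \<open>auto intro!: continuous_intros\<close>)

lemma continuous_on_dual_integrand:
  "continuous_on (({0..L} \<times> Z) \<times> K) (\<lambda>(p, x). dual_integrand (fst p) (snd p) x)"
  unfolding dual_integrand_def case_prod_beta'
  by (rule continuous_on_INF_param[OF _ K])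
    (auto intro!: compact_Times K Z continuous_intros continuous_on_F_comp simp: case_prod_beta')

lemma weakly_continuous_snd: "weakly_continuous_on (S \<times> Z) K (\<lambda>p. \<mu> (snd p))"
  unfolding weakly_continuous_on_def
proof (intro allI impI)
  fix f :: "'a \<Rightarrow> real" assume "continuous_on K f \<and> bounded (f ` K)"
  then have "continuous_on Z (\<lambda>z. \<integral>y. f y \<partial>\<mu> z)"
    using \<mu>_cont unfolding weakly_continuous_on_def by blast
  then show "continuous_on (S \<times> Z) (\<lambda>p. \<integral>y. f y \<partial>\<mu> (snd p))"
    by (rule continuous_on_compose2) (auto intro!: continuous_intros)
qed

lemma continuous_on_integral_snd:
  fixes L :: real and g :: "real \<times> 'z \<Rightarrow> 'a \<Rightarrow> real"
  assumes "continuous_on (({0..L} \<times> Z) \<times> K) (\<lambda>(p, x). g p x)"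
  shows "continuous_on ({0..L} \<times> Z) (\<lambda>p. \<integral>x. g p x \<partial>\<mu> (snd p))"
proof (rule continuous_on_integral_param[where Z="{0..L} \<times> Z" and N="\<lambda>p. \<mu> (snd p)" and F=g, OF _ K(1)])
  show "weakly_continuous_on ({0..L} \<times> Z) K (\<lambda>p. \<mu> (snd p))" by (rule weakly_continuous_snd)
qed (use assms in \<open>auto intro!: compact_Times Z \<mu>\<close>)

lemma continuous_on_dual_objective: "continuous_on ({0..L} \<times> Z) (\<lambda>p. dual_objective (fst p) (snd p))"
  unfolding dual_objective_def
  by (intro continuous_intros continuous_on_integral_snd continuous_on_dual_integrand)

lemma continuous_on_dual_integrand1:
  assumes "z \<in> Z" "\<kappa> \<ge> 0"
  shows "continuous_on K (dual_integrand \<kappa> z)"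
  using continuous_on_slice[OF continuous_on_dual_integrand, of "(\<kappa>, z)" \<kappa>] assms by simp

lemma dual_integrand_le:
  assumes "z \<in> Z" "\<kappa> \<ge> 0" "y \<in> K"
  shows "dual_integrand \<kappa> z x \<le> F z y + \<kappa> * norm (x - y) ^ q"
  unfolding dual_integrand_def using assms
  by (intro cINF_lower bounded_imp_bdd_below compact_imp_bounded compact_continuous_image K continuous_intros continuous_on_F1)

lemma F_bound:
  obtains B where "B > 0" "\<And>z y. z \<in> Z \<Longrightarrow> y \<in> K \<Longrightarrow> \<bar>F z y\<bar> \<le> B"
proof -
  obtain B where "B > 0" "\<And>p. p \<in> Z \<times> K \<Longrightarrow> \<bar>case p of (z, y) \<Rightarrow> F z y\<bar> \<le> B"
    using compact_real_bound[OF compact_Times[OF Z K(1)] F] by blast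
  then show thesis by (intro that[of B]) force+
qed

lemma dual_objective_le:
  assumes "\<And>y. y \<in> K \<Longrightarrow> F z y \<le> B" "z \<in> Z" "\<kappa> \<ge> 0"
  shows "dual_objective \<kappa> z \<le> B - \<epsilon> ^ q * \<kappa>"
proof -
  interpret prob_space "\<mu> z" using \<mu>[OF assms(2)] by (simp add: space_prob_algebra)
  \<comment> \<open>Leaving the mass in place, y = x, costs nothing because q \<ge> 1.\<close>
  have "dual_integrand \<kappa> z x \<le> B" if "x \<in> K" for x
    using dual_integrand_le[OF assms(2,3) that, of x] assms(1)[OF that] q by (simp add: power_0_left)
  then have "(\<integral>x. dual_integrand \<kappa> z x \<partial>\<mu> z) \<le> (\<integral>x. B \<partial>\<mu> z)"
    by (intro integral_prob_measures_mono[OF K(1) \<mu>] continuous_on_dual_integrand1 assms continuous_on_const)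
  then show ?thesis by (simp add: dual_objective_def prob_space)
qed

lemma dual_objective_le_dual:
  assumes "z \<in> Z" "\<kappa> \<ge> 0"
  shows "dual_objective \<kappa> z \<le> dual z"
proof -
  obtain B where B: "B > 0" "\<And>z y. z \<in> Z \<Longrightarrow> y \<in> K \<Longrightarrow> \<bar>F z y\<bar> \<le> B" using F_bound by blast
  have "dual_objective \<kappa>' z \<le> B" if "\<kappa>' \<ge> 0" for \<kappa>'
  proof -
    have "dual_objective \<kappa>' z \<le> B - \<epsilon> ^ q * \<kappa>'"
      using B(2)[OF assms(1)] by (intro dual_objective_le assms that) (auto simp: abs_le_iff)
    moreover have "0 \<le> \<epsilon> ^ q * \<kappa>'" using \<epsilon> that by simp
    ultimately show ?thesis by linarith
  qed
  then show ?thesis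
    unfolding dual_eq_SUP using assms by (intro cSUP_upper bdd_aboveI[of _ B]) auto
qed

text \<open>Large multipliers are useless, so the supremum runs over a compact set and is continuous.\<close>

lemma continuous_on_dual: "continuous_on Z dual"
proof -
  obtain B where B: "B > 0" "\<And>z y. z \<in> Z \<Longrightarrow> y \<in> K \<Longrightarrow> \<bar>F z y\<bar> \<le> B" using F_bound by blast
  \<comment> \<open>Beyond this value the upper bound \<open>B - \<epsilon> ^ q * \<kappa>\<close>
    falls below -B, a lower bound for the objective at multiplier 0.\<close>
  define L where "L = 2 * B / \<epsilon> ^ q"
  have \<epsilon>q: "\<epsilon> ^ q > 0" using \<epsilon> by simp
  have L: "L \<ge> 0" using B \<epsilon>q by (simp add: L_def)
  have eq: "dual z = (SUP \<kappa>\<in>{0..L}. dual_objective \<kappa> z)" if z: "z \<in> Z" for z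
  proof (rule antisym)
    have bdd: "bdd_above ((\<lambda>\<kappa>. dual_objective \<kappa> z) ` {0..L})"
      using dual_objective_le_dual[OF z] by (intro bdd_aboveI[of _ "dual z"]) auto
    show "dual z \<le> (SUP \<kappa>\<in>{0..L}. dual_objective \<kappa> z)"
      unfolding dual_eq_SUP
    proof (rule cSUP_least)
      fix \<kappa> :: real assume "\<kappa> \<in> {0..}"
      then have \<kappa>: "\<kappa> \<ge> 0" by simp
      show "dual_objective \<kappa> z \<le> (SUP \<kappa>\<in>{0..L}. dual_objective \<kappa> z)"
      proof (cases "\<kappa> \<le> L")
        case True
        then show ?thesis using \<kappa> bdd by (intro cSUP_upper) auto
      next
        case False
        have "dual_objective \<kappa> z \<le> B - \<epsilon> ^ q * \<kappa>"
          using B(2)[OF z] by (intro dual_objective_le z \<kappa>) (auto simp: abs_le_iff)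
        also have "\<dots> \<le> - B"
          using False \<epsilon>q by (simp add: L_def field_simps)
        also have "- B \<le> dual_objective 0 z"
        proof -
          have "- B \<le> F z y" if "y \<in> K" for y
            using B(2)[OF z that] by linarith
          then have "- B \<le> dual_integrand 0 z x" for x
            unfolding dual_integrand_def using K(2) by (intro cINF_greatest) auto
          then have "(\<integral>x. - B \<partial>\<mu> z) \<le> (\<integral>x. dual_integrand 0 z x \<partial>\<mu> z)"
            by (intro integral_prob_measures_mono[OF K(1) \<mu>[OF z]] continuous_on_dual_integrand1 z continuous_on_const) auto
          then show ?thesis
            using prob_measuresD(3)[OF \<mu>[OF z]] by (simp add: dual_objective_def prob_space.prob_space)
        qed
        also have "\<dots> \<le> (SUP \<kappa>\<in>{0..L}. dual_objective \<kappa> z)"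
          using L bdd by (intro cSUP_upper) auto
        finally show ?thesis .
      qed
    qed simp
    show "(SUP \<kappa>\<in>{0..L}. dual_objective \<kappa> z) \<le> dual z"
      using L dual_objective_le_dual[OF z] by (intro cSUP_least) auto
  qed
  have "continuous_on (Z \<times> {0..L}) (\<lambda>(z, \<kappa>). dual_objective \<kappa> z)"
    unfolding case_prod_beta'
    by (rule continuous_on_compose2[OF continuous_on_dual_objective[of L], of _ "\<lambda>p. (snd p, fst p)", simplified])
      (auto intro!: continuous_intros)
  then have "continuous_on Z (\<lambda>z. SUP \<kappa>\<in>{0..L}. dual_objective \<kappa> z)"
    using L by (intro continuous_on_SUP_param[OF Z]) auto
  then show ?thesis using eq by (simp cong: continuous_on_cong)
qed

text \<open>
  The adversary moves mass from \<open>x\<close> to a point \<open>y\<close> of a finite net with Gibbs weights proportional to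
  \<open>exp (- \<beta> (F z y + k |x - y|\<^sup>q))\<close>, which nearly attain the infimum in the dual integrand. The weights are
  continuous, so the transport cost depends continuously on the multiplier \<open>k\<close>, and the least \<open>k\<close> that
  makes the plan feasible depends on \<open>z\<close> in a Borel way and satisfies complementary slackness.
\<close>

theorem near_optimal_kernel:
  assumes "\<delta> > 0"
  obtains P where "P \<in> restrict_space borel Z \<rightarrow>\<^sub>M prob_algebra (restrict_space borel K)"
    "\<And>z. z \<in> Z \<Longrightarrow> P z \<in> wasserstein_ball K q \<epsilon> (\<mu> z)"
    "\<And>z. z \<in> Z \<Longrightarrow> (\<integral>y. F z y \<partial>P z) \<le> dual z + \<delta>"
proof -
  obtain B where B: "B > 0" "\<And>z y. z \<in> Z \<Longrightarrow> y \<in> K \<Longrightarrow> \<bar>F z y\<bar> \<le> B" using F_bound by blast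
  have \<epsilon>q: "\<epsilon> ^ q > 0" using \<epsilon> by simp
  \<comment> \<open>Chosen so that \<open>\<Lambda> * (\<epsilon> ^ q / 2) = 2 * B + 1\<close>: half
    of the transport budget at this multiplier absorbs the oscillation 2 * B of F and a smoothing
    error of at most 1.\<close>
  define \<Lambda> where "\<Lambda> = 2 * (2 * B + 1) / \<epsilon> ^ q"
  have \<Lambda>: "\<Lambda> > 0" using B \<epsilon>q by (simp add: \<Lambda>_def)
  have cE: "continuous_on ((({0..\<Lambda>} \<times> Z) \<times> K) \<times> K) (\<lambda>(s, y). F (snd (fst s)) y + fst (fst s) * norm (y - snd s) ^ q)"
    by (auto intro!: continuous_intros continuous_on_F_comp simp: case_prod_beta')
  \<comment> \<open>Two nets are merged. This one nearly minimizes the penalized integrand for every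
    multiplier, parameter and origin, which gives optimality; \<open>N2\<close> contains a cheap
    destination for every origin, which gives feasibility at \<Lambda>.\<close>
  obtain N1 where N1: "finite N1" "N1 \<subseteq> K"
    "\<And>s y. s \<in> ({0..\<Lambda>} \<times> Z) \<times> K \<Longrightarrow> y \<in> K \<Longrightarrow>
      \<exists>y'\<in>N1. F (snd (fst s)) y' + fst (fst s) * norm (y' - snd s) ^ q \<le> F (snd (fst s)) y + fst (fst s) * norm (y - snd s) ^ q + \<delta> / 2"
    by (rule finite_minimizing_net[OF _ K(1) cE, of "\<delta> / 2"])
      (use \<open>\<delta> > 0\<close> K Z in \<open>auto intro!: compact_Times\<close>)
  have cN: "continuous_on (K \<times> K) (\<lambda>(x, y). norm (y - x) ^ q)"
    by (auto intro!: continuous_intros simp: case_prod_beta')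
  obtain N2 where N2: "finite N2" "N2 \<subseteq> K"
    "\<And>x y. x \<in> K \<Longrightarrow> y \<in> K \<Longrightarrow> \<exists>y'\<in>N2. norm (y' - x) ^ q \<le> norm (y - x) ^ q + \<epsilon> ^ q / 2"
    by (rule finite_minimizing_net[OF K(1) K(1) cN, of "\<epsilon> ^ q / 2"]) (use \<epsilon>q in auto)
  define N where "N = N1 \<union> N2"
  have N: "finite N" "N \<subseteq> K" using N1 N2 by (auto simp: N_def)
  have "N \<noteq> {}" using N2(3) K(2) by (fastforce simp: N_def)
  \<comment> \<open>The smoothing error: at most 1 for the feasibility estimate and at most \<delta>
    / 2 for optimality, the net taking the other half. Then \<beta> is set so that the gap
    \<open>card N / \<beta>\<close> equals \<eta>.\<close>
  define \<eta> where "\<eta> = min 1 (\<delta> / 2)"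
  have \<eta>: "\<eta> > 0" "\<eta> \<le> 1" "\<eta> \<le> \<delta> / 2" using \<open>\<delta> > 0\<close> by (auto simp: \<eta>_def)
  define \<beta> where "\<beta> = card N / \<eta>"
  have \<beta>: "\<beta> > 0" "card N / \<beta> = \<eta>"
    using \<eta> N \<open>N \<noteq> {}\<close> by (auto simp: \<beta>_def card_gt_0_iff)
  define w where "w p x y = exp (- \<beta> * (F (snd p) y + fst p * norm (y - x) ^ q)) /
    (\<Sum>y'\<in>N. exp (- \<beta> * (F (snd p) y' + fst p * norm (y' - x) ^ q)))" for p x y
  have den: "(\<Sum>y'\<in>N. exp (- \<beta> * (F (snd p) y' + fst p * norm (y' - x) ^ q))) > 0" for p x
    using N \<open>N \<noteq> {}\<close> by (intro sum_pos) auto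
  have w_nonneg: "w p x y \<ge> 0" for p x y
    using den[of p x] by (simp add: w_def)
  have w_sum: "(\<Sum>y\<in>N. w p x y) = 1" for p x
    using den[of p x] by (simp add: w_def sum_divide_distrib[symmetric])
  have w_cont: "continuous_on (({0..\<Lambda>} \<times> Z) \<times> K) (\<lambda>(p, x). w p x y)" if "y \<in> N" for y
    unfolding w_def case_prod_beta'
    using that N(2) den by (intro continuous_intros continuous_on_F_comp) (auto simp: less_imp_neq[symmetric])
  have w_cont1: "continuous_on K (\<lambda>x. w p x y)" if "p \<in> {0..\<Lambda>} \<times> Z" "y \<in> N" for p y
    using continuous_on_slice[OF w_cont[OF that(2)] that(1)] .
  have avg_cont: "continuous_on ({0..\<Lambda>} \<times> Z) (\<lambda>p. \<integral>x. (\<Sum>y\<in>N. w p x y * f (y, x)) \<partial>\<mu> (snd p))"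
    if f: "continuous_on (K \<times> K) f" for f :: "'a \<times> 'a \<Rightarrow> real"
  proof (rule continuous_on_integral_snd)
    have "continuous_on (({0..\<Lambda>} \<times> Z) \<times> K) (\<lambda>s. \<Sum>y\<in>N. w (fst s) (snd s) y * f (y, snd s))"
      using w_cont N(2) unfolding case_prod_beta'
      by (intro continuous_intros continuous_on_compose2[OF f]) auto
    then show "continuous_on (({0..\<Lambda>} \<times> Z) \<times> K) (\<lambda>(p, x). \<Sum>y\<in>N. w p x y * f (y, x))"
      by (simp add: case_prod_beta')
  qed
  define C where "C k z = (\<integral>x. (\<Sum>y\<in>N. w (k, z) x y * norm (y - x) ^ q) \<partial>\<mu> z)" for k z
  define H where "H k z = (\<integral>x. (\<Sum>y\<in>N. w (k, z) x y * F z y) \<partial>\<mu> z)" for k z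
  have C_cont: "continuous_on ({0..\<Lambda>} \<times> Z) (\<lambda>(k, z). C k z)"
    using avg_cont[OF continuous_on_cost[of _ q]] by (simp add: C_def case_prod_beta')
  \<comment> \<open>The penalized value of the Gibbs plan is within \<eta> of any bound \<psi> that
    some net point meets at each x. Used with a constant for feasibility and with the dual integrand
    plus \<delta> / 2 for optimality.\<close>
  have HC_le: "H k z + k * C k z \<le> (\<integral>x. \<psi> x \<partial>\<mu> z) + \<eta>"
    if k: "k \<in> {0..\<Lambda>}" and z: "z \<in> Z" and \<psi>: "continuous_on K \<psi>"
      and le: "\<And>x. x \<in> K \<Longrightarrow> \<exists>y\<in>N. F z y + k * norm (y - x) ^ q \<le> \<psi> x" for k z \<psi>
  proof -
    interpret prob_space "\<mu> z" using \<mu>[OF z] by (simp add: space_prob_algebra)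
    have p: "(k, z) \<in> {0..\<Lambda>} \<times> Z" using k z by simp
    have cF: "continuous_on K (\<lambda>x. \<Sum>y\<in>N. w (k, z) x y * F z y)"
      and cC: "continuous_on K (\<lambda>x. \<Sum>y\<in>N. w (k, z) x y * norm (y - x) ^ q)"
      by (intro continuous_intros w_cont1[OF p]; simp)+
    have "H k z + k * C k z =
        (\<integral>x. (\<Sum>y\<in>N. w (k, z) x y * F z y) + k * (\<Sum>y\<in>N. w (k, z) x y * norm (y - x) ^ q) \<partial>\<mu> z)"
      unfolding H_def C_def
      using integrable_prob_measures[OF K(1) \<mu>[OF z] cF] integrable_prob_measures[OF K(1) \<mu>[OF z] cC] by simp
    also have "\<dots> \<le> (\<integral>x. \<psi> x + \<eta> \<partial>\<mu> z)"
    proof (rule integral_prob_measures_mono[OF K(1) \<mu>[OF z]])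
      fix x assume x: "x \<in> K"
      obtain y0 where y0: "y0 \<in> N" "F z y0 + k * norm (y0 - x) ^ q \<le> \<psi> x" using le[OF x] by blast
      have "(\<Sum>y\<in>N. w (k, z) x y * F z y) + k * (\<Sum>y\<in>N. w (k, z) x y * norm (y - x) ^ q) =
          (\<Sum>y\<in>N. w (k, z) x y * (F z y + k * norm (y - x) ^ q))"
        by (simp add: sum_distrib_left sum.distrib[symmetric] algebra_simps)
      also have "\<dots> \<le> (F z y0 + k * norm (y0 - x) ^ q) + card N / \<beta>"
        unfolding w_def fst_conv snd_conv by (rule softmin_gap[OF N(1) y0(1) \<beta>(1)])
      finally show "(\<Sum>y\<in>N. w (k, z) x y * F z y) + k * (\<Sum>y\<in>N. w (k, z) x y * norm (y - x) ^ q) \<le> \<psi> x + \<eta>"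
        using y0(2) \<beta>(2) by linarith
    qed (intro continuous_intros cF cC \<psi>)+
    finally show ?thesis
      using integrable_prob_measures[OF K(1) \<mu>[OF z] \<psi>] by (simp add: prob_space)
  qed
  have H_ge: "- B \<le> H k z" if k: "k \<in> {0..\<Lambda>}" and z: "z \<in> Z" for k z
  proof -
    interpret prob_space "\<mu> z" using \<mu>[OF z] by (simp add: space_prob_algebra)
    have p: "(k, z) \<in> {0..\<Lambda>} \<times> Z" using k z by simp
    have "(\<integral>x. - B \<partial>\<mu> z) \<le> H k z"
      unfolding H_def
    proof (rule integral_prob_measures_mono[OF K(1) \<mu>[OF z]])
      fix x
      have "(\<Sum>y\<in>N. w (k, z) x y * (- B)) \<le> (\<Sum>y\<in>N. w (k, z) x y * F z y)"
      proof (intro sum_mono mult_left_mono w_nonneg)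
        fix y assume "y \<in> N"
        then show "- B \<le> F z y" using B(2)[OF z, of y] N(2) by (auto simp: abs_le_iff)
      qed
      then show "- B \<le> (\<Sum>y\<in>N. w (k, z) x y * F z y)"
        using w_sum by (simp add: sum_distrib_right[symmetric] sum_negf)
    qed (intro continuous_intros w_cont1[OF p]; simp)+
    then show ?thesis by (simp add: prob_space)
  qed
  \<comment> \<open>A destination of cost at most \<open>\<epsilon> ^ q / 2\<close> bounds the
    penalized value from above and F \<ge> -B bounds its F part from below; the choice of \<Lambda>
    leaves at most \<open>\<epsilon> ^ q\<close> for the cost.\<close>
  have C_\<Lambda>: "C \<Lambda> z \<le> \<epsilon> ^ q" if z: "z \<in> Z" for z
  proof -
    interpret prob_space "\<mu> z" using \<mu>[OF z] by (simp add: space_prob_algebra)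
    have "\<exists>y\<in>N. F z y + \<Lambda> * norm (y - x) ^ q \<le> B + \<Lambda> * (\<epsilon> ^ q / 2)" if x: "x \<in> K" for x
    proof -
      obtain y where y: "y \<in> N2" "norm (y - x) ^ q \<le> \<epsilon> ^ q / 2"
        using N2(3)[OF x x] q by (auto simp: power_0_left)
      moreover have "F z y \<le> B" using B(2)[OF z, of y] y(1) N2(2) by (auto simp: abs_le_iff)
      moreover have "\<Lambda> * norm (y - x) ^ q \<le> \<Lambda> * (\<epsilon> ^ q / 2)"
        using y(2) \<Lambda> by (intro mult_left_mono) auto
      ultimately show ?thesis by (intro bexI[of _ y]) (auto simp: N_def)
    qed
    then have "H \<Lambda> z + \<Lambda> * C \<Lambda> z \<le> (\<integral>x. B + \<Lambda> * (\<epsilon> ^ q / 2) \<partial>\<mu> z) + \<eta>"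
      using \<Lambda> by (intro HC_le z continuous_on_const) auto
    then have "\<Lambda> * C \<Lambda> z \<le> 2 * B + 1 + \<Lambda> * (\<epsilon> ^ q / 2)"
      using H_ge[OF _ z, of \<Lambda>] \<eta> \<Lambda> by (simp add: prob_space)
    also have "2 * B + 1 = \<Lambda> * (\<epsilon> ^ q / 2)" using \<epsilon> by (simp add: \<Lambda>_def)
    also have "\<Lambda> * (\<epsilon> ^ q / 2) + \<Lambda> * (\<epsilon> ^ q / 2) = \<Lambda> * \<epsilon> ^ q" by simp
    finally show ?thesis using \<Lambda> by simp
  qed
  have "\<exists>l\<in>borel_measurable (restrict_space borel Z).
      \<forall>z\<in>Z. l z \<in> {0..\<Lambda>} \<and> C (l z) z \<le> \<epsilon> ^ q \<and> l z * C (l z) z = l z * \<epsilon> ^ q"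
    by (rule measurable_least_multiplier[OF Z C_cont less_imp_le[OF \<Lambda>] C_\<Lambda>])
  then obtain l where lm: "l \<in> borel_measurable (restrict_space borel Z)"
    and l': "\<forall>z\<in>Z. l z \<in> {0..\<Lambda>} \<and> C (l z) z \<le> \<epsilon> ^ q \<and> l z * C (l z) z = l z * \<epsilon> ^ q"
    by (elim bexE)
  have l: "l z \<in> {0..\<Lambda>}" "C (l z) z \<le> \<epsilon> ^ q" "l z * C (l z) z = l z * \<epsilon> ^ q" if "z \<in> Z" for z
    using bspec[OF l' that] by (blast+)
  have "\<exists>P. P \<in> wasserstein_ball K q \<epsilon> (\<mu> z) \<and>
      (\<forall>f. continuous_on K f \<longrightarrow> (\<integral>y. f y \<partial>P) = (\<integral>x. (\<Sum>y\<in>N. w (l z, z) x y * f y) \<partial>\<mu> z))"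
    if z: "z \<in> Z" for z
  proof -
    obtain P \<gamma> where P: "P \<in> \<P> K" "\<gamma> \<in> couplings P (\<mu> z)"
      "\<And>f. continuous_on K f \<Longrightarrow> (\<integral>y. f y \<partial>P) = (\<integral>x. (\<Sum>y\<in>N. w (l z, z) x y * f y) \<partial>\<mu> z)"
      "\<And>f. continuous_on (K \<times> K) f \<Longrightarrow> (\<integral>s. f s \<partial>\<gamma>) = (\<integral>x. (\<Sum>y\<in>N. w (l z, z) x y * f (y, x)) \<partial>\<mu> z)"
      by (rule finite_kernel_coupling[OF K(1) \<mu>[OF z] N, of "w (l z, z)"])
        (use w_nonneg w_sum w_cont1 l(1)[OF z] z in auto)
    have "(\<integral>s. norm (fst s - snd s) ^ q \<partial>\<gamma>) = C (l z) z"
      unfolding C_def by (subst P(4)[OF continuous_on_cost]) simp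
    then have "P \<in> wasserstein_ball K q \<epsilon> (\<mu> z)"
      using l(2)[OF z] q \<epsilon> by (intro wasserstein_ballI[OF P(1,2)]) auto
    with P(3) show ?thesis by blast
  qed
  then have "\<forall>z\<in>Z. \<exists>P. P \<in> wasserstein_ball K q \<epsilon> (\<mu> z) \<and>
      (\<forall>f. continuous_on K f \<longrightarrow> (\<integral>y. f y \<partial>P) = (\<integral>x. (\<Sum>y\<in>N. w (l z, z) x y * f y) \<partial>\<mu> z))"
    by (rule ballI)
  from bchoice[OF this] obtain P where P': "\<forall>z\<in>Z. P z \<in> wasserstein_ball K q \<epsilon> (\<mu> z) \<and>
      (\<forall>f. continuous_on K f \<longrightarrow> (\<integral>y. f y \<partial>P z) = (\<integral>x. (\<Sum>y\<in>N. w (l z, z) x y * f y) \<partial>\<mu> z))"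
    by (elim exE)
  have P: "P z \<in> wasserstein_ball K q \<epsilon> (\<mu> z)"
    "continuous_on K f \<Longrightarrow> (\<integral>y. f y \<partial>P z) = (\<integral>x. (\<Sum>y\<in>N. w (l z, z) x y * f y) \<partial>\<mu> z)" if "z \<in> Z" for z f
    using bspec[OF P' that] by (blast+)
  show thesis
  proof (rule that[OF _ P(1)])
    show "P \<in> restrict_space borel Z \<rightarrow>\<^sub>M prob_algebra (restrict_space borel K)"
    proof (rule prob_measures_kernelI[OF compact_imp_closed[OF K(1)]])
      show "P z \<in> \<P> K" if "z \<in> space (restrict_space borel Z)" for z
        using P(1) that by (auto simp: wasserstein_ball_def space_restrict_space)
      fix f :: "'a \<Rightarrow> real" assume f: "continuous_on K f"
      have "continuous_on (K \<times> K) (\<lambda>s. f (fst s))"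
        by (auto intro!: continuous_on_compose2[OF f] continuous_intros)
      from avg_cont[OF this]
      have m1: "(\<lambda>p. \<integral>x. (\<Sum>y\<in>N. w p x y * f y) \<partial>\<mu> (snd p)) \<in> borel_measurable (restrict_space borel ({0..\<Lambda>} \<times> Z))"
        by (simp add: borel_measurable_continuous_on_restrict)
      have m2: "(\<lambda>z. (l z, z)) \<in> restrict_space borel Z \<rightarrow>\<^sub>M restrict_space borel ({0..\<Lambda>} \<times> Z)"
      proof (rule measurable_restrict_space2)
        show "(\<lambda>z. (l z, z)) \<in> space (restrict_space borel Z) \<rightarrow> {0..\<Lambda>} \<times> Z"
          using l(1) by (auto simp: space_restrict_space)
        have "(\<lambda>z. z) \<in> restrict_space borel Z \<rightarrow>\<^sub>M borel" by (simp add: measurable_restrict_space1)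
        from measurable_Pair[OF lm this] show "(\<lambda>z. (l z, z)) \<in> borel_measurable (restrict_space borel Z)"
          by (simp add: borel_prod)
      qed
      show "(\<lambda>z. \<integral>y. f y \<partial>P z) \<in> borel_measurable (restrict_space borel Z)"
        using measurable_compose[OF m2 m1] P(2)[OF _ f]
        by (subst measurable_cong) (auto simp: space_restrict_space)
    qed
    fix z assume z: "z \<in> Z"
    have k: "l z \<ge> 0" using l(1)[OF z] by simp
    have "(\<integral>y. F z y \<partial>P z) = H (l z) z"
      unfolding H_def using P(2)[OF z continuous_on_F1[OF z]] by simp
    \<comment> \<open>Complementary slackness exchanges the penalty \<open>l z * C (l z) z\<close>
      for \<open>\<epsilon> ^ q * l z\<close>, so the primal value can be compared with the dual
      objective at \<open>l z\<close>.\<close>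
    also have "\<dots> = (H (l z) z + l z * C (l z) z) - \<epsilon> ^ q * l z" using l(3)[OF z] by (simp add: mult.commute)
    also have "H (l z) z + l z * C (l z) z \<le> (\<integral>x. dual_integrand (l z) z x + \<delta> / 2 \<partial>\<mu> z) + \<eta>"
    proof (rule HC_le[OF l(1)[OF z] z])
      show "continuous_on K (\<lambda>x. dual_integrand (l z) z x + \<delta> / 2)"
        by (intro continuous_intros continuous_on_dual_integrand1 z k)
      fix x assume x: "x \<in> K"
      have "compact ((\<lambda>y. F z y + l z * norm (x - y) ^ q) ` K)"
        by (intro compact_continuous_image K continuous_intros continuous_on_F1 z)
      then have "dual_integrand (l z) z x \<in> (\<lambda>y. F z y + l z * norm (x - y) ^ q) ` K"
        unfolding dual_integrand_def using K(2)
        by (intro closed_contains_Inf bounded_imp_bdd_below compact_imp_bounded compact_imp_closed) auto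
      then obtain y where y: "y \<in> K" "dual_integrand (l z) z x = F z y + l z * norm (y - x) ^ q"
        by (auto simp: norm_minus_commute)
      have "\<exists>y'\<in>N1. F z y' + l z * norm (y' - x) ^ q \<le> F z y + l z * norm (y - x) ^ q + \<delta> / 2"
        using N1(3)[of "((l z, z), x)" y] l(1)[OF z] z x y(1) by simp
      then show "\<exists>y\<in>N. F z y + l z * norm (y - x) ^ q \<le> dual_integrand (l z) z x + \<delta> / 2"
        unfolding y(2) N_def by blast
    qed
    also have "(\<integral>x. dual_integrand (l z) z x + \<delta> / 2 \<partial>\<mu> z) = (\<integral>x. dual_integrand (l z) z x \<partial>\<mu> z) + \<delta> / 2"
      using integrable_prob_measures[OF K(1) \<mu>[OF z] continuous_on_dual_integrand1[OF z k]] prob_measuresD(3)[OF \<mu>[OF z]]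
      by (simp add: prob_space.prob_space prob_space_def finite_measure.integrable_const)
    also have "(\<integral>x. dual_integrand (l z) z x \<partial>\<mu> z) + \<delta> / 2 + \<eta> - \<epsilon> ^ q * l z \<le> dual_objective (l z) z + \<delta>"
      using \<eta>(3) by (simp add: dual_objective_def)
    also have "dual_objective (l z) z \<le> dual z" by (rule dual_objective_le_dual[OF z k])
    finally show "(\<integral>y. F z y \<partial>P z) \<le> dual z + \<delta>" by simp
  qed
qed

end

text \<open>The kernel construction for a constant family over the single parameter 0 produces
  feasible measures within any \<delta> of the dual value. This proves nonemptiness and closes the
  gap left by weak duality.\<close>

lemma transport_duality:
  fixes K :: "'a::euclidean_space set"
  assumes K: "compact K" "K \<noteq> {}" and \<mu>: "\<mu> \<in> \<P> K" and q: "q \<ge> 1" and \<epsilon>: "\<epsilon> > 0" and F: "continuous_on K F"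
  shows "wasserstein_ball K q \<epsilon> \<mu> \<noteq> {}"
    "transport_dual K q \<epsilon> \<mu> F = (INF P\<in>wasserstein_ball K q \<epsilon> \<mu>. \<integral>y. F y \<partial>P)"
proof -
  note weak = transport_weak_duality[OF K \<mu> q F]
  interpret transport_family K "{0 :: real}" q \<epsilon> "\<lambda>_. \<mu>" "\<lambda>_. F"
    by unfold_locales
      (use assms in \<open>auto simp: weakly_continuous_on_def case_prod_beta' intro!: continuous_on_compose2[OF F] continuous_intros\<close>)
  have near: "\<exists>P\<in>wasserstein_ball K q \<epsilon> \<mu>. (\<integral>y. F y \<partial>P) \<le> transport_dual K q \<epsilon> \<mu> F + \<delta>" if \<delta>: "\<delta> > 0" for \<delta>
    using near_optimal_kernel[OF \<delta>] by (metis insertI1)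
  then show ne: "wasserstein_ball K q \<epsilon> \<mu> \<noteq> {}" using zero_less_one by blast
  show "transport_dual K q \<epsilon> \<mu> F = (INF P\<in>wasserstein_ball K q \<epsilon> \<mu>. \<integral>y. F y \<partial>P)"
  proof (rule antisym)
    show "transport_dual K q \<epsilon> \<mu> F \<le> (INF P\<in>wasserstein_ball K q \<epsilon> \<mu>. \<integral>y. F y \<partial>P)"
      by (intro cINF_greatest ne weak)
    show "(INF P\<in>wasserstein_ball K q \<epsilon> \<mu>. \<integral>y. F y \<partial>P) \<le> transport_dual K q \<epsilon> \<mu> F"
    proof (rule field_le_epsilon)
      fix \<delta> :: real assume "\<delta> > 0"
      then obtain P where P: "P \<in> wasserstein_ball K q \<epsilon> \<mu>" "(\<integral>y. F y \<partial>P) \<le> transport_dual K q \<epsilon> \<mu> F + \<delta>"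
        using near by blast
      show "(INF P\<in>wasserstein_ball K q \<epsilon> \<mu>. \<integral>y. F y \<partial>P) \<le> transport_dual K q \<epsilon> \<mu> F + \<delta>"
        using weak
        by (intro cINF_lower2[of _ _ P] P bdd_belowI[of _ "transport_dual K q \<epsilon> \<mu> F"]) auto
    qed
  qed
qed

section \<open>Directional differentiability of infima\<close>

text \<open>The domain has no topology; the values of f form a sequentially compact set of reals,
  which is enough for a minimum.\<close>

lemma attains_min_sequentially:
  fixes f :: "'b \<Rightarrow> real"
  assumes "A \<noteq> {}" and seq: "\<And>P :: nat \<Rightarrow> 'b. (\<And>n. P n \<in> A) \<Longrightarrow>
    \<exists>r Q. strict_mono r \<and> Q \<in> A \<and> (\<lambda>n. f (P (r n))) \<longlonglongrightarrow> f Q"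
  shows "\<exists>Q\<in>A. \<forall>P\<in>A. f Q \<le> f P"
proof -
  have "seq_compact (f ` A)"
  proof (rule seq_compactI)
    fix u :: "nat \<Rightarrow> real" assume "\<forall>n. u n \<in> f ` A"
    then have "\<forall>n. \<exists>P. P \<in> A \<and> u n = f P" by blast
    then obtain P where P: "\<And>n. P n \<in> A" "\<And>n. u n = f (P n)" by metis
    have "\<exists>r Q. strict_mono r \<and> Q \<in> A \<and> (\<lambda>n. f (P (r n))) \<longlonglongrightarrow> f Q"
      by (rule seq) (rule P(1))
    then obtain r :: "nat \<Rightarrow> nat" and Q where "strict_mono r" "Q \<in> A" "(\<lambda>n. f (P (r n))) \<longlonglongrightarrow> f Q"
      by (elim exE conjE)
    then show "\<exists>l\<in>f ` A. \<exists>r. strict_mono r \<and> (u \<circ> r) \<longlonglongrightarrow> l"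
      by (intro bexI[of _ "f Q"] exI[of _ r]) (auto simp: comp_def P(2))
  qed
  then have "compact (f ` A)" by (simp add: compact_eq_seq_compact_metric)
  then obtain v where "v \<in> f ` A" "\<And>u. u \<in> f ` A \<Longrightarrow> v \<le> u"
    using compact_attains_inf[of "f ` A"] \<open>A \<noteq> {}\<close> by auto
  then show ?thesis by blast
qed

text \<open>Testing with a Q that minimizes L among the minimizers of J0 bounds the quotient from
  above. If the lower bound failed for arbitrarily small h, the corresponding nearly optimal points
  would accumulate at some R; letting h tend to 0 shows that R minimizes J0, yet L R would lie below
  L Q by a fixed amount.\<close>

theorem danskin_right:
  fixes B :: "'b set" and J :: "real \<Rightarrow> 'b \<Rightarrow> real" and J0 L :: "'b \<Rightarrow> real"
  assumes ne: "B \<noteq> {}"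
    and seq: "\<And>P :: nat \<Rightarrow> 'b. (\<And>n. P n \<in> B) \<Longrightarrow>
      \<exists>r Q. strict_mono r \<and> Q \<in> B \<and> (\<lambda>n. J0 (P (r n))) \<longlonglongrightarrow> J0 Q \<and> (\<lambda>n. L (P (r n))) \<longlonglongrightarrow> L Q"
    and bdd: "\<forall>\<^sub>F h in at_right 0. bdd_below (J h ` B)"
    and unif: "uniform_limit B (\<lambda>h P. (J h P - J0 P) / h) L (at_right 0)"
  obtains Q where "is_arg_min L (\<lambda>P. is_arg_min J0 (\<lambda>P. P \<in> B) P) Q"
    "((\<lambda>h. ((INF P\<in>B. J h P) - (INF P\<in>B. J0 P)) / h) \<longlongrightarrow> L Q) (at_right 0)"
proof -
  obtain P0 where P0: "P0 \<in> B" "\<And>P. P \<in> B \<Longrightarrow> J0 P0 \<le> J0 P"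
    using attains_min_sequentially[OF ne, of J0] seq by blast
  define m where "m = J0 P0"
  define A where "A = {P \<in> B. J0 P \<le> m}"
  have argmin: "is_arg_min J0 (\<lambda>P. P \<in> B) P \<longleftrightarrow> P \<in> A" for P
    unfolding is_arg_min_linorder A_def m_def using P0 by (auto intro: order_trans)
  have "A \<noteq> {}" using P0(1) by (auto simp: A_def m_def)
  have "\<exists>Q\<in>A. \<forall>P\<in>A. L Q \<le> L P"
  proof (rule attains_min_sequentially[OF \<open>A \<noteq> {}\<close>, of L])
    fix P :: "nat \<Rightarrow> 'b" assume P: "\<And>n. P n \<in> A"
    then obtain r R where r: "strict_mono r" "R \<in> B" "(\<lambda>n. J0 (P (r n))) \<longlonglongrightarrow> J0 R" "(\<lambda>n. L (P (r n))) \<longlonglongrightarrow> L R"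
      using seq[of P] by (auto simp: A_def)
    have "J0 R \<le> m" using P by (intro LIMSEQ_le_const2[OF r(3)]) (auto simp: A_def)
    with r show "\<exists>r R. strict_mono r \<and> R \<in> A \<and> (\<lambda>n. L (P (r n))) \<longlonglongrightarrow> L R" by (auto simp: A_def)
  qed
  then obtain Q where Q: "Q \<in> A" "\<And>P. P \<in> A \<Longrightarrow> L Q \<le> L P" by blast
  have QB: "Q \<in> B" "J0 Q = m" using Q(1) P0(2)[of Q] by (auto simp: A_def m_def)
  have m: "(INF P\<in>B. J0 P) = m"
  proof (rule antisym)
    show "(INF P\<in>B. J0 P) \<le> m"
      unfolding m_def using P0 by (intro cINF_lower bdd_belowI[of _ "J0 P0"]) auto
    show "m \<le> (INF P\<in>B. J0 P)"
      unfolding m_def using P0(2) by (intro cINF_greatest ne)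
  qed
  define I where "I h = (INF P\<in>B. J h P)" for h
  \<comment> \<open>Uniform convergence of the quotients, multiplied by h > 0: a first-order
    expansion of J h with error \<open>h * e\<close> for all P at once.\<close>
  have close: "\<forall>\<^sub>F h in at_right 0. bdd_below (J h ` B) \<and> h > 0 \<and> (\<forall>P\<in>B. \<bar>J h P - (J0 P + h * L P)\<bar> \<le> h * e)" if "e > 0" for e
    using bdd uniform_limitD[OF unif that] eventually_at_right_less[of 0]
  proof eventually_elim
    case (elim h)
    show ?case
    proof (intro conjI ballI)
      fix P assume "P \<in> B"
      then have "\<bar>(J h P - J0 P) / h - L P\<bar> < e" using elim(2) by (simp add: dist_real_def)
      then have "h * \<bar>(J h P - J0 P) / h - L P\<bar> \<le> h * e" using elim(3) by (intro mult_left_mono) auto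
      also have "h * \<bar>(J h P - J0 P) / h - L P\<bar> = \<bar>h * ((J h P - J0 P) / h - L P)\<bar>"
        using elim(3) by (simp add: abs_mult)
      also have "h * ((J h P - J0 P) / h - L P) = J h P - (J0 P + h * L P)"
        using elim(3) by (simp add: field_simps)
      finally show "\<bar>J h P - (J0 P + h * L P)\<bar> \<le> h * e" .
    qed (use elim in auto)
  qed
  have upper: "\<forall>\<^sub>F h in at_right 0. I h \<le> m + h * (L Q + e)" if "e > 0" for e
    using close[OF that]
  proof eventually_elim
    case (elim h)
    have "I h \<le> J h Q" unfolding I_def using elim QB by (intro cINF_lower) auto
    also have "J h Q \<le> m + h * (L Q + e)" using elim QB by (auto simp: algebra_simps abs_le_iff)
    finally show ?case .
  qed
  have lower: "\<forall>\<^sub>F h in at_right 0. I h \<ge> m + h * (L Q - e)" if "e > 0" for e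
  proof (rule sequentially_imp_eventually_at_right[OF zero_less_one])
    fix h :: "nat \<Rightarrow> real" assume h: "\<And>n. 0 < h n" "h \<longlonglongrightarrow> 0"
    have h': "filterlim h (at_right 0) sequentially"
      using h less_imp_neq[OF h(1)] by (auto simp: filterlim_at intro!: always_eventually)
    show "\<forall>\<^sub>F n in sequentially. I (h n) \<ge> m + h n * (L Q - e)"
    proof (rule ccontr)
      assume "\<not> ?thesis"
      then have "\<exists>\<^sub>F n in sequentially. I (h n) < m + h n * (L Q - e)"
        by (simp add: not_eventually not_le)
      moreover have "\<forall>\<^sub>F n in sequentially. bdd_below (J (h n) ` B) \<and> (\<forall>P\<in>B. \<bar>J (h n) P - (J0 P + h n * L P)\<bar> \<le> h n * (e / 2))"
        using eventually_compose_filterlim[OF close[of "e / 2"] h'] that by (auto elim: eventually_mono)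
      ultimately have fr: "\<exists>\<^sub>F n in sequentially. \<exists>P\<in>B. J0 P + h n * L P < m + h n * (L Q - e / 2)"
      proof (rule frequently_rev_mp[OF _ eventually_mono], intro impI)
        fix n assume n: "bdd_below (J (h n) ` B) \<and> (\<forall>P\<in>B. \<bar>J (h n) P - (J0 P + h n * L P)\<bar> \<le> h n * (e / 2))"
          and "I (h n) < m + h n * (L Q - e)"
        then obtain P where P: "P \<in> B" "J (h n) P < m + h n * (L Q - e)"
          unfolding I_def using cINF_less_iff[OF ne] by blast
        have "J0 P + h n * L P \<le> J (h n) P + h n * (e / 2)"
          using bspec[OF conjunct2[OF n] P(1)] by linarith
        with P(2) have "J0 P + h n * L P < m + h n * (L Q - e / 2)" by (simp add: algebra_simps)
        with P(1) show "\<exists>P\<in>B. J0 P + h n * L P < m + h n * (L Q - e / 2)" by blast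
      qed
      \<comment> \<open>The violation is known for infinitely many n, not for all, so the bad
        indices are enumerated to obtain a subsequence.\<close>
      define S where "S = {n. \<exists>P\<in>B. J0 P + h n * L P < m + h n * (L Q - e / 2)}"
      have "infinite S"
        unfolding S_def using fr by (simp add: cofinite_eq_sequentially[symmetric] frequently_cofinite)
      define s where "s = enumerate S"
      have s: "strict_mono s"
        unfolding s_def by (rule strict_mono_enumerate[OF \<open>infinite S\<close>])
      have "s n \<in> S" for n unfolding s_def by (rule enumerate_in_set[OF \<open>infinite S\<close>])
      then have "\<forall>n. \<exists>P\<in>B. J0 P + h (s n) * L P < m + h (s n) * (L Q - e / 2)"
        by (simp add: S_def)
      then obtain P where P: "\<And>n. P n \<in> B" "\<And>n. J0 (P n) + h (s n) * L (P n) < m + h (s n) * (L Q - e / 2)"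
        by metis
      obtain r R where r: "strict_mono r" "R \<in> B" "(\<lambda>n. J0 (P (r n))) \<longlonglongrightarrow> J0 R" "(\<lambda>n. L (P (r n))) \<longlonglongrightarrow> L R"
        using seq[of P] P(1) by blast
      have hs: "(\<lambda>n. h (s (r n))) \<longlonglongrightarrow> 0"
        using LIMSEQ_subseq_LIMSEQ[OF LIMSEQ_subseq_LIMSEQ[OF h(2) s] r(1)] by (simp add: comp_def)
      have "J0 R + 0 * L R \<le> m + 0 * (L Q - e / 2)"
      proof (rule LIMSEQ_le)
        show "(\<lambda>n. J0 (P (r n)) + h (s (r n)) * L (P (r n))) \<longlonglongrightarrow> J0 R + 0 * L R"
          by (intro tendsto_intros r hs)
        show "(\<lambda>n. m + h (s (r n)) * (L Q - e / 2)) \<longlonglongrightarrow> m + 0 * (L Q - e / 2)"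
          by (intro tendsto_intros hs)
      qed (use P(2) less_imp_le in blast)
      then have "R \<in> A" using r(2) by (simp add: A_def)
      \<comment> \<open>Since \<open>J0 (P (r n)) \<ge> m\<close>, the J0 terms drop out and the
        factor h > 0 can be cancelled.\<close>
      have "L (P (r n)) \<le> L Q - e / 2" for n
      proof -
        have "h (s (r n)) * L (P (r n)) < h (s (r n)) * (L Q - e / 2)"
          using P(2)[of "r n"] P0(2)[OF P(1), of "r n"] by (simp add: m_def)
        then show ?thesis using h(1)[of "s (r n)"] by simp
      qed
      then have "L R \<le> L Q - e / 2" by (intro LIMSEQ_le_const2[OF r(4)]) auto
      with Q(2)[OF \<open>R \<in> A\<close>] that show False by simp
    qed
  qed
  show thesis
  proof (rule that[of Q])
    show "is_arg_min L (\<lambda>P. is_arg_min J0 (\<lambda>P. P \<in> B) P) Q"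
      unfolding argmin using Q by (simp add: is_arg_min_linorder)
    show "((\<lambda>h. ((INF P\<in>B. J h P) - (INF P\<in>B. J0 P)) / h) \<longlongrightarrow> L Q) (at_right 0)"
    proof (rule tendstoI)
      fix e :: real assume "e > 0"
      then have e: "e / 2 > 0" by simp
      show "\<forall>\<^sub>F h in at_right 0. dist (((INF P\<in>B. J h P) - (INF P\<in>B. J0 P)) / h) (L Q) < e"
        using upper[OF e] lower[OF e] eventually_at_right_less[of 0]
      proof eventually_elim
        case (elim h)
        have "(I h - m) / h \<le> L Q + e / 2" using elim by (simp add: field_simps)
        moreover have "(I h - m) / h \<ge> L Q - e / 2" using elim by (simp add: field_simps)
        ultimately show ?case using \<open>e > 0\<close> unfolding m I_def[symmetric] by (simp add: dist_real_def abs_less_iff)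
      qed
    qed
  qed
qed

section \<open>Continuity of the robust value\<close>

lemma ambiguity_set_eq_ball:
  "ambiguity_set M t x a = wasserstein_ball (states M) (expo M) (radius M) (nominal M t x a)"
  by (simp add: ambiguity_set_def wasserstein_ball_def)

lemma robust_action_value_eq_dual:
  "robust_action_value M t \<theta> x a = transport_dual (states M) (expo M) (radius M) (nominal M t x a)
     (\<lambda>y. run_reward M t x a y + robust_value M (Suc t) \<theta> y)"
  by (simp add: robust_action_value_def transport_dual_def)

text \<open>Stated for one parameter at a time, to be instantiated at \<theta> and at nearby
  \<theta> + h r: duality for the perturbed problems requires their values to be continuous
  too.\<close>

locale continuous_robust_mdp =
  fixes M :: "('d::finite, 'm::finite, 'p::finite) robust_mdp" and \<theta> :: "real ^ 'p"
  assumes wf: "wf_robust_mdp M"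
    and run_cont: "\<And>s. s < horizon M \<Longrightarrow>
      continuous_on (states M \<times> actions M \<times> states M) (\<lambda>(x, a, y). run_reward M s x a y)"
    and term_cont: "continuous_on (states M) (term_reward M)"
    and nominal_cont: "\<And>s. s < horizon M \<Longrightarrow>
      weakly_continuous_on (states M \<times> actions M) (states M) (\<lambda>(x, a). nominal M s x a)"
    and policy_cont: "\<And>s. s < horizon M \<Longrightarrow>
      weakly_continuous_on (params M \<times> states M) (actions M) (\<lambda>(\<theta>, x). policy M s \<theta> x)"
    and \<theta>: "\<theta> \<in> params M"
begin

lemma compact_states: "compact (states M)" "states M \<noteq> {}"
  and compact_actions: "compact (actions M)"
  and expo_radius: "expo M \<ge> 1" "radius M > 0"
  using wf by (auto simp: wf_robust_mdp_def)

lemma run_cont_comp: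
  assumes "s < horizon M" "continuous_on S f" "continuous_on S g" "continuous_on S h"
    "f ` S \<subseteq> states M" "g ` S \<subseteq> actions M" "h ` S \<subseteq> states M"
  shows "continuous_on S (\<lambda>z. run_reward M s (f z) (g z) (h z))"
  by (rule continuous_on_compose2[OF run_cont[OF assms(1)], of S "\<lambda>z. (f z, g z, h z)", simplified])
    (use assms in \<open>auto intro!: continuous_intros\<close>)

lemma nominal_prob:
  assumes "s < horizon M" "x \<in> states M" "a \<in> actions M"
  shows "nominal M s x a \<in> \<P> (states M)"
proof -
  have "(\<lambda>(x, a). nominal M s x a) \<in> state_space M \<Otimes>\<^sub>M action_space M \<rightarrow>\<^sub>M prob_algebra (state_space M)"
    using wf assms(1) by (simp add: wf_robust_mdp_def)
  from measurable_space[OF this, of "(x, a)"] show ?thesis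
    using assms by (simp add: space_pair_measure space_restrict_space)
qed

lemma policy_prob:
  assumes "s < horizon M" "x \<in> states M"
  shows "policy M s \<theta> x \<in> \<P> (actions M)"
proof -
  have "sets (ref_measure M) = sets (action_space M)" "prob_space (policy M s \<theta> x)"
    using wf assms \<theta> by (auto simp: wf_robust_mdp_def)
  then show ?thesis by (simp add: space_prob_algebra policy_def)
qed

lemma policy_weakly_continuous:
  assumes "s < horizon M"
  shows "weakly_continuous_on (states M) (actions M) (policy M s \<theta>)"
  unfolding weakly_continuous_on_def
proof (intro allI impI)
  fix f :: "real ^ 'm \<Rightarrow> real" assume "continuous_on (actions M) f \<and> bounded (f ` actions M)"
  then have "continuous_on (params M \<times> states M) (\<lambda>(\<theta>, x). \<integral>a. f a \<partial>policy M s \<theta> x)"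
    using policy_cont[OF assms] unfolding weakly_continuous_on_def by (auto simp: case_prod_beta')
  then show "continuous_on (states M) (\<lambda>x. \<integral>a. f a \<partial>policy M s \<theta> x)"
    using \<theta> by (rule continuous_on_slice)
qed

lemma policy_measurable:
  assumes "s < horizon M"
  shows "policy M s \<theta> \<in> state_space M \<rightarrow>\<^sub>M prob_algebra (action_space M)"
proof (rule prob_measures_kernelI[OF compact_imp_closed[OF compact_actions]])
  show "policy M s \<theta> x \<in> \<P> (actions M)" if "x \<in> space (state_space M)" for x
    using that policy_prob[OF assms] by (simp add: space_restrict_space)
  fix f :: "real ^ 'm \<Rightarrow> real" assume "continuous_on (actions M) f"
  then show "(\<lambda>x. \<integral>a. f a \<partial>policy M s \<theta> x) \<in> borel_measurable (state_space M)"
    by (intro borel_measurable_continuous_on_restrict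
        weakly_continuous_onD[OF policy_weakly_continuous[OF assms] compact_actions])
qed

definition stage_dual :: "nat \<Rightarrow> (real ^ 'd \<Rightarrow> real) \<Rightarrow> real ^ 'd \<Rightarrow> real ^ 'm \<Rightarrow> real" where
  "stage_dual s W x a = transport_dual (states M) (expo M) (radius M) (nominal M s x a)
     (\<lambda>y. run_reward M s x a y + W y)"

text \<open>With the pair (x, a) as parameter, the near-optimal kernel is an adversary kernel for
  stage s, and continuity of the dual is joint continuity of the one-stage value.\<close>

lemma stage_family:
  assumes s: "s < horizon M" and W: "continuous_on (states M) W"
  shows "transport_family (states M) (states M \<times> actions M) (expo M) (radius M)
    (\<lambda>(x, a). nominal M s x a) (\<lambda>(x, a) y. run_reward M s x a y + W y)"
proof
  show "continuous_on ((states M \<times> actions M) \<times> states M)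
      (\<lambda>(z, y). (case z of (x, a) \<Rightarrow> \<lambda>y. run_reward M s x a y + W y) y)"
    unfolding case_prod_beta'
    by (auto intro!: continuous_intros run_cont_comp[OF s] continuous_on_compose2[OF W])
qed (use s compact_states compact_actions expo_radius nominal_cont nominal_prob in \<open>auto intro: compact_Times\<close>)

lemma continuous_on_stage_dual:
  assumes "s < horizon M" "continuous_on (states M) W"
  shows "continuous_on (states M \<times> actions M) (\<lambda>(x, a). stage_dual s W x a)"
  using transport_family.continuous_on_dual[OF stage_family[OF assms]]
  by (simp add: stage_dual_def case_prod_beta')

lemma stage_dual_le:
  assumes "s < horizon M" "continuous_on (states M) W" "x \<in> states M" "a \<in> actions M"
    "P \<in> ambiguity_set M s x a"
  shows "stage_dual s W x a \<le> (\<integral>y. run_reward M s x a y + W y \<partial>P)"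
  unfolding stage_dual_def
  by (rule transport_weak_duality[OF compact_states nominal_prob expo_radius(1)])
    (use assms in \<open>auto simp: ambiguity_set_eq_ball intro!: continuous_intros run_cont_comp\<close>)

lemma stage_near_optimal:
  assumes s: "s < horizon M" and W: "continuous_on (states M) W" and \<delta>: "\<delta> > 0"
  shows "\<exists>P. (\<lambda>(x, a). P x a) \<in> state_space M \<Otimes>\<^sub>M action_space M \<rightarrow>\<^sub>M prob_algebra (state_space M) \<and>
    (\<forall>x\<in>states M. \<forall>a\<in>actions M. P x a \<in> ambiguity_set M s x a \<and>
      (\<integral>y. run_reward M s x a y + W y \<partial>P x a) \<le> stage_dual s W x a + \<delta>)"
proof -
  obtain P where P: "P \<in> restrict_space borel (states M \<times> actions M) \<rightarrow>\<^sub>M prob_algebra (state_space M)"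
    "\<And>z. z \<in> states M \<times> actions M \<Longrightarrow> P z \<in> wasserstein_ball (states M) (expo M) (radius M) (case z of (x, a) \<Rightarrow> nominal M s x a)"
    "\<And>z. z \<in> states M \<times> actions M \<Longrightarrow> (\<integral>y. (case z of (x, a) \<Rightarrow> \<lambda>y. run_reward M s x a y + W y) y \<partial>P z) \<le>
      transport_dual (states M) (expo M) (radius M) (case z of (x, a) \<Rightarrow> nominal M s x a) (case z of (x, a) \<Rightarrow> \<lambda>y. run_reward M s x a y + W y) + \<delta>"
    using transport_family.near_optimal_kernel[OF stage_family[OF s W] \<delta>] by blast
  have "P \<in> state_space M \<Otimes>\<^sub>M action_space M \<rightarrow>\<^sub>M prob_algebra (state_space M)"
    using P(1) by (subst measurable_cong_sets[OF sets_restrict_borel_Times refl])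
  then show ?thesis
    using P(2,3) by (intro exI[of _ "\<lambda>x a. P (x, a)"]) (auto simp: ambiguity_set_eq_ball stage_dual_def)
qed

text \<open>Indexed by the number of stages to go, which makes the backward recursion primitive;
  stage \<open>horizon M - Suc n\<close> is the one with \<open>Suc n\<close> stages left.\<close>

primrec value_iter :: "nat \<Rightarrow> real ^ 'd \<Rightarrow> real" where
  "value_iter 0 x = term_reward M x"
| "value_iter (Suc n) x =
     (\<integral>a. stage_dual (horizon M - Suc n) (value_iter n) x a \<partial>policy M (horizon M - Suc n) \<theta> x)"

lemma continuous_on_value_iter:
  assumes "n \<le> horizon M"
  shows "continuous_on (states M) (value_iter n)"
  using assms
proof (induction n)
  case 0
  then show ?case using term_cont by (simp cong: continuous_on_cong)
next
  case (Suc n)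
  then have s: "horizon M - Suc n < horizon M" by simp
  have "continuous_on (states M) (\<lambda>x. \<integral>a. stage_dual (horizon M - Suc n) (value_iter n) x a \<partial>policy M (horizon M - Suc n) \<theta> x)"
    by (rule continuous_on_integral_param[OF compact_states(1) compact_actions policy_weakly_continuous[OF s]])
      (use Suc s policy_prob continuous_on_stage_dual in auto)
  then show ?case by simp
qed

definition value_at :: "nat \<Rightarrow> real ^ 'd \<Rightarrow> real" where
  "value_at l = value_iter (horizon M - l)"

lemma value_at_horizon: "value_at (horizon M) = term_reward M"
  by (auto simp: value_at_def)

lemma value_at_step:
  assumes "l < horizon M"
  shows "value_at l x = (\<integral>a. stage_dual l (value_at (Suc l)) x a \<partial>policy M l \<theta> x)"
proof -
  obtain n where n: "horizon M - l = Suc n" using assms by (cases "horizon M - l") auto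
  then have "horizon M - Suc l = n" "horizon M - Suc n = l" using assms by auto
  with n show ?thesis by (simp add: value_at_def)
qed

lemma continuous_on_value_at: "continuous_on (states M) (value_at l)"
  unfolding value_at_def by (rule continuous_on_value_iter) simp

section \<open>Path spaces: measurability and boundedness of path functionals\<close>

lemma state_component_measurable:
  assumes "l \<in> {s..s + n}"
  shows "(\<lambda>\<omega>. fst \<omega> l) \<in> path_space M s n \<rightarrow>\<^sub>M state_space M"
  unfolding path_space_def
  by (rule measurable_compose[OF measurable_fst measurable_component_singleton[OF assms]])

lemma action_component_measurable:
  assumes "l \<in> {s..<s + n}"
  shows "(\<lambda>\<omega>. snd \<omega> l) \<in> path_space M s n \<rightarrow>\<^sub>M action_space M"
  unfolding path_space_def
  by (rule measurable_compose[OF measurable_snd measurable_component_singleton[OF assms]])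

lemma state_component_mem: "\<omega> \<in> space (path_space M s n) \<Longrightarrow> l \<in> {s..s + n} \<Longrightarrow> fst \<omega> l \<in> states M"
  using measurable_space[OF state_component_measurable[of l s n], of \<omega>] by (simp add: space_restrict_space)

lemma action_component_mem: "\<omega> \<in> space (path_space M s n) \<Longrightarrow> l \<in> {s..<s + n} \<Longrightarrow> snd \<omega> l \<in> actions M"
  using measurable_space[OF action_component_measurable[of l s n], of \<omega>] by (simp add: space_restrict_space)

text \<open>Interpolates between the value iterate at the initial state, for n = 0, and the total
  reward of a full path, so that the two can be compared stage by stage.\<close>

definition path_total :: "nat \<Rightarrow> nat \<Rightarrow> (nat \<Rightarrow> real ^ 'd) \<times> (nat \<Rightarrow> real ^ 'm) \<Rightarrow> real" where
  "path_total s n \<omega> = (\<Sum>l=s..<s + n. run_reward M l (fst \<omega> l) (snd \<omega> l) (fst \<omega> (Suc l))) + value_at (s + n) (fst \<omega> (s + n))"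

lemma run_reward_measurable:
  assumes "l < horizon M" "f \<in> N \<rightarrow>\<^sub>M state_space M" "g \<in> N \<rightarrow>\<^sub>M action_space M" "h \<in> N \<rightarrow>\<^sub>M state_space M"
  shows "(\<lambda>\<omega>. run_reward M l (f \<omega>) (g \<omega>) (h \<omega>)) \<in> borel_measurable N"
proof -
  have "sets (state_space M \<Otimes>\<^sub>M (action_space M \<Otimes>\<^sub>M state_space M)) = sets (restrict_space borel (states M \<times> actions M \<times> states M))"
    by (subst sets_pair_measure_cong[OF refl sets_restrict_borel_Times]) (rule sets_restrict_borel_Times)
  then have "(\<lambda>(x, a, y). run_reward M l x a y) \<in> borel_measurable (state_space M \<Otimes>\<^sub>M (action_space M \<Otimes>\<^sub>M state_space M))"
    using borel_measurable_continuous_on_restrict[OF run_cont[OF assms(1)]] by (simp cong: measurable_cong_sets)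
  from measurable_compose[OF measurable_Pair[OF assms(2) measurable_Pair[OF assms(3,4)]] this]
  show ?thesis by simp
qed

lemma value_at_measurable: "value_at l \<in> borel_measurable (state_space M)"
  by (rule borel_measurable_continuous_on_restrict[OF continuous_on_value_at])

lemma running_total_measurable:
  assumes "s + n \<le> horizon M"
  shows "(\<lambda>\<omega>. \<Sum>l=s..<s + n. run_reward M l (fst \<omega> l) (snd \<omega> l) (fst \<omega> (Suc l))) \<in> borel_measurable (path_space M s n)"
  using assms
  by (intro borel_measurable_sum run_reward_measurable state_component_measurable action_component_measurable) auto

lemma running_total_bounded:
  assumes "s + n \<le> horizon M"
  shows "\<exists>B. \<forall>\<omega>\<in>space (path_space M s n). \<bar>\<Sum>l=s..<s + n. run_reward M l (fst \<omega> l) (snd \<omega> l) (fst \<omega> (Suc l))\<bar> \<le> B"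
proof -
  have "\<forall>l\<in>{s..<s + n}. \<exists>b. \<forall>x\<in>states M. \<forall>a\<in>actions M. \<forall>y\<in>states M. \<bar>run_reward M l x a y\<bar> \<le> b"
  proof
    fix l assume "l \<in> {s..<s + n}"
    then have "l < horizon M" using assms by simp
    then obtain B where "\<And>z. z \<in> states M \<times> actions M \<times> states M \<Longrightarrow> \<bar>case z of (x, a, y) \<Rightarrow> run_reward M l x a y\<bar> \<le> B"
      using compact_real_bound[OF compact_Times[OF compact_states(1) compact_Times[OF compact_actions compact_states(1)]] run_cont]
      by blast
    then show "\<exists>b. \<forall>x\<in>states M. \<forall>a\<in>actions M. \<forall>y\<in>states M. \<bar>run_reward M l x a y\<bar> \<le> b"
      by (intro exI[of _ B]) force
  qed
  from bchoice[OF this] obtain b where b: "\<forall>l\<in>{s..<s + n}. \<forall>x\<in>states M. \<forall>a\<in>actions M. \<forall>y\<in>states M. \<bar>run_reward M l x a y\<bar> \<le> b l"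
    by (elim exE)
  show ?thesis
  proof (intro exI[of _ "\<Sum>l=s..<s + n. b l"] ballI)
    fix \<omega> assume \<omega>: "\<omega> \<in> space (path_space M s n)"
    show "\<bar>\<Sum>l=s..<s + n. run_reward M l (fst \<omega> l) (snd \<omega> l) (fst \<omega> (Suc l))\<bar> \<le> (\<Sum>l=s..<s + n. b l)"
      using b state_component_mem[OF \<omega>] action_component_mem[OF \<omega>]
      by (intro order_trans[OF sum_abs] sum_mono) auto
  qed
qed

lemma value_at_bounded: "\<exists>B. \<forall>x\<in>states M. \<bar>value_at l x\<bar> \<le> B"
  using compact_real_bound[OF compact_states(1) continuous_on_value_at[of l]] by metis

lemma path_total_measurable:
  assumes "s + n \<le> horizon M"
  shows "path_total s n \<in> borel_measurable (path_space M s n)"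
  unfolding path_total_def[abs_def]
  by (intro borel_measurable_add running_total_measurable assms measurable_compose[OF state_component_measurable value_at_measurable]) simp

lemma path_total_bounded:
  assumes "s + n \<le> horizon M"
  shows "\<exists>B. \<forall>\<omega>\<in>space (path_space M s n). \<bar>path_total s n \<omega>\<bar> \<le> B"
proof -
  obtain B1 where B1: "\<forall>\<omega>\<in>space (path_space M s n). \<bar>\<Sum>l=s..<s + n. run_reward M l (fst \<omega> l) (snd \<omega> l) (fst \<omega> (Suc l))\<bar> \<le> B1"
    using running_total_bounded[OF assms] by blast
  obtain B2 where B2: "\<forall>x\<in>states M. \<bar>value_at (s + n) x\<bar> \<le> B2"
    using value_at_bounded by blast
  have "\<bar>path_total s n \<omega>\<bar> \<le> B1 + B2" if \<omega>: "\<omega> \<in> space (path_space M s n)" for \<omega>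
    using bspec[OF B1 \<omega>] bspec[OF B2 state_component_mem[OF \<omega>, of "s + n"]]
    unfolding path_total_def by simp
  then show ?thesis by blast
qed

definition path_step ::
  "(nat \<Rightarrow> real ^ 'd \<Rightarrow> real ^ 'm \<Rightarrow> (real ^ 'd) measure) \<Rightarrow> nat \<Rightarrow> nat
     \<Rightarrow> (nat \<Rightarrow> real ^ 'd) \<times> (nat \<Rightarrow> real ^ 'm) \<Rightarrow> real ^ 'm \<Rightarrow> ((nat \<Rightarrow> real ^ 'd) \<times> (nat \<Rightarrow> real ^ 'm)) measure" where
  "path_step P s n \<omega> a = distr (P (s + n) (fst \<omega> (s + n)) a) (path_space M s (Suc n))
     (\<lambda>y. ((fst \<omega>)(Suc (s + n) := y), (snd \<omega>)(s + n := a)))"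

lemma path_law_Suc:
  "path_law M P \<theta> s x (Suc n) =
    path_law M P \<theta> s x n \<bind> (\<lambda>\<omega>. policy M (s + n) \<theta> (fst \<omega> (s + n)) \<bind> path_step P s n \<omega>)"
  by (simp add: path_step_def[abs_def] case_prod_beta')

lemma path_update_measurable:
  "(\<lambda>(z, y). ((fst (fst z))(Suc (s + n) := y), (snd (fst z))(s + n := snd z)))
     \<in> (path_space M s n \<Otimes>\<^sub>M action_space M) \<Otimes>\<^sub>M state_space M \<rightarrow>\<^sub>M path_space M s (Suc n)"
proof -
  have "(\<lambda>w. (fst (fst (fst w)))(Suc (s + n) := snd w)) \<in> (path_space M s n \<Otimes>\<^sub>M action_space M) \<Otimes>\<^sub>M state_space M
      \<rightarrow>\<^sub>M PiM {s..s + Suc n} (\<lambda>_. state_space M)"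
  proof (rule measurable_fun_upd)
    show "{s..s + Suc n} = {s..s + n} \<union> {Suc (s + n)}" by auto
    show "(\<lambda>w. fst (fst (fst w))) \<in> (path_space M s n \<Otimes>\<^sub>M action_space M) \<Otimes>\<^sub>M state_space M \<rightarrow>\<^sub>M PiM {s..s + n} (\<lambda>_. state_space M)"
      unfolding path_space_def by measurable
  qed measurable
  moreover have "(\<lambda>w. (snd (fst (fst w)))(s + n := snd (fst w))) \<in> (path_space M s n \<Otimes>\<^sub>M action_space M) \<Otimes>\<^sub>M state_space M
      \<rightarrow>\<^sub>M PiM {s..<s + Suc n} (\<lambda>_. action_space M)"
  proof (rule measurable_fun_upd)
    show "{s..<s + Suc n} = {s..<s + n} \<union> {s + n}" by auto
    show "(\<lambda>w. snd (fst (fst w))) \<in> (path_space M s n \<Otimes>\<^sub>M action_space M) \<Otimes>\<^sub>M state_space M \<rightarrow>\<^sub>M PiM {s..<s + n} (\<lambda>_. action_space M)"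
      unfolding path_space_def by measurable
  qed measurable
  ultimately show ?thesis
    unfolding path_space_def[of M s "Suc n"] case_prod_beta' by (rule measurable_Pair)
qed

section \<open>Path laws and expected totals under a fixed adversary\<close>

context
  fixes P s
  assumes P: "P \<in> adversary_kernels M s"
begin

lemma adversary_measurable:
  assumes "s \<le> l" "l < horizon M"
  shows "(\<lambda>(x, a). P l x a) \<in> state_space M \<Otimes>\<^sub>M action_space M \<rightarrow>\<^sub>M prob_algebra (state_space M)"
  using P assms by (auto simp: adversary_kernels_def)

lemma adversary_mem:
  assumes "s \<le> l" "l < horizon M" "x \<in> states M" "a \<in> actions M"
  shows "P l x a \<in> ambiguity_set M l x a" "P l x a \<in> \<P> (states M)"
  using P assms by (auto simp: adversary_kernels_def ambiguity_set_def)

lemma path_step_measurable: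
  assumes "s + n < horizon M"
  shows "(\<lambda>(\<omega>, a). path_step P s n \<omega> a) \<in> path_space M s n \<Otimes>\<^sub>M action_space M \<rightarrow>\<^sub>M prob_algebra (path_space M s (Suc n))"
proof -
  have "(\<lambda>z. (fst (fst z) (s + n), snd z)) \<in> path_space M s n \<Otimes>\<^sub>M action_space M \<rightarrow>\<^sub>M state_space M \<Otimes>\<^sub>M action_space M"
    by (intro measurable_Pair measurable_compose[OF measurable_fst state_component_measurable] measurable_snd) simp
  from measurable_compose[OF this adversary_measurable[OF _ assms]]
  have "(\<lambda>z. P (s + n) (fst (fst z) (s + n)) (snd z)) \<in> path_space M s n \<Otimes>\<^sub>M action_space M \<rightarrow>\<^sub>M prob_algebra (state_space M)"
    by simp
  from measurable_distr_prob_space2[OF this path_update_measurable]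
  show ?thesis by (simp add: path_step_def case_prod_beta')
qed

lemma path_kernel_measurable:
  assumes "s + n < horizon M"
  shows "(\<lambda>\<omega>. policy M (s + n) \<theta> (fst \<omega> (s + n)) \<bind> path_step P s n \<omega>) \<in> path_space M s n \<rightarrow>\<^sub>M prob_algebra (path_space M s (Suc n))"
  by (rule measurable_bind_prob_space2[OF measurable_compose[OF state_component_measurable policy_measurable[OF assms]] path_step_measurable[OF assms]]) simp

lemma path_law_prob:
  assumes "x \<in> states M" "s + n \<le> horizon M"
  shows "path_law M P \<theta> s x n \<in> space (prob_algebra (path_space M s n))"
  using assms(2)
proof (induction n)
  case 0
  have "((\<lambda>i\<in>{s}. x), (\<lambda>i. undefined)) \<in> space (path_space M s 0)"
    using assms(1) by (auto simp: path_space_def space_pair_measure space_PiM space_restrict_space)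
  then show ?case
    using measurable_space[OF measurable_return_prob_space] by simp
next
  case (Suc n)
  then have n: "s + n < horizon M" and IH: "path_law M P \<theta> s x n \<in> space (prob_algebra (path_space M s n))" by auto
  show ?case
    unfolding path_law_Suc space_prob_algebra
    using prob_space_bind'[OF IH path_kernel_measurable[OF n]] sets_bind'[OF IH path_kernel_measurable[OF n]] by simp
qed

text \<open>The one-stage value under the adversary's own kernel, to be compared with
  \<open>stage_dual\<close>. As P is only Borel in (x, a), this function is handled by measurability
  rather than continuity.\<close>

definition stage_value :: "nat \<Rightarrow> real ^ 'd \<Rightarrow> real ^ 'm \<Rightarrow> real" where
  "stage_value l x a = (\<integral>y. run_reward M l x a y + value_at (Suc l) y \<partial>P l x a)"

text \<open>Integrand and kernel both depend on (x, a). Pushing the kernel forward under the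
  integrand yields a measurable family of laws on the reals, whose means are then
  measurable.\<close>

lemma stage_value_measurable:
  assumes "s \<le> l" "l < horizon M"
  shows "(\<lambda>(x, a). stage_value l x a) \<in> borel_measurable (state_space M \<Otimes>\<^sub>M action_space M)"
proof -
  let ?S = "state_space M \<Otimes>\<^sub>M action_space M"
  have m: "(\<lambda>w. run_reward M l (fst (fst w)) (snd (fst w)) (snd w) + value_at (Suc l) (snd w)) \<in> borel_measurable (?S \<Otimes>\<^sub>M state_space M)"
    by (intro borel_measurable_add run_reward_measurable assms measurable_compose[OF measurable_snd value_at_measurable]) measurable
  have "(\<lambda>z. distr (case z of (x, a) \<Rightarrow> P l x a) borel (\<lambda>y. run_reward M l (fst z) (snd z) y + value_at (Suc l) y)) \<in> ?S \<rightarrow>\<^sub>M prob_algebra borel"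
    using m by (intro measurable_distr_prob_space2[OF adversary_measurable[OF assms]]) (simp add: case_prod_beta')
  from measurable_compose[OF measurable_prob_algebraD[OF this] integral_measurable_subprob_algebra[of "\<lambda>v::real. v"]]
  have "(\<lambda>z. \<integral>v. v \<partial>distr (case z of (x, a) \<Rightarrow> P l x a) borel (\<lambda>y. run_reward M l (fst z) (snd z) y + value_at (Suc l) y)) \<in> borel_measurable ?S"
    by simp
  moreover have "(\<integral>v. v \<partial>distr (case z of (x, a) \<Rightarrow> P l x a) borel (\<lambda>y. run_reward M l (fst z) (snd z) y + value_at (Suc l) y)) =
      (case z of (x, a) \<Rightarrow> stage_value l x a)" if "z \<in> space ?S" for z
  proof -
    have z: "fst z \<in> states M" "snd z \<in> actions M"
      using that by (auto simp: space_pair_measure space_restrict_space)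
    have "(\<lambda>y. run_reward M l (fst z) (snd z) y + value_at (Suc l) y) \<in> borel_measurable (P l (fst z) (snd z))"
      using z by (intro borel_measurable_prob_measures[OF adversary_mem(2)[OF assms z]])
        (auto intro!: continuous_intros continuous_on_value_at run_cont_comp[OF assms(2)])
    then show ?thesis
      by (simp add: case_prod_beta' stage_value_def integral_distr)
  qed
  ultimately show ?thesis by (subst measurable_cong[symmetric]) auto
qed

lemma stage_value_bounded:
  assumes "s \<le> l" "l < horizon M"
  shows "\<exists>B. \<forall>x\<in>states M. \<forall>a\<in>actions M. \<bar>stage_value l x a\<bar> \<le> B"
proof -
  have "continuous_on (states M \<times> actions M \<times> states M) (\<lambda>z. run_reward M l (fst z) (fst (snd z)) (snd (snd z)) + value_at (Suc l) (snd (snd z)))"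
    by (auto intro!: continuous_intros run_cont_comp[OF assms(2)] continuous_on_compose2[OF continuous_on_value_at])
  then obtain B where B: "\<And>z. z \<in> states M \<times> actions M \<times> states M \<Longrightarrow>
      \<bar>run_reward M l (fst z) (fst (snd z)) (snd (snd z)) + value_at (Suc l) (snd (snd z))\<bar> \<le> B"
    using compact_real_bound[OF compact_Times[OF compact_states(1) compact_Times[OF compact_actions compact_states(1)]]] by blast
  have "\<bar>stage_value l x a\<bar> \<le> B" if "x \<in> states M" "a \<in> actions M" for x a
    unfolding stage_value_def
    using B[of "(x, a, _)"] that
    by (intro integral_prob_measures_bound[OF compact_states(1) adversary_mem(2)[OF assms that]])
      (auto intro!: continuous_intros continuous_on_value_at run_cont_comp[OF assms(2)])
  then show ?thesis by blast
qed

lemma stage_value_slice: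
  assumes "s \<le> l" "l < horizon M" "x \<in> states M"
  shows "stage_value l x \<in> borel_measurable (policy M l \<theta> x)" "integrable (policy M l \<theta> x) (stage_value l x)"
proof -
  note pol = prob_measuresD[OF policy_prob[OF assms(2,3)]]
  interpret prob_space "policy M l \<theta> x" by (rule pol(3))
  have "Pair x \<in> action_space M \<rightarrow>\<^sub>M state_space M \<Otimes>\<^sub>M action_space M"
    using assms(3) by (intro measurable_Pair1') (simp add: space_restrict_space)
  from measurable_compose[OF this stage_value_measurable[OF assms(1,2)]]
  show m: "stage_value l x \<in> borel_measurable (policy M l \<theta> x)"
    using pol(1) by (simp cong: measurable_cong_sets)
  obtain B where "\<forall>x\<in>states M. \<forall>a\<in>actions M. \<bar>stage_value l x a\<bar> \<le> B"
    using stage_value_bounded[OF assms(1,2)] by blast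
  then show "integrable (policy M l \<theta> x) (stage_value l x)"
    using m pol(2) assms(3) by (intro integrable_const_bound[where B=B]) auto
qed

definition mean_stage_value :: "nat \<Rightarrow> real ^ 'd \<Rightarrow> real" where
  "mean_stage_value l x = (\<integral>a. stage_value l x a \<partial>policy M l \<theta> x)"

lemma path_step_integral:
  assumes n: "s + n < horizon M" and \<omega>: "\<omega> \<in> space (path_space M s n)" and a: "a \<in> actions M"
  shows "(\<integral>\<omega>'. path_total s (Suc n) \<omega>' \<partial>path_step P s n \<omega> a) =
    (\<Sum>l=s..<s + n. run_reward M l (fst \<omega> l) (snd \<omega> l) (fst \<omega> (Suc l))) + stage_value (s + n) (fst \<omega> (s + n)) a"
proof -
  have x: "fst \<omega> (s + n) \<in> states M" using state_component_mem[OF \<omega>] by simp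
  have "s \<le> s + n" by simp
  note Pm = adversary_mem(2)[OF this n x a]
  interpret prob_space "P (s + n) (fst \<omega> (s + n)) a" by (rule prob_measuresD(3)[OF Pm])
  have "(\<omega>, a) \<in> space (path_space M s n \<Otimes>\<^sub>M action_space M)"
    using \<omega> a by (simp add: space_pair_measure space_restrict_space)
  then have "Pair (\<omega>, a) \<in> state_space M \<rightarrow>\<^sub>M (path_space M s n \<Otimes>\<^sub>M action_space M) \<Otimes>\<^sub>M state_space M"
    by (rule measurable_Pair1')
  from measurable_compose[OF this path_update_measurable]
  have upd: "(\<lambda>y. ((fst \<omega>)(Suc (s + n) := y), (snd \<omega>)(s + n := a))) \<in> P (s + n) (fst \<omega> (s + n)) a \<rightarrow>\<^sub>M path_space M s (Suc n)"
    using prob_measuresD(1)[OF Pm] by (simp cong: measurable_cong_sets)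
  have int: "integrable (P (s + n) (fst \<omega> (s + n)) a) (\<lambda>y. run_reward M (s + n) (fst \<omega> (s + n)) a y + value_at (Suc (s + n)) y)"
    using x a by (intro integrable_prob_measures[OF compact_states(1) Pm])
      (auto intro!: continuous_intros continuous_on_value_at run_cont_comp[OF n])
  have total: "path_total s (Suc n) ((fst \<omega>)(Suc (s + n) := y), (snd \<omega>)(s + n := a)) =
      (\<Sum>l=s..<s + n. run_reward M l (fst \<omega> l) (snd \<omega> l) (fst \<omega> (Suc l))) +
      (run_reward M (s + n) (fst \<omega> (s + n)) a y + value_at (Suc (s + n)) y)" for y
    unfolding path_total_def by (simp add: sum.atLeastLessThan_Suc)
  have "(\<integral>\<omega>'. path_total s (Suc n) \<omega>' \<partial>path_step P s n \<omega> a) =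
      (\<integral>y. path_total s (Suc n) ((fst \<omega>)(Suc (s + n) := y), (snd \<omega>)(s + n := a)) \<partial>P (s + n) (fst \<omega> (s + n)) a)"
    unfolding path_step_def using n by (intro integral_distr upd path_total_measurable) simp
  also have "\<dots> = (\<Sum>l=s..<s + n. run_reward M l (fst \<omega> l) (snd \<omega> l) (fst \<omega> (Suc l))) + stage_value (s + n) (fst \<omega> (s + n)) a"
    unfolding total stage_value_def using int by (simp add: prob_space)
  finally show ?thesis .
qed

text \<open>Integrates out the last stage: its reward and the terminal iterate collapse to the mean
  stage value of the state before it.\<close>

lemma path_total_integral_Suc:
  assumes x: "x \<in> states M" and n: "s + n < horizon M"
  shows "(\<integral>\<omega>. path_total s (Suc n) \<omega> \<partial>path_law M P \<theta> s x (Suc n)) =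
    (\<integral>\<omega>. (\<Sum>l=s..<s + n. run_reward M l (fst \<omega> l) (snd \<omega> l) (fst \<omega> (Suc l))) + mean_stage_value (s + n) (fst \<omega> (s + n)) \<partial>path_law M P \<theta> s x n)"
proof -
  have law: "path_law M P \<theta> s x n \<in> space (prob_algebra (path_space M s n))"
    using n by (intro path_law_prob x) simp
  have law_sets: "sets (path_law M P \<theta> s x n) = sets (path_space M s n)"
    and law_prob: "prob_space (path_law M P \<theta> s x n)"
    using law by (auto simp: space_prob_algebra)
  have law_space: "space (path_law M P \<theta> s x n) = space (path_space M s n)"
    by (rule sets_eq_imp_space_eq[OF law_sets])
  have n': "s + Suc n \<le> horizon M" using n by simp
  note total_m = path_total_measurable[OF n']
  obtain B where B: "\<And>\<omega>. \<omega> \<in> space (path_space M s (Suc n)) \<Longrightarrow> \<bar>path_total s (Suc n) \<omega>\<bar> \<le> B"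
    using path_total_bounded[OF n'] by blast
  have k: "(\<lambda>\<omega>. policy M (s + n) \<theta> (fst \<omega> (s + n)) \<bind> path_step P s n \<omega>) \<in> path_law M P \<theta> s x n \<rightarrow>\<^sub>M prob_algebra (path_space M s (Suc n))"
    using path_kernel_measurable[OF n] law_sets by (simp cong: measurable_cong_sets)
  have "(\<integral>\<omega>. path_total s (Suc n) \<omega> \<partial>path_law M P \<theta> s x (Suc n)) =
      (\<integral>\<omega>. (\<integral>\<omega>'. path_total s (Suc n) \<omega>' \<partial>(policy M (s + n) \<theta> (fst \<omega> (s + n)) \<bind> path_step P s n \<omega>)) \<partial>path_law M P \<theta> s x n)"
    unfolding path_law_Suc
  proof (rule integral_bind[OF total_m B measurable_prob_algebraD[OF k], where B'=1])
    show "finite_measure (path_law M P \<theta> s x n)" using law_prob by (simp add: prob_space_def)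
    show "AE \<omega> in path_law M P \<theta> s x n. emeasure (policy M (s + n) \<theta> (fst \<omega> (s + n)) \<bind> path_step P s n \<omega>)
        (space (policy M (s + n) \<theta> (fst \<omega> (s + n)) \<bind> path_step P s n \<omega>)) \<le> ennreal 1"
      using measurable_space[OF k] by (intro AE_I2) (simp add: space_prob_algebra prob_space.emeasure_space_1)
  qed
  also have "\<dots> = (\<integral>\<omega>. (\<Sum>l=s..<s + n. run_reward M l (fst \<omega> l) (snd \<omega> l) (fst \<omega> (Suc l))) + mean_stage_value (s + n) (fst \<omega> (s + n)) \<partial>path_law M P \<theta> s x n)"
  proof (rule Bochner_Integration.integral_cong[OF refl])
    fix \<omega> assume "\<omega> \<in> space (path_law M P \<theta> s x n)"
    then have \<omega>: "\<omega> \<in> space (path_space M s n)" by (simp add: law_space)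
    have y: "fst \<omega> (s + n) \<in> states M" using state_component_mem[OF \<omega>] by simp
    note pol = prob_measuresD[OF policy_prob[OF n y]]
    interpret pol: prob_space "policy M (s + n) \<theta> (fst \<omega> (s + n))" by (rule pol(3))
    have "Pair \<omega> \<in> action_space M \<rightarrow>\<^sub>M path_space M s n \<Otimes>\<^sub>M action_space M"
      using \<omega> by (rule measurable_Pair1')
    from measurable_compose[OF this path_step_measurable[OF n]]
    have k': "path_step P s n \<omega> \<in> policy M (s + n) \<theta> (fst \<omega> (s + n)) \<rightarrow>\<^sub>M prob_algebra (path_space M s (Suc n))"
      using pol(1) by (simp cong: measurable_cong_sets)
    have "(\<integral>\<omega>'. path_total s (Suc n) \<omega>' \<partial>(policy M (s + n) \<theta> (fst \<omega> (s + n)) \<bind> path_step P s n \<omega>)) =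
        (\<integral>a. (\<integral>\<omega>'. path_total s (Suc n) \<omega>' \<partial>path_step P s n \<omega> a) \<partial>policy M (s + n) \<theta> (fst \<omega> (s + n)))"
    proof (rule integral_bind[OF total_m B measurable_prob_algebraD[OF k'], where B'=1])
      show "AE a in policy M (s + n) \<theta> (fst \<omega> (s + n)). emeasure (path_step P s n \<omega> a) (space (path_step P s n \<omega> a)) \<le> ennreal 1"
        using measurable_space[OF k'] by (intro AE_I2) (simp add: space_prob_algebra prob_space.emeasure_space_1)
    qed (auto intro: pol.finite_measure_axioms)
    also have "\<dots> = (\<integral>a. (\<Sum>l=s..<s + n. run_reward M l (fst \<omega> l) (snd \<omega> l) (fst \<omega> (Suc l))) + stage_value (s + n) (fst \<omega> (s + n)) a \<partial>policy M (s + n) \<theta> (fst \<omega> (s + n)))"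
      using pol(2) path_step_integral[OF n \<omega>] by (intro Bochner_Integration.integral_cong) auto
    also have "\<dots> = (\<Sum>l=s..<s + n. run_reward M l (fst \<omega> l) (snd \<omega> l) (fst \<omega> (Suc l))) + mean_stage_value (s + n) (fst \<omega> (s + n))"
      unfolding mean_stage_value_def using stage_value_slice(2)[OF _ n y] by (simp add: pol.prob_space)
    finally show "(\<integral>\<omega>'. path_total s (Suc n) \<omega>' \<partial>(policy M (s + n) \<theta> (fst \<omega> (s + n)) \<bind> path_step P s n \<omega>)) =
      (\<Sum>l=s..<s + n. run_reward M l (fst \<omega> l) (snd \<omega> l) (fst \<omega> (Suc l))) + mean_stage_value (s + n) (fst \<omega> (s + n))" .
  qed
  finally show ?thesis .
qed

lemma mean_stage_value_measurable:
  assumes "s \<le> l" "l < horizon M"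
  shows "mean_stage_value l \<in> borel_measurable (state_space M)"
proof -
  have "(\<lambda>x. distr (policy M l \<theta> x) borel (stage_value l x)) \<in> state_space M \<rightarrow>\<^sub>M prob_algebra borel"
    by (rule measurable_distr_prob_space2[OF policy_measurable[OF assms(2)] stage_value_measurable[OF assms]])
  from measurable_compose[OF measurable_prob_algebraD[OF this] integral_measurable_subprob_algebra[of "\<lambda>v::real. v"]]
  have "(\<lambda>x. \<integral>v. v \<partial>distr (policy M l \<theta> x) borel (stage_value l x)) \<in> borel_measurable (state_space M)"
    by simp
  moreover have "(\<integral>v. v \<partial>distr (policy M l \<theta> x) borel (stage_value l x)) = mean_stage_value l x" if "x \<in> space (state_space M)" for x
    using that stage_value_slice(1)[OF assms, of x]
    by (simp add: mean_stage_value_def integral_distr space_restrict_space)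
  ultimately show ?thesis by (subst measurable_cong[symmetric]) auto
qed

text \<open>The one-stage comparison averaged over the policy: weak duality bounds every admissible
  kernel from below by the dual, and near-optimality reverses this up to \<delta>.\<close>

lemma value_at_le_mean_stage_value:
  assumes l: "s \<le> l" "l < horizon M" and x: "x \<in> states M"
  shows "value_at l x \<le> mean_stage_value l x"
    and "(\<And>a. a \<in> actions M \<Longrightarrow> stage_value l x a \<le> stage_dual l (value_at (Suc l)) x a + \<delta>) \<Longrightarrow>
      mean_stage_value l x \<le> value_at l x + \<delta>"
proof -
  note pol = policy_prob[OF l(2) x]
  interpret pol: prob_space "policy M l \<theta> x" by (rule prob_measuresD(3)[OF pol])
  have "continuous_on (actions M) (stage_dual l (value_at (Suc l)) x)"
    by (rule continuous_on_slice[OF continuous_on_stage_dual[OF l(2) continuous_on_value_at] x])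
  then have int: "integrable (policy M l \<theta> x) (stage_dual l (value_at (Suc l)) x)"
    by (rule integrable_prob_measures[OF compact_actions pol])
  show "value_at l x \<le> mean_stage_value l x"
    unfolding value_at_step[OF l(2)] mean_stage_value_def
  proof (rule integral_mono[OF int stage_value_slice(2)[OF l x]])
    fix a assume "a \<in> space (policy M l \<theta> x)"
    then have a: "a \<in> actions M" using prob_measuresD(2)[OF pol] by simp
    show "stage_dual l (value_at (Suc l)) x a \<le> stage_value l x a"
      unfolding stage_value_def
      by (rule stage_dual_le[OF l(2) continuous_on_value_at x a adversary_mem(1)[OF l x a]])
  qed
  assume "\<And>a. a \<in> actions M \<Longrightarrow> stage_value l x a \<le> stage_dual l (value_at (Suc l)) x a + \<delta>"
  then have "mean_stage_value l x \<le> (\<integral>a. stage_dual l (value_at (Suc l)) x a + \<delta> \<partial>policy M l \<theta> x)"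
    unfolding mean_stage_value_def using int prob_measuresD(2)[OF pol]
    by (intro integral_mono stage_value_slice(2)[OF l x]) auto
  also have "\<dots> = value_at l x + \<delta>"
    unfolding value_at_step[OF l(2)] using int by (simp add: pol.prob_space)
  finally show "mean_stage_value l x \<le> value_at l x + \<delta>" .
qed

text \<open>Extending the path by a stage never lowers the expected total, whatever the adversary,
  and raises it by at most \<delta> if the adversary is near-optimal at each stage. At n = 0 the law
  is a point mass and the total is \<open>value_at s x\<close>.\<close>

lemma path_total_integral_bounds:
  assumes x: "x \<in> states M" and "s + n \<le> horizon M"
  shows "value_at s x \<le> (\<integral>\<omega>. path_total s n \<omega> \<partial>path_law M P \<theta> s x n)"
    and "(\<And>l x a. l \<in> {s..<horizon M} \<Longrightarrow> x \<in> states M \<Longrightarrow> a \<in> actions M \<Longrightarrow>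
        stage_value l x a \<le> stage_dual l (value_at (Suc l)) x a + \<delta>) \<Longrightarrow>
      (\<integral>\<omega>. path_total s n \<omega> \<partial>path_law M P \<theta> s x n) \<le> value_at s x + n * \<delta>"
proof -
  let ?I = "\<lambda>n. \<integral>\<omega>. path_total s n \<omega> \<partial>path_law M P \<theta> s x n"
  have base: "?I 0 = value_at s x"
  proof -
    have "((\<lambda>i\<in>{s}. x), (\<lambda>i. undefined)) \<in> space (path_space M s 0)"
      using x by (auto simp: path_space_def space_pair_measure space_PiM space_restrict_space)
    then have "?I 0 = path_total s 0 ((\<lambda>i\<in>{s}. x), (\<lambda>i. undefined))"
      unfolding path_law.simps using assms(2) by (intro integral_return path_total_measurable) auto
    then show ?thesis by (simp add: path_total_def)
  qed
  have step: "?I n \<le> ?I (Suc n)"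
    "(\<And>l x a. l \<in> {s..<horizon M} \<Longrightarrow> x \<in> states M \<Longrightarrow> a \<in> actions M \<Longrightarrow>
        stage_value l x a \<le> stage_dual l (value_at (Suc l)) x a + \<delta>) \<Longrightarrow> ?I (Suc n) \<le> ?I n + \<delta>"
    if n: "s + n < horizon M" for n
  proof -
    let ?R = "\<lambda>\<omega>. \<Sum>l=s..<s + n. run_reward M l (fst \<omega> l) (snd \<omega> l) (fst \<omega> (Suc l))"
    have n': "s + n \<le> horizon M" using n by simp
    have law: "path_law M P \<theta> s x n \<in> space (prob_algebra (path_space M s n))"
      by (rule path_law_prob[OF x n'])
    have law_sets [measurable_cong]: "sets (path_law M P \<theta> s x n) = sets (path_space M s n)"
      and law_prob: "prob_space (path_law M P \<theta> s x n)"
      using law by (auto simp: space_prob_algebra)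
    have law_space: "space (path_law M P \<theta> s x n) = space (path_space M s n)"
      by (rule sets_eq_imp_space_eq[OF law_sets])
    interpret law: prob_space "path_law M P \<theta> s x n" by (rule law_prob)
    obtain B where B: "\<forall>\<omega>\<in>space (path_space M s n). \<bar>path_total s n \<omega>\<bar> \<le> B"
      using path_total_bounded[OF n'] by blast
    have int: "integrable (path_law M P \<theta> s x n) (path_total s n)"
      using B path_total_measurable[OF n'] law_space
      by (intro law.integrable_const_bound[where B=B]) (auto cong: measurable_cong_sets[OF law_sets])
    obtain B1 where B1: "\<forall>\<omega>\<in>space (path_space M s n). \<bar>?R \<omega>\<bar> \<le> B1"
      using running_total_bounded[OF n'] by blast
    obtain B2 where B2: "\<forall>x\<in>states M. \<forall>a\<in>actions M. \<bar>stage_value (s + n) x a\<bar> \<le> B2"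
      using stage_value_bounded[OF _ n] by auto
    have mean_bound: "\<bar>mean_stage_value (s + n) y\<bar> \<le> B2" if y: "y \<in> states M" for y
    proof -
      note pol = prob_measuresD[OF policy_prob[OF n y]]
      interpret pol: prob_space "policy M (s + n) \<theta> y" by (rule pol(3))
      have "\<bar>mean_stage_value (s + n) y\<bar> \<le> (\<integral>a. \<bar>stage_value (s + n) y a\<bar> \<partial>policy M (s + n) \<theta> y)"
        unfolding mean_stage_value_def by (rule integral_abs_bound)
      also have "\<dots> \<le> (\<integral>a. B2 \<partial>policy M (s + n) \<theta> y)"
        using B2 y pol(2) stage_value_slice(2)[OF _ n y] by (intro integral_mono integrable_abs) auto
      finally show ?thesis by (simp add: pol.prob_space)
    qed
    have int': "integrable (path_law M P \<theta> s x n) (\<lambda>\<omega>. ?R \<omega> + mean_stage_value (s + n) (fst \<omega> (s + n)))"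
    proof (rule law.integrable_const_bound[where B="B1 + B2"])
      have "(\<lambda>\<omega>. ?R \<omega> + mean_stage_value (s + n) (fst \<omega> (s + n))) \<in> borel_measurable (path_space M s n)"
        using n by (intro borel_measurable_add running_total_measurable[OF n']
            measurable_compose[OF state_component_measurable mean_stage_value_measurable]) auto
      then show "(\<lambda>\<omega>. ?R \<omega> + mean_stage_value (s + n) (fst \<omega> (s + n))) \<in> borel_measurable (path_law M P \<theta> s x n)"
        by (simp cong: measurable_cong_sets[OF law_sets])
      show "AE \<omega> in path_law M P \<theta> s x n. norm (?R \<omega> + mean_stage_value (s + n) (fst \<omega> (s + n))) \<le> B1 + B2"
      proof (rule AE_I2)
        fix \<omega> assume "\<omega> \<in> space (path_law M P \<theta> s x n)"
        then have \<omega>: "\<omega> \<in> space (path_space M s n)" by (simp add: law_space)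
        have "fst \<omega> (s + n) \<in> states M" using state_component_mem[OF \<omega>] by simp
        then show "norm (?R \<omega> + mean_stage_value (s + n) (fst \<omega> (s + n))) \<le> B1 + B2"
          using bspec[OF B1 \<omega>] mean_bound[of "fst \<omega> (s + n)"] by simp
      qed
    qed
    have mem: "fst \<omega> (s + n) \<in> states M" if "\<omega> \<in> space (path_law M P \<theta> s x n)" for \<omega>
      using state_component_mem[of \<omega> s n "s + n"] that by (simp add: law_space)
    show "?I n \<le> ?I (Suc n)"
      unfolding path_total_integral_Suc[OF x n]
      using value_at_le_mean_stage_value(1)[OF _ n mem]
      by (intro integral_mono[OF int int']) (simp add: path_total_def)
    assume near: "\<And>l x a. l \<in> {s..<horizon M} \<Longrightarrow> x \<in> states M \<Longrightarrow> a \<in> actions M \<Longrightarrow>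
        stage_value l x a \<le> stage_dual l (value_at (Suc l)) x a + \<delta>"
    have "?I (Suc n) \<le> (\<integral>\<omega>. path_total s n \<omega> + \<delta> \<partial>path_law M P \<theta> s x n)"
      unfolding path_total_integral_Suc[OF x n]
    proof (rule integral_mono[OF int'])
      fix \<omega> assume \<omega>: "\<omega> \<in> space (path_law M P \<theta> s x n)"
      have "mean_stage_value (s + n) (fst \<omega> (s + n)) \<le> value_at (s + n) (fst \<omega> (s + n)) + \<delta>"
        using near[OF _ mem[OF \<omega>], of "s + n"] n by (intro value_at_le_mean_stage_value(2) mem[OF \<omega>]) auto
      then show "?R \<omega> + mean_stage_value (s + n) (fst \<omega> (s + n)) \<le> path_total s n \<omega> + \<delta>"
        by (simp add: path_total_def)
    qed (use int in simp)
    also have "\<dots> = ?I n + \<delta>" using int by (simp add: law.prob_space)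
    finally show "?I (Suc n) \<le> ?I n + \<delta>" .
  qed
  show "value_at s x \<le> ?I n"
    using assms(2)
  proof (induction n)
    case (Suc n)
    then show ?case using step(1)[of n] by simp
  qed (simp add: base del: path_law.simps)
  assume near: "\<And>l x a. l \<in> {s..<horizon M} \<Longrightarrow> x \<in> states M \<Longrightarrow> a \<in> actions M \<Longrightarrow>
      stage_value l x a \<le> stage_dual l (value_at (Suc l)) x a + \<delta>"
  show "?I n \<le> value_at s x + n * \<delta>"
    using assms(2)
  proof (induction n)
    case (Suc n)
    then have "?I (Suc n) \<le> ?I n + \<delta>" by (intro step(2) near) auto
    then show ?case using Suc by (simp add: algebra_simps)
  qed (simp add: base del: path_law.simps)
qed

end

text \<open>With N stages left, every adversary yields at least the iterated value, while stagewise
  \<delta>-optimal kernels yield at most N * \<delta> more. These kernels also show that the infimum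
  is over a nonempty set.\<close>

lemma robust_value_eq_value_at:
  assumes s: "s \<le> horizon M" and x: "x \<in> states M"
  shows "robust_value M s \<theta> x = value_at s x"
proof -
  define N where "N = horizon M - s"
  have N: "s + N = horizon M" using s by (simp add: N_def)
  let ?I = "\<lambda>P. \<integral>\<omega>. path_total s N \<omega> \<partial>path_law M P \<theta> s x N"
  have rv: "robust_value M s \<theta> x = (INF P\<in>adversary_kernels M s. ?I P)"
    unfolding robust_value_def path_total_def N N_def[symmetric] value_at_horizon by (simp add: case_prod_beta')
  have lower: "value_at s x \<le> ?I P" if "P \<in> adversary_kernels M s" for P
    using path_total_integral_bounds(1)[OF that x] N by simp
  have near: "\<exists>P\<in>adversary_kernels M s. ?I P \<le> value_at s x + N * \<delta>" if \<delta>: "\<delta> > 0" for \<delta> :: real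
  proof -
    have "\<forall>l\<in>{s..<horizon M}. \<exists>P. (\<lambda>(x, a). P x a) \<in> state_space M \<Otimes>\<^sub>M action_space M \<rightarrow>\<^sub>M prob_algebra (state_space M) \<and>
      (\<forall>x\<in>states M. \<forall>a\<in>actions M. P x a \<in> ambiguity_set M l x a \<and>
        (\<integral>y. run_reward M l x a y + value_at (Suc l) y \<partial>P x a) \<le> stage_dual l (value_at (Suc l)) x a + \<delta>)"
      by (intro ballI stage_near_optimal continuous_on_value_at \<delta>) simp
    from bchoice[OF this] obtain P where P: "\<forall>l\<in>{s..<horizon M}.
      (\<lambda>(x, a). P l x a) \<in> state_space M \<Otimes>\<^sub>M action_space M \<rightarrow>\<^sub>M prob_algebra (state_space M) \<and>
      (\<forall>x\<in>states M. \<forall>a\<in>actions M. P l x a \<in> ambiguity_set M l x a \<and>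
        (\<integral>y. run_reward M l x a y + value_at (Suc l) y \<partial>P l x a) \<le> stage_dual l (value_at (Suc l)) x a + \<delta>)"
      by (elim exE)
    have adv: "P \<in> adversary_kernels M s"
      unfolding adversary_kernels_def using P by blast
    have "?I P \<le> value_at s x + N * \<delta>"
      using P N by (intro path_total_integral_bounds(2)[OF adv x]) (auto simp: stage_value_def[OF adv])
    with adv show ?thesis by blast
  qed
  have ne: "adversary_kernels M s \<noteq> {}" using near[of 1] by auto
  show ?thesis
    unfolding rv
  proof (rule antisym)
    show "value_at s x \<le> (INF P\<in>adversary_kernels M s. ?I P)"
      by (intro cINF_greatest ne lower)
    show "(INF P\<in>adversary_kernels M s. ?I P) \<le> value_at s x"
    proof (rule field_le_epsilon)
      fix e :: real assume e: "e > 0"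
      \<comment> \<open>The divisor N + 1 covers N = 0, where no stage remains.\<close>
      then obtain P where P: "P \<in> adversary_kernels M s" "?I P \<le> value_at s x + N * (e / (N + 1))"
        using near[of "e / (N + 1)"] by auto
      have "N * (e / (N + 1)) \<le> e" using e by (simp add: field_simps)
      then have "?I P \<le> value_at s x + e" using P(2) by linarith
      then show "(INF P\<in>adversary_kernels M s. ?I P) \<le> value_at s x + e"
        using lower P(1) by (intro cINF_lower2[of _ _ P] bdd_belowI[of _ "value_at s x"]) auto
    qed
  qed
qed

lemma continuous_on_robust_value:
  assumes "s \<le> horizon M"
  shows "continuous_on (states M) (robust_value M s \<theta>)"
  using continuous_on_value_at[of s] robust_value_eq_value_at[OF assms] by (simp cong: continuous_on_cong)

end

section \<open>Envelope theorem for the robust action value\<close>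

text \<open>Danskin's theorem for the ball, with the integrals of \<open>F h\<close>,
  \<open>F 0\<close> and \<open>DV\<close> as functionals. A sup-norm error of the value quotients
  bounds the error of their integrals under every probability measure, which gives uniformity over
  the ball.\<close>

lemma robust_action_value_right_derivative:
  fixes M :: "('d::finite, 'm::finite, 'p::finite) robust_mdp"
    and t :: nat and x :: "real ^ 'd" and a :: "real ^ 'm" and \<theta> r :: "real ^ 'p"
  assumes mdp: "\<And>\<theta>'. \<theta>' \<in> params M \<Longrightarrow> continuous_robust_mdp M \<theta>'"
    and t: "t < horizon M" and x: "x \<in> states M" and a: "a \<in> actions M"
    and int: "\<theta> \<in> interior (params M)"
    and unif: "uniform_limit (states M)
      (\<lambda>h y. (robust_value M (Suc t) (\<theta> + h *\<^sub>R r) y - robust_value M (Suc t) \<theta> y) / h) DV (at_right 0)"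
    and DV: "continuous_on (states M) DV"
  shows "\<exists>P. is_arg_min (\<lambda>P. \<integral>y. DV y \<partial>P) (\<lambda>P. P \<in> worst_case_measures M t x a \<theta>) P \<and>
    has_right_dir_deriv (\<lambda>\<theta>. robust_action_value M t \<theta> x a) \<theta> r (\<integral>y. DV y \<partial>P)"
proof -
  interpret continuous_robust_mdp M \<theta> using int interior_subset by (intro mdp) blast
  define V where "V h = robust_value M (Suc t) (\<theta> + h *\<^sub>R r)" for h
  define F where "F h y = run_reward M t x a y + V h y" for h y
  define B where "B = ambiguity_set M t x a"
  have V0: "V 0 = robust_value M (Suc t) \<theta>" by (simp add: V_def)
  note \<mu> = nominal_prob[OF t x a]
  have BP: "P \<in> \<P> (states M)" if "P \<in> B" for P using that by (simp add: B_def ambiguity_set_def)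
  have V_cont: "continuous_on (states M) (V h)" if "\<theta> + h *\<^sub>R r \<in> params M" for h
    unfolding V_def using t by (intro continuous_robust_mdp.continuous_on_robust_value[OF mdp[OF that]]) simp
  have F_cont: "continuous_on (states M) (F h)" if "continuous_on (states M) (V h)" for h
    unfolding F_def using that x a by (intro continuous_intros run_cont_comp[OF t]) auto
  have V0_cont: "continuous_on (states M) (V 0)"
    using V_cont[of 0] \<theta> by simp
  \<comment> \<open>Interiority keeps \<theta> + h r in the parameter set for small h, where the
    value is continuous and duality turns the action value into an infimum over a ball that does not
    depend on h.\<close>
  have "((\<lambda>h. \<theta> + h *\<^sub>R r) \<longlongrightarrow> \<theta> + 0 *\<^sub>R r) (at_right 0)"
    by (intro tendsto_intros)
  from topological_tendstoD[OF this open_interior]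
  have "\<forall>\<^sub>F h in at_right 0. \<theta> + h *\<^sub>R r \<in> interior (params M)"
    using int by simp
  then have ev_cont: "\<forall>\<^sub>F h in at_right 0. continuous_on (states M) (V h)"
    by (rule eventually_mono) (use interior_subset in \<open>blast intro: V_cont\<close>)
  note duality = transport_duality[OF compact_states \<mu> expo_radius]
  have dual: "robust_action_value M t (\<theta> + h *\<^sub>R r) x a = (INF P\<in>B. \<integral>y. F h y \<partial>P)"
    if "continuous_on (states M) (V h)" for h
    unfolding robust_action_value_eq_dual B_def ambiguity_set_eq_ball
    using duality(2)[OF F_cont[OF that]] by (simp add: F_def[abs_def] V_def)
  obtain P where P: "is_arg_min (\<lambda>P. \<integral>y. DV y \<partial>P) (\<lambda>P. is_arg_min (\<lambda>P. \<integral>y. F 0 y \<partial>P) (\<lambda>P. P \<in> B) P) P"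
    and lim: "((\<lambda>h. ((INF P\<in>B. \<integral>y. F h y \<partial>P) - (INF P\<in>B. \<integral>y. F 0 y \<partial>P)) / h) \<longlongrightarrow> (\<integral>y. DV y \<partial>P)) (at_right 0)"
  proof (rule danskin_right[of B "\<lambda>P. \<integral>y. F 0 y \<partial>P" "\<lambda>P. \<integral>y. DV y \<partial>P" "\<lambda>h P. \<integral>y. F h y \<partial>P"])
    show "B \<noteq> {}"
      using duality(1)[OF DV] by (simp add: B_def ambiguity_set_eq_ball)
    show "\<exists>r Q. strict_mono r \<and> Q \<in> B \<and> (\<lambda>n. \<integral>y. F 0 y \<partial>P (r n)) \<longlonglongrightarrow> (\<integral>y. F 0 y \<partial>Q) \<and>
        (\<lambda>n. \<integral>y. DV y \<partial>P (r n)) \<longlonglongrightarrow> (\<integral>y. DV y \<partial>Q)" if PB: "\<And>n. P n \<in> B" for P :: "nat \<Rightarrow> _"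
    proof -
      have ball: "P n \<in> wasserstein_ball (states M) (expo M) (radius M) (nominal M t x a)" for n
        using PB[of n] by (simp add: B_def ambiguity_set_eq_ball)
      obtain r :: "nat \<Rightarrow> nat" and Q where r: "strict_mono r"
        and Q: "Q \<in> wasserstein_ball (states M) (expo M) (radius M) (nominal M t x a)"
        and lim: "\<And>f :: _ \<Rightarrow> real. continuous_on (states M) f \<Longrightarrow> (\<lambda>n. \<integral>y. f y \<partial>P (r n)) \<longlonglongrightarrow> (\<integral>y. f y \<partial>Q)"
        by (rule wasserstein_ball_sequentially_compact[OF compact_states(1) \<mu> expo_radius, of P, OF ball]) blast
      have "Q \<in> B" using Q by (simp add: B_def ambiguity_set_eq_ball)
      then show ?thesis using r lim[OF F_cont[OF V0_cont]] lim[OF DV] by blast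
    qed
    show "\<forall>\<^sub>F h in at_right 0. bdd_below ((\<lambda>P. \<integral>y. F h y \<partial>P) ` B)"
      using ev_cont
    proof eventually_elim
      case (elim h)
      show ?case
        unfolding B_def ambiguity_set_eq_ball
        by (rule bdd_belowI2) (rule transport_weak_duality[OF compact_states \<mu> expo_radius(1) F_cont[OF elim]])
    qed
    show "uniform_limit B (\<lambda>h P. ((\<integral>y. F h y \<partial>P) - (\<integral>y. F 0 y \<partial>P)) / h) (\<lambda>P. \<integral>y. DV y \<partial>P) (at_right 0)"
    proof (rule uniform_limitI)
      fix e :: real assume e: "e > 0"
      then have "e / 2 > 0" by simp
      from uniform_limitD[OF unif this] ev_cont
      show "\<forall>\<^sub>F h in at_right 0. \<forall>P\<in>B. dist (((\<integral>y. F h y \<partial>P) - (\<integral>y. F 0 y \<partial>P)) / h) (\<integral>y. DV y \<partial>P) < e"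
      proof eventually_elim
        case (elim h)
        show ?case
        proof
          fix P assume "P \<in> B"
          note P = BP[OF this]
          have q: "continuous_on (states M) (\<lambda>y. (V h y - V 0 y) * inverse h)"
            by (intro continuous_intros elim(2) V0_cont)
          have "((\<integral>y. F h y \<partial>P) - (\<integral>y. F 0 y \<partial>P)) / h = (\<integral>y. F h y - F 0 y \<partial>P) * inverse h"
            using integrable_prob_measures[OF compact_states(1) P F_cont[OF elim(2)]]
              integrable_prob_measures[OF compact_states(1) P F_cont[OF V0_cont]]
            by (simp add: divide_inverse)
          also have "\<dots> = (\<integral>y. (V h y - V 0 y) * inverse h \<partial>P)"
            by (simp add: F_def)
          finally have "dist (((\<integral>y. F h y \<partial>P) - (\<integral>y. F 0 y \<partial>P)) / h) (\<integral>y. DV y \<partial>P) =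
              \<bar>(\<integral>y. (V h y - V 0 y) * inverse h \<partial>P) - (\<integral>y. DV y \<partial>P)\<bar>"
            by (simp add: dist_real_def)
          also have "\<dots> \<le> e / 2"
          proof (rule integral_prob_measures_diff_le[OF compact_states(1) P q DV])
            fix y assume "y \<in> states M"
            from bspec[OF elim(1) this] have "\<bar>(V h y - V 0 y) / h - DV y\<bar> < e / 2"
              unfolding V0 by (simp only: V_def dist_real_def)
            then show "\<bar>(V h y - V 0 y) * inverse h - DV y\<bar> \<le> e / 2"
              unfolding divide_inverse[of "V h y - V 0 y"] by (rule less_imp_le)
          qed
          finally show "dist (((\<integral>y. F h y \<partial>P) - (\<integral>y. F 0 y \<partial>P)) / h) (\<integral>y. DV y \<partial>P) < e"
            using e by simp
        qed
      qed
    qed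
  qed blast
  show ?thesis
  proof (intro exI conjI)
    show "is_arg_min (\<lambda>P. \<integral>y. DV y \<partial>P) (\<lambda>P. P \<in> worst_case_measures M t x a \<theta>) P"
      using P by (simp add: worst_case_measures_def worst_case_objective_def F_def V0 B_def)
    have "\<forall>\<^sub>F h in at_right 0. ((INF P\<in>B. \<integral>y. F h y \<partial>P) - (INF P\<in>B. \<integral>y. F 0 y \<partial>P)) / h =
        (robust_action_value M t (\<theta> + h *\<^sub>R r) x a - robust_action_value M t \<theta> x a) / h"
      using ev_cont by (rule eventually_mono) (use dual dual[OF V0_cont] in simp)
    with lim show "has_right_dir_deriv (\<lambda>\<theta>. robust_action_value M t \<theta> x a) \<theta> r (\<integral>y. DV y \<partial>P)"
      unfolding has_right_dir_deriv_def by (rule Lim_transform_eventually)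
  qed
qed

text \<open>Substituting -h for h reverses the direction and, because the left quotient keeps its
  signed denominator, the sign.\<close>

lemma has_left_dir_deriv_iff_right:
  "has_left_dir_deriv \<phi> \<theta> r L \<longleftrightarrow> has_right_dir_deriv \<phi> \<theta> (- r) (- L)"
proof -
  have "has_left_dir_deriv \<phi> \<theta> r L \<longleftrightarrow> ((\<lambda>h. (\<phi> (\<theta> + (- h) *\<^sub>R r) - \<phi> \<theta>) / (- h)) \<longlongrightarrow> L) (at_right 0)"
    unfolding has_left_dir_deriv_def at_left_minus by (simp add: filterlim_filtermap)
  also have "\<dots> \<longleftrightarrow> ((\<lambda>h. - ((\<phi> (\<theta> + h *\<^sub>R (- r)) - \<phi> \<theta>) / h)) \<longlongrightarrow> - (- L)) (at_right 0)"
    by simp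
  also have "\<dots> \<longleftrightarrow> has_right_dir_deriv \<phi> \<theta> (- r) (- L)"
    unfolding has_right_dir_deriv_def by (simp only: tendsto_minus_cancel_left[symmetric] minus_minus)
  finally show ?thesis .
qed

theorem proposition3p6:
  fixes M :: "('d::finite, 'm::finite, 'p::finite) robust_mdp"
    and t :: nat and x :: "real ^ 'd" and a :: "real ^ 'm" and \<theta> r :: "real ^ 'p"
  assumes "wf_robust_mdp M"
    and "\<forall>s<horizon M. continuous_on (states M \<times> actions M \<times> states M)
           (\<lambda>(x, a, y). run_reward M s x a y)"
    and "continuous_on (states M) (term_reward M)"
    and "\<forall>s<horizon M. weakly_continuous_on (states M \<times> actions M) (states M)
           (\<lambda>(x, a). nominal M s x a)"
    and "regular_policy_class M"
    and "t < horizon M"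
    and "x \<in> states M" and "a \<in> actions M"
    and "\<theta> \<in> interior (params M)"
  shows
    "(\<forall>DV :: real ^ 'd \<Rightarrow> real.
        (\<forall>y\<in>states M. has_right_dir_deriv (\<lambda>\<theta>. robust_value M (Suc t) \<theta> y) \<theta> r (DV y)) \<and>
        uniform_limit (states M)
          (\<lambda>h y. (robust_value M (Suc t) (\<theta> + h *\<^sub>R r) y - robust_value M (Suc t) \<theta> y) / h)
          DV (at_right 0) \<and>
        continuous_on (states M) DV \<longrightarrow>
        (\<exists>P. is_arg_min (\<lambda>P. \<integral>y. DV y \<partial>P) (\<lambda>P. P \<in> worst_case_measures M t x a \<theta>) P \<and>
             has_right_dir_deriv (\<lambda>\<theta>. robust_action_value M t \<theta> x a) \<theta> r (\<integral>y. DV y \<partial>P)))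
     \<and>
     (\<forall>DV :: real ^ 'd \<Rightarrow> real.
        (\<forall>y\<in>states M. has_left_dir_deriv (\<lambda>\<theta>. robust_value M (Suc t) \<theta> y) \<theta> r (DV y)) \<and>
        uniform_limit (states M)
          (\<lambda>h y. (robust_value M (Suc t) (\<theta> + h *\<^sub>R r) y - robust_value M (Suc t) \<theta> y) / h)
          DV (at_left 0) \<and>
        continuous_on (states M) DV \<longrightarrow>
        (\<exists>P. is_arg_max (\<lambda>P. \<integral>y. DV y \<partial>P) (\<lambda>P. P \<in> worst_case_measures M t x a \<theta>) P \<and>
             has_left_dir_deriv (\<lambda>\<theta>. robust_action_value M t \<theta> x a) \<theta> r (\<integral>y. DV y \<partial>P)))"
proof (intro conjI allI impI; elim conjE)
  have mdp: "continuous_robust_mdp M \<theta>'" if "\<theta>' \<in> params M" for \<theta>'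
    by unfold_locales (use assms that in \<open>auto simp: regular_policy_class_def\<close>)
  note right = robust_action_value_right_derivative[OF mdp assms(6-9)]
  fix DV :: "real ^ 'd \<Rightarrow> real"
  let ?q = "\<lambda>r h y. (robust_value M (Suc t) (\<theta> + h *\<^sub>R r) y - robust_value M (Suc t) \<theta> y) / h"
  assume DV: "continuous_on (states M) DV"
  {
    assume "uniform_limit (states M) (?q r) DV (at_right 0)"
    from right[OF _ this DV]
    show "\<exists>P. is_arg_min (\<lambda>P. \<integral>y. DV y \<partial>P) (\<lambda>P. P \<in> worst_case_measures M t x a \<theta>) P \<and>
      has_right_dir_deriv (\<lambda>\<theta>. robust_action_value M t \<theta> x a) \<theta> r (\<integral>y. DV y \<partial>P)" by simp
  next
    assume "uniform_limit (states M) (?q r) DV (at_left 0)"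
    \<comment> \<open>The left hypothesis for r and \<open>DV\<close> is the right hypothesis for -r
      and -DV.\<close>
    then have "uniform_limit (states M) (\<lambda>h. ?q r (- h)) DV (at_right 0)"
      by (simp add: at_left_minus filterlim_filtermap)
    then have "uniform_limit (states M) (\<lambda>h y. - ?q r (- h) y) (\<lambda>y. - DV y) (at_right 0)"
      by (rule uniform_limit_uminus)
    then have "uniform_limit (states M) (?q (- r)) (\<lambda>y. - DV y) (at_right 0)"
      by simp
    from right[OF _ this continuous_on_minus[OF DV]]
    obtain P where P: "is_arg_min (\<lambda>P. \<integral>y. - DV y \<partial>P) (\<lambda>P. P \<in> worst_case_measures M t x a \<theta>) P"
      "has_right_dir_deriv (\<lambda>\<theta>. robust_action_value M t \<theta> x a) \<theta> (- r) (\<integral>y. - DV y \<partial>P)"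
      by auto
    \<comment> \<open>A minimizer of the integral of -DV is a maximizer of that of
      \<open>DV\<close>, which is where the maximum in the left formula comes from.\<close>
    then show "\<exists>P. is_arg_max (\<lambda>P. \<integral>y. DV y \<partial>P) (\<lambda>P. P \<in> worst_case_measures M t x a \<theta>) P \<and>
      has_left_dir_deriv (\<lambda>\<theta>. robust_action_value M t \<theta> x a) \<theta> r (\<integral>y. DV y \<partial>P)"
      by (intro exI[of _ P]) (simp add: is_arg_min_def is_arg_max_def has_left_dir_deriv_iff_right)
  }
qed

end
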